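(* Let $K$ be a commutative Noetherian ring with $1$, let $n\geq 2$, and let $C\leq A_1\times\dots\times A_n$ be a subdirect product of $K$-algebras $A_1,\dots,A_n$ such that $\pi_{ij}(C)$ has finite co-rank in $A_i\times A_j$ for all $1\leq i<j\leq n$. Then $C$ is finitely generated (respectively, finitely presented) if and only if all $A_1,\dots,A_n$ are finitely generated (respectively, finitely presented).
   Context: For $K$ a commutative ring with $1$, a $K$-algebra is a structure which is simultaneously a ring (not necessarily commutative or with $1$) and a $K$-module, such that the ring multiplication is $K$-bilinear. Finitely generated and finitely presented are meant as $K$-algebras in this (not necessarily unital) sense: finitely presented means isomorphic to the quotient of a finitely generated free $K$-algebra (in the variety of such $K$-algebras) by a finitely generated ideal. A $K$-subalgebra $C\leq A_1\times\dots\times A_n$ is a subdirect product if each coordinate projection maps $C$ onto $A_i$. $\pi_{ij}$ denotes the projection onto $A_i\times A_j$. A submodule $N$ of a $K$-module $M$ has finite co-rank in $M$ if $M/N$ is a finitely generated $K$-module; a subalgebra has finite co-rank if it does so as a $K$-submodule. *)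

theory Defs
  imports "HOL-Algebra.Module" "HOL-Algebra.Ring_Divisibility"
begin

text \<open>
  The locale \<^locale>\<open>algebra\<close> demands a commutative unital multiplication.  The algebras
  considered here are associative, but need be neither commutative nor unital.  They are
  carried by the same records; the field \<^const>\<open>one\<close> of such a record is junk and
  plays no role.
\<close>

locale nonunital_algebra = module K A
  for K :: "('k, 'm) ring_scheme" and A :: "('k, 'a, 'n) module_scheme" +
  assumes mult_closed:
      "\<lbrakk>x \<in> carrier A; y \<in> carrier A\<rbrakk> \<Longrightarrow> x \<otimes>\<^bsub>A\<^esub> y \<in> carrier A"
    and mult_assoc:
      "\<lbrakk>x \<in> carrier A; y \<in> carrier A; z \<in> carrier A\<rbrakk> \<Longrightarrow>
        (x \<otimes>\<^bsub>A\<^esub> y) \<otimes>\<^bsub>A\<^esub> z = x \<otimes>\<^bsub>A\<^esub> (y \<otimes>\<^bsub>A\<^esub> z)"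
    and mult_add_left:
      "\<lbrakk>x \<in> carrier A; y \<in> carrier A; z \<in> carrier A\<rbrakk> \<Longrightarrow>
        (x \<oplus>\<^bsub>A\<^esub> y) \<otimes>\<^bsub>A\<^esub> z = x \<otimes>\<^bsub>A\<^esub> z \<oplus>\<^bsub>A\<^esub> y \<otimes>\<^bsub>A\<^esub> z"
    and mult_add_right:
      "\<lbrakk>x \<in> carrier A; y \<in> carrier A; z \<in> carrier A\<rbrakk> \<Longrightarrow>
        z \<otimes>\<^bsub>A\<^esub> (x \<oplus>\<^bsub>A\<^esub> y) = z \<otimes>\<^bsub>A\<^esub> x \<oplus>\<^bsub>A\<^esub> z \<otimes>\<^bsub>A\<^esub> y"
    and mult_smult_left:
      "\<lbrakk>a \<in> carrier K; x \<in> carrier A; y \<in> carrier A\<rbrakk> \<Longrightarrow>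
        (a \<odot>\<^bsub>A\<^esub> x) \<otimes>\<^bsub>A\<^esub> y = a \<odot>\<^bsub>A\<^esub> (x \<otimes>\<^bsub>A\<^esub> y)"
    and mult_smult_right:
      "\<lbrakk>a \<in> carrier K; x \<in> carrier A; y \<in> carrier A\<rbrakk> \<Longrightarrow>
        x \<otimes>\<^bsub>A\<^esub> (a \<odot>\<^bsub>A\<^esub> y) = a \<odot>\<^bsub>A\<^esub> (x \<otimes>\<^bsub>A\<^esub> y)"


definition subalg :: "('k, 'm) ring_scheme \<Rightarrow> ('k, 'a, 'n) module_scheme \<Rightarrow> 'a set \<Rightarrow> bool" where
  "subalg K A H \<longleftrightarrow> submodule H K A \<and> (\<forall>x\<in>H. \<forall>y\<in>H. x \<otimes>\<^bsub>A\<^esub> y \<in> H)"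

definition alg_ideal :: "('k, 'm) ring_scheme \<Rightarrow> ('k, 'a, 'n) module_scheme \<Rightarrow> 'a set \<Rightarrow> bool" where
  "alg_ideal K A I \<longleftrightarrow> submodule I K A \<and>
    (\<forall>x\<in>I. \<forall>a\<in>carrier A. a \<otimes>\<^bsub>A\<^esub> x \<in> I \<and> x \<otimes>\<^bsub>A\<^esub> a \<in> I)"

definition module_gen :: "('k, 'm) ring_scheme \<Rightarrow> ('k, 'a, 'n) module_scheme \<Rightarrow> 'a set \<Rightarrow> 'a set" where
  "module_gen K M S = \<Inter>{N. submodule N K M \<and> S \<subseteq> N}"

definition subalg_gen :: "('k, 'm) ring_scheme \<Rightarrow> ('k, 'a, 'n) module_scheme \<Rightarrow> 'a set \<Rightarrow> 'a set" where
  "subalg_gen K A S = \<Inter>{H. subalg K A H \<and> S \<subseteq> H}"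

definition ideal_gen :: "('k, 'm) ring_scheme \<Rightarrow> ('k, 'a, 'n) module_scheme \<Rightarrow> 'a set \<Rightarrow> 'a set" where
  "ideal_gen K A S = \<Inter>{I. alg_ideal K A I \<and> S \<subseteq> I}"


definition alg_hom ::
    "('k, 'm) ring_scheme \<Rightarrow> ('k, 'a, 'n) module_scheme \<Rightarrow> ('k, 'b, 'p) module_scheme \<Rightarrow> ('a \<Rightarrow> 'b) set" where
  "alg_hom K A B = {h. h \<in> carrier A \<rightarrow> carrier B \<and>
    (\<forall>x\<in>carrier A. \<forall>y\<in>carrier A. h (x \<oplus>\<^bsub>A\<^esub> y) = h x \<oplus>\<^bsub>B\<^esub> h y) \<and>
    (\<forall>x\<in>carrier A. \<forall>y\<in>carrier A. h (x \<otimes>\<^bsub>A\<^esub> y) = h x \<otimes>\<^bsub>B\<^esub> h y) \<and>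
    (\<forall>a\<in>carrier K. \<forall>x\<in>carrier A. h (a \<odot>\<^bsub>A\<^esub> x) = a \<odot>\<^bsub>B\<^esub> h x)}"

definition alg_isomorphic ::
    "('k, 'm) ring_scheme \<Rightarrow> ('k, 'a, 'n) module_scheme \<Rightarrow> ('k, 'b, 'p) module_scheme \<Rightarrow> bool" where
  "alg_isomorphic K A B \<longleftrightarrow> (\<exists>h \<in> alg_hom K A B. bij_betw h (carrier A) (carrier B))"

text \<open>
  The quotient as a set of cosets.  For a submodule \<open>I\<close> this is the quotient module (its
  multiplication is then meaningless), and for an ideal it is the quotient algebra.
\<close>

definition quot :: "('k, 'a, 'n) module_scheme \<Rightarrow> 'a set \<Rightarrow> ('k, 'a set) module" where
  "quot A I = ring.extend (A Quot I)
    \<lparr>smult = (\<lambda>a U. \<Union>x\<in>U. I +>\<^bsub>A\<^esub> (a \<odot>\<^bsub>A\<^esub> x))\<rparr>"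


text \<open>
  The free algebra on \<open>V\<close> consists of the finitely supported \<open>K\<close>-linear combinations of nonempty
  words over \<open>V\<close>, multiplied by extending concatenation of words bilinearly.  Excluding the
  empty word is what makes it free among algebras that need not have a unit.
\<close>

definition free_alg :: "('k, 'm) ring_scheme \<Rightarrow> 'x set \<Rightarrow> ('k, 'x list \<Rightarrow> 'k) module" where
  "free_alg K V =
    \<lparr>carrier = {f. (\<forall>w. f w \<in> carrier K) \<and> finite {w. f w \<noteq> \<zero>\<^bsub>K\<^esub>} \<and>
                   {w. f w \<noteq> \<zero>\<^bsub>K\<^esub>} \<subseteq> lists V - {[]}},
     mult = (\<lambda>f g w. \<Oplus>\<^bsub>K\<^esub>j\<in>{0<..<length w}. f (take j w) \<otimes>\<^bsub>K\<^esub> g (drop j w)),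
     one = (\<lambda>w. \<zero>\<^bsub>K\<^esub>),
     zero = (\<lambda>w. \<zero>\<^bsub>K\<^esub>),
     add = (\<lambda>f g w. f w \<oplus>\<^bsub>K\<^esub> g w),
     smult = (\<lambda>a f w. a \<otimes>\<^bsub>K\<^esub> f w)\<rparr>"


definition fin_gen_module :: "('k, 'm) ring_scheme \<Rightarrow> ('k, 'a, 'n) module_scheme \<Rightarrow> bool" where
  "fin_gen_module K M \<longleftrightarrow> (\<exists>S\<subseteq>carrier M. finite S \<and> module_gen K M S = carrier M)"

definition finite_corank :: "('k, 'm) ring_scheme \<Rightarrow> ('k, 'a, 'n) module_scheme \<Rightarrow> 'a set \<Rightarrow> bool" where
  "finite_corank K M N \<longleftrightarrow> submodule N K M \<and> fin_gen_module K (quot M N)"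

definition fin_gen_alg :: "('k, 'm) ring_scheme \<Rightarrow> ('k, 'a, 'n) module_scheme \<Rightarrow> bool" where
  "fin_gen_alg K A \<longleftrightarrow> (\<exists>S\<subseteq>carrier A. finite S \<and> subalg_gen K A S = carrier A)"

definition fin_pres_alg :: "('k, 'm) ring_scheme \<Rightarrow> ('k, 'a, 'n) module_scheme \<Rightarrow> bool" where
  "fin_pres_alg K A \<longleftrightarrow>
    (\<exists>(m::nat) R. R \<subseteq> carrier (free_alg K {..<m}) \<and> finite R \<and>
      alg_isomorphic K (quot (free_alg K {..<m}) (ideal_gen K (free_alg K {..<m}) R)) A)"


definition prod_alg :: "'i set \<Rightarrow> ('i \<Rightarrow> ('k, 'a, 'n) module_scheme) \<Rightarrow> ('k, 'i \<Rightarrow> 'a) module" where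
  "prod_alg I A =
    \<lparr>carrier = (\<Pi>\<^sub>E i\<in>I. carrier (A i)),
     mult = (\<lambda>f g. \<lambda>i\<in>I. f i \<otimes>\<^bsub>A i\<^esub> g i),
     one = (\<lambda>i\<in>I. \<one>\<^bsub>A i\<^esub>),
     zero = (\<lambda>i\<in>I. \<zero>\<^bsub>A i\<^esub>),
     add = (\<lambda>f g. \<lambda>i\<in>I. f i \<oplus>\<^bsub>A i\<^esub> g i),
     smult = (\<lambda>a f. \<lambda>i\<in>I. a \<odot>\<^bsub>A i\<^esub> f i)\<rparr>"

definition subdirect_product ::
    "('k, 'm) ring_scheme \<Rightarrow> 'i set \<Rightarrow> ('i \<Rightarrow> ('k, 'a, 'n) module_scheme) \<Rightarrow> ('i \<Rightarrow> 'a) set \<Rightarrow> bool" where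
  "subdirect_product K I A C \<longleftrightarrow>
    subalg K (prod_alg I A) C \<and> (\<forall>i\<in>I. (\<lambda>f. f i) ` C = carrier (A i))"

text \<open>
  The product of \<open>A i\<close> and \<open>A j\<close> is rendered as \<open>prod_alg {i, j} A\<close>, so that the projection of a
  larger product onto these two factors is restriction to \<open>{i, j}\<close>.
\<close>

definition pair_proj :: "'i \<Rightarrow> 'i \<Rightarrow> ('i \<Rightarrow> 'a) \<Rightarrow> ('i \<Rightarrow> 'a)" where
  "pair_proj i j f = restrict f {i, j}"

end

theory Submission
  imports Defs
begin

text \<open>
  Let \<open>P\<close> be the product of the algebras \<open>A i\<close>. Both equivalences rest on the fact that \<open>C\<close> is
  close to \<open>P\<close>: it contains an ideal of \<open>P\<close> of finite corank. In either direction the \<open>A i\<close> are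
  finitely generated, being images of \<open>C\<close> if \<open>C\<close> is, so this may be assumed. Consider the ideal of
  all elements of \<open>A i\<close> that occur in an element of \<open>C\<close> next to zeros at the positions in a set
  \<open>S\<close>. For \<open>S = {j}\<close> it has finite corank in \<open>A i\<close> by the hypothesis on pairs, since the scalars
  are Noetherian. The product of the ideals for \<open>S\<close> and \<open>T\<close> lies in the ideal for \<open>S \<union> T\<close>, and in
  a finitely generated algebra products of ideals of finite corank have finite corank
  (\<open>finite_corank_product\<close>). Hence the ideals for \<open>S = I - {i}\<close> have finite corank, and their
  product over all \<open>i\<close> is an ideal of \<open>P\<close> of finite corank inside \<open>C\<close>.

  As products are taken without regard to units, \<open>P\<close> is finitely generated or finitely presented
  if and only if all factors are: generators of different factors only have to annihilate each
  other. It remains to compare \<open>C\<close> with \<open>P\<close>.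

  A presentation of a subalgebra of finite corank extends to the whole algebra: finitely many
  relators say how to multiply with finitely many vectors that span the rest, and finitely many
  more describe the linear dependencies of these vectors modulo the subalgebra
  (\<open>fin_pres_alg_of_finite_corank\<close>).

  In the other direction, cover \<open>P\<close> by a finitely generated free algebra \<open>F\<close> such that the letters
  and the preimage \<open>L\<close> of the ideal found above span \<open>F\<close>. Then \<open>L\<close> contains for any two letters an
  element \<open>b x y\<close> that differs from the word \<open>xy\<close> by a combination of letters. The elements \<open>b x
  y\<close> and \<open>b x y z\<close> generate a subalgebra of \<open>L\<close> that together with the letters spans \<open>F\<close>.
  Comparing leading words shows that it has a basis over the scalars, consisting of products of
  these generators, and therefore a finite presentation (\<open>fin_pres_subalg_of_free_alg_ideal\<close>). By
  the preceding paragraph the preimage of \<open>C\<close> in \<open>F\<close> is finitely presented. If \<open>P\<close> is finitely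
  presented, the kernel of the cover is a finitely generated ideal of \<open>F\<close>, hence also of the
  preimage of \<open>C\<close> (\<open>fin_gen_ideal_restrict\<close>), and \<open>C\<close> is finitely presented as a quotient of this
  preimage.

  Presentations are handled through one principle: the kernel of any surjection from a finitely
  generated onto a finitely presented algebra is a finitely generated ideal
  (\<open>fin_pres_kernel_fin_gen\<close>).
\<close>

section \<open>Submodules and spans\<close>

context module
begin

lemma submodule_iff:
  "submodule H R M \<longleftrightarrow> H \<subseteq> carrier M \<and> \<zero>\<^bsub>M\<^esub> \<in> H \<and>
    (\<forall>x\<in>H. \<forall>y\<in>H. x \<oplus>\<^bsub>M\<^esub> y \<in> H) \<and> (\<forall>a\<in>carrier R. \<forall>x\<in>H. a \<odot>\<^bsub>M\<^esub> x \<in> H)"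
proof
  assume H: "submodule H R M"
  then have "\<zero>\<^bsub>M\<^esub> \<in> H"
    using subgroup.one_closed[OF submodule.axioms(1)[OF H]] by simp
  then show "H \<subseteq> carrier M \<and> \<zero>\<^bsub>M\<^esub> \<in> H \<and>
    (\<forall>x\<in>H. \<forall>y\<in>H. x \<oplus>\<^bsub>M\<^esub> y \<in> H) \<and> (\<forall>a\<in>carrier R. \<forall>x\<in>H. a \<odot>\<^bsub>M\<^esub> x \<in> H)"
    using submoduleE[OF H] by blast
next
  assume H: "H \<subseteq> carrier M \<and> \<zero>\<^bsub>M\<^esub> \<in> H \<and>
    (\<forall>x\<in>H. \<forall>y\<in>H. x \<oplus>\<^bsub>M\<^esub> y \<in> H) \<and> (\<forall>a\<in>carrier R. \<forall>x\<in>H. a \<odot>\<^bsub>M\<^esub> x \<in> H)"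
  show "submodule H R M"
  proof (rule submoduleI)
    fix a assume a: "a \<in> H"
    then have "(\<ominus>\<^bsub>R\<^esub> \<one>\<^bsub>R\<^esub>) \<odot>\<^bsub>M\<^esub> a \<in> H" using H by blast
    moreover have "(\<ominus>\<^bsub>R\<^esub> \<one>\<^bsub>R\<^esub>) \<odot>\<^bsub>M\<^esub> a = \<ominus>\<^bsub>M\<^esub> a"
      using a H smult_l_minus[of "\<one>\<^bsub>R\<^esub>" a] by auto
    ultimately show "\<ominus>\<^bsub>M\<^esub> a \<in> H" by simp
  qed (use H in auto)
qed

lemma submodule_minus:
  assumes "submodule H R M" "x \<in> H" "y \<in> H"
  shows "x \<ominus>\<^bsub>M\<^esub> y \<in> H"
  unfolding M.minus_eq using assms submoduleE(3,5)[OF assms(1)] by blast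

lemma submodule_add_cancel:
  assumes H: "submodule H R M" and x: "x \<in> carrier M" and y: "y \<in> H" and xy: "x \<oplus>\<^bsub>M\<^esub> y \<in> H"
  shows "x \<in> H"
proof -
  have "y \<in> carrier M" using y submoduleE(1)[OF H] by blast
  then have "x = (x \<oplus>\<^bsub>M\<^esub> y) \<ominus>\<^bsub>M\<^esub> y"
    using x by (simp add: M.minus_eq M.a_assoc M.r_neg)
  then show ?thesis using submodule_minus[OF H xy y] by simp
qed

lemma minus_add_cancel: "x \<in> carrier M \<Longrightarrow> y \<in> carrier M \<Longrightarrow> (x \<ominus>\<^bsub>M\<^esub> y) \<oplus>\<^bsub>M\<^esub> y = x"
  by (simp add: M.minus_eq M.a_assoc M.l_neg)

lemma minus_eq_zero_iff:
  "x \<in> carrier M \<Longrightarrow> y \<in> carrier M \<Longrightarrow> x \<ominus>\<^bsub>M\<^esub> y = \<zero>\<^bsub>M\<^esub> \<longleftrightarrow> x = y"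
  using minus_add_cancel[of x y] by (auto simp: M.minus_eq M.r_neg)

lemma submodule_minus_cancel:
  assumes "submodule N R M" "x \<in> carrier M" "y \<in> N" "x \<ominus>\<^bsub>M\<^esub> y \<in> N"
  shows "x \<in> N"
proof -
  have "y \<in> carrier M" using assms(1,3) submoduleE(1) by blast
  then have "(x \<ominus>\<^bsub>M\<^esub> y) \<oplus>\<^bsub>M\<^esub> y = x" using minus_add_cancel assms(2) by blast
  then show ?thesis using submoduleE(5)[OF assms(1,4,3)] by simp
qed

lemma submodule_Inter:
  assumes "\<And>N. N \<in> F \<Longrightarrow> submodule N R M" "F \<noteq> {}"
  shows "submodule (\<Inter>F) R M"
  using assms unfolding submodule_iff by blast

lemma submodule_Int:
  assumes "submodule N R M" "submodule Q R M"
  shows "submodule (N \<inter> Q) R M"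
  using assms unfolding submodule_iff by blast

lemma module_gen_submodule:
  assumes "S \<subseteq> carrier M"
  shows "submodule (module_gen R M S) R M"
  unfolding module_gen_def
  by (rule submodule_Inter) (use assms carrier_is_submodule in auto)

lemma module_gen_carrier: "S \<subseteq> carrier M \<Longrightarrow> module_gen R M S \<subseteq> carrier M"
  using module_gen_submodule submoduleE(1) by blast

lemma module_gen_eq_self: "submodule N R M \<Longrightarrow> module_gen R M N = N"
  unfolding module_gen_def by blast

lemma submodule_add_set:
  assumes N: "submodule N R M" and Q: "submodule Q R M"
  shows "submodule {x \<oplus>\<^bsub>M\<^esub> y | x y. x \<in> N \<and> y \<in> Q} R M" (is "submodule ?S R M")
proof -
  have Nc: "N \<subseteq> carrier M" and Qc: "Q \<subseteq> carrier M" using N Q submoduleE(1) by auto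
  have 1: "?S \<subseteq> carrier M" using Nc Qc by auto
  have 2: "\<zero>\<^bsub>M\<^esub> \<in> ?S"
    using N Q unfolding submodule_iff by (auto intro!: exI[of _ "\<zero>\<^bsub>M\<^esub>"])
  have 3: "(x \<oplus>\<^bsub>M\<^esub> y) \<oplus>\<^bsub>M\<^esub> (x' \<oplus>\<^bsub>M\<^esub> y') \<in> ?S" if "x \<in> N" "y \<in> Q" "x' \<in> N" "y' \<in> Q" for x y x' y'
  proof -
    have c: "x \<in> carrier M" "y \<in> carrier M" "x' \<in> carrier M" "y' \<in> carrier M"
      using that Nc Qc by auto
    then have "(x \<oplus>\<^bsub>M\<^esub> y) \<oplus>\<^bsub>M\<^esub> (x' \<oplus>\<^bsub>M\<^esub> y') = (x \<oplus>\<^bsub>M\<^esub> x') \<oplus>\<^bsub>M\<^esub> (y \<oplus>\<^bsub>M\<^esub> y')"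
      by (simp add: M.a_ac)
    then show ?thesis using that N Q unfolding submodule_iff by blast
  qed
  have 4: "a \<odot>\<^bsub>M\<^esub> (x \<oplus>\<^bsub>M\<^esub> y) \<in> ?S" if "a \<in> carrier R" "x \<in> N" "y \<in> Q" for a x y
  proof -
    have "a \<odot>\<^bsub>M\<^esub> (x \<oplus>\<^bsub>M\<^esub> y) = a \<odot>\<^bsub>M\<^esub> x \<oplus>\<^bsub>M\<^esub> a \<odot>\<^bsub>M\<^esub> y"
      using that Nc Qc smult_r_distr by blast
    then show ?thesis using that N Q unfolding submodule_iff by blast
  qed
  show ?thesis unfolding submodule_iff using 1 2 3 4 by blast
qed

lemma module_gen_Un_submodules:
  assumes N: "submodule N R M" and Q: "submodule Q R M"
  shows "module_gen R M (N \<union> Q) = {x \<oplus>\<^bsub>M\<^esub> y | x y. x \<in> N \<and> y \<in> Q}" (is "_ = ?S")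
proof
  have Nc: "N \<subseteq> carrier M" and Qc: "Q \<subseteq> carrier M" using N Q submoduleE(1) by auto
  have z: "\<zero>\<^bsub>M\<^esub> \<in> N" "\<zero>\<^bsub>M\<^esub> \<in> Q" using N Q unfolding submodule_iff by auto
  have "N \<subseteq> ?S"
  proof
    fix x assume "x \<in> N"
    moreover have "x = x \<oplus>\<^bsub>M\<^esub> \<zero>\<^bsub>M\<^esub>" using \<open>x \<in> N\<close> Nc by auto
    ultimately show "x \<in> ?S" using z by blast
  qed
  moreover have "Q \<subseteq> ?S"
  proof
    fix x assume "x \<in> Q"
    moreover have "x = \<zero>\<^bsub>M\<^esub> \<oplus>\<^bsub>M\<^esub> x" using \<open>x \<in> Q\<close> Qc by auto
    ultimately show "x \<in> ?S" using z by blast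
  qed
  ultimately show "module_gen R M (N \<union> Q) \<subseteq> ?S"
    using submodule_add_set[OF N Q] unfolding module_gen_def by blast
  have "submodule (module_gen R M (N \<union> Q)) R M"
    by (rule module_gen_submodule) (use Nc Qc in blast)
  moreover have "N \<union> Q \<subseteq> module_gen R M (N \<union> Q)" unfolding module_gen_def by blast
  ultimately show "?S \<subseteq> module_gen R M (N \<union> Q)"
    unfolding submodule_iff by blast
qed

end

lemma module_gen_superset: "S \<subseteq> module_gen K M S"
  unfolding module_gen_def by blast

lemma module_gen_least: "submodule N K M \<Longrightarrow> S \<subseteq> N \<Longrightarrow> module_gen K M S \<subseteq> N"
  unfolding module_gen_def by blast

lemma module_gen_mono: "S \<subseteq> T \<Longrightarrow> module_gen K M S \<subseteq> module_gen K M T"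
  unfolding module_gen_def by blast

context module
begin

lemma module_gen_closed:
  assumes "S \<subseteq> carrier M"
  shows "\<zero>\<^bsub>M\<^esub> \<in> module_gen R M S"
    and "x \<in> module_gen R M S \<Longrightarrow> y \<in> module_gen R M S \<Longrightarrow> x \<oplus>\<^bsub>M\<^esub> y \<in> module_gen R M S"
    and "a \<in> carrier R \<Longrightarrow> x \<in> module_gen R M S \<Longrightarrow> a \<odot>\<^bsub>M\<^esub> x \<in> module_gen R M S"
  using module_gen_submodule[OF assms] unfolding submodule_iff by blast+

lemma module_gen_Un_decomp:
  assumes N: "submodule N R M" and T: "T \<subseteq> carrier M" and x: "x \<in> module_gen R M (N \<union> T)"
  obtains y z where "y \<in> N" "z \<in> module_gen R M T" "x = y \<oplus>\<^bsub>M\<^esub> z"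
proof -
  have T': "submodule (module_gen R M T) R M" using module_gen_submodule[OF T] .
  have "x \<in> module_gen R M (N \<union> module_gen R M T)"
    using x module_gen_mono[of "N \<union> T" "N \<union> module_gen R M T"] module_gen_superset[of T R M] by blast
  then show ?thesis using that module_gen_Un_submodules[OF N T'] by blast
qed

lemma submodule_singleton_span:
  assumes t: "t \<in> carrier M"
  shows "submodule {k \<odot>\<^bsub>M\<^esub> t | k. k \<in> carrier R} R M"
  unfolding submodule_iff
proof (intro conjI ballI)
  show "{k \<odot>\<^bsub>M\<^esub> t | k. k \<in> carrier R} \<subseteq> carrier M" using t by auto
  show "\<zero>\<^bsub>M\<^esub> \<in> {k \<odot>\<^bsub>M\<^esub> t | k. k \<in> carrier R}"
    using t smult_l_null[OF t] R.zero_closed by (metis (mono_tags, lifting) mem_Collect_eq)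
next
  fix x y assume "x \<in> {k \<odot>\<^bsub>M\<^esub> t | k. k \<in> carrier R}" "y \<in> {k \<odot>\<^bsub>M\<^esub> t | k. k \<in> carrier R}"
  then obtain k l where "k \<in> carrier R" "l \<in> carrier R" "x = k \<odot>\<^bsub>M\<^esub> t" "y = l \<odot>\<^bsub>M\<^esub> t" by blast
  then have "x \<oplus>\<^bsub>M\<^esub> y = (k \<oplus>\<^bsub>R\<^esub> l) \<odot>\<^bsub>M\<^esub> t" "k \<oplus>\<^bsub>R\<^esub> l \<in> carrier R" using t smult_l_distr by auto
  then show "x \<oplus>\<^bsub>M\<^esub> y \<in> {k \<odot>\<^bsub>M\<^esub> t | k. k \<in> carrier R}" by blast
next
  fix a x assume a: "a \<in> carrier R" and "x \<in> {k \<odot>\<^bsub>M\<^esub> t | k. k \<in> carrier R}"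
  then obtain k where "k \<in> carrier R" "x = k \<odot>\<^bsub>M\<^esub> t" by blast
  then have "a \<odot>\<^bsub>M\<^esub> x = (a \<otimes>\<^bsub>R\<^esub> k) \<odot>\<^bsub>M\<^esub> t" "a \<otimes>\<^bsub>R\<^esub> k \<in> carrier R"
    using t a smult_assoc1 by auto
  then show "a \<odot>\<^bsub>M\<^esub> x \<in> {k \<odot>\<^bsub>M\<^esub> t | k. k \<in> carrier R}" by blast
qed

lemma module_gen_insert_decomp:
  assumes N: "submodule N R M" and t: "t \<in> carrier M" and x: "x \<in> module_gen R M (insert t N)"
  obtains y k where "y \<in> N" "k \<in> carrier R" "x = y \<oplus>\<^bsub>M\<^esub> k \<odot>\<^bsub>M\<^esub> t"
proof -
  let ?T = "{k \<odot>\<^bsub>M\<^esub> t | k. k \<in> carrier R}"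
  have "t \<in> ?T" using smult_one[OF t] R.one_closed by (metis (mono_tags, lifting) mem_Collect_eq)
  then have "x \<in> module_gen R M (N \<union> ?T)"
    using x module_gen_mono[of "insert t N" "N \<union> ?T"] by blast
  then show ?thesis
    using that module_gen_Un_submodules[OF N submodule_singleton_span[OF t]] by auto
qed

lemma coefficient_ideal:
  assumes W: "submodule W R M" and Q: "submodule Q R M" and t: "t \<in> carrier M"
  shows "ideal {k \<in> carrier R. \<exists>w\<in>W. w \<oplus>\<^bsub>M\<^esub> k \<odot>\<^bsub>M\<^esub> t \<in> Q} R" (is "ideal ?J R")
proof -
  have Wc: "W \<subseteq> carrier M" using W submoduleE(1) by blast
  note Wcl = W[unfolded submodule_iff] and Qcl = Q[unfolded submodule_iff]
  have add: "x \<oplus>\<^bsub>R\<^esub> y \<in> ?J" if m: "x \<in> ?J" "y \<in> ?J" for x y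
  proof -
    obtain w v where wv: "w \<in> W" "v \<in> W" "w \<oplus>\<^bsub>M\<^esub> x \<odot>\<^bsub>M\<^esub> t \<in> Q" "v \<oplus>\<^bsub>M\<^esub> y \<odot>\<^bsub>M\<^esub> t \<in> Q"
      and xy: "x \<in> carrier R" "y \<in> carrier R"
      using m by blast
    have c: "w \<in> carrier M" "v \<in> carrier M" using wv Wc by auto
    have "(w \<oplus>\<^bsub>M\<^esub> x \<odot>\<^bsub>M\<^esub> t) \<oplus>\<^bsub>M\<^esub> (v \<oplus>\<^bsub>M\<^esub> y \<odot>\<^bsub>M\<^esub> t) = (w \<oplus>\<^bsub>M\<^esub> v) \<oplus>\<^bsub>M\<^esub> (x \<oplus>\<^bsub>R\<^esub> y) \<odot>\<^bsub>M\<^esub> t"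
      using c xy t by (simp add: smult_l_distr M.a_ac)
    moreover have "(w \<oplus>\<^bsub>M\<^esub> x \<odot>\<^bsub>M\<^esub> t) \<oplus>\<^bsub>M\<^esub> (v \<oplus>\<^bsub>M\<^esub> y \<odot>\<^bsub>M\<^esub> t) \<in> Q" "w \<oplus>\<^bsub>M\<^esub> v \<in> W"
      using wv Wcl Qcl by blast+
    ultimately show ?thesis using xy by auto
  qed
  have mul: "a \<otimes>\<^bsub>R\<^esub> x \<in> ?J" if m: "x \<in> ?J" "a \<in> carrier R" for x a
  proof -
    obtain w where w: "w \<in> W" "w \<oplus>\<^bsub>M\<^esub> x \<odot>\<^bsub>M\<^esub> t \<in> Q" and x: "x \<in> carrier R"
      using m by blast
    have "w \<in> carrier M" using w Wc by auto
    then have "a \<odot>\<^bsub>M\<^esub> (w \<oplus>\<^bsub>M\<^esub> x \<odot>\<^bsub>M\<^esub> t) = a \<odot>\<^bsub>M\<^esub> w \<oplus>\<^bsub>M\<^esub> (a \<otimes>\<^bsub>R\<^esub> x) \<odot>\<^bsub>M\<^esub> t"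
      using x t m by (simp add: smult_r_distr smult_assoc1)
    moreover have "a \<odot>\<^bsub>M\<^esub> (w \<oplus>\<^bsub>M\<^esub> x \<odot>\<^bsub>M\<^esub> t) \<in> Q" "a \<odot>\<^bsub>M\<^esub> w \<in> W"
      using w Wcl Qcl m(2) by blast+
    ultimately show ?thesis using x m(2) by auto
  qed
  have "\<zero>\<^bsub>R\<^esub> \<in> ?J" using t Wcl Qcl smult_l_null[OF t] by (auto intro!: bexI[of _ "\<zero>\<^bsub>M\<^esub>"])
  moreover have "\<ominus>\<^bsub>R\<^esub> a \<in> ?J" if "a \<in> ?J" for a
    using mul[OF that, of "\<ominus>\<^bsub>R\<^esub> \<one>\<^bsub>R\<^esub>"] that by (simp add: R.l_minus)
  ultimately have "subgroup ?J (add_monoid R)"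
    by (intro R.add.subgroupI) (use add in blast)+
  moreover have "x \<otimes>\<^bsub>R\<^esub> a \<in> ?J \<and> a \<otimes>\<^bsub>R\<^esub> x \<in> ?J" if a: "a \<in> ?J" and x: "x \<in> carrier R" for a x
  proof -
    have "a \<in> carrier R" using a by blast
    then show ?thesis using mul[OF a x] R.m_comm[OF x] by simp
  qed
  ultimately show ?thesis by (intro idealI R.ring_axioms) blast+
qed

text \<open>
  The span of a submodule \<open>N\<close> and finitely many further vectors is the working form of finite
  corank. Noetherianity of the scalars enters only here: by adding one vector \<open>t\<close> at a time, the
  coefficients at \<open>t\<close> of the elements of \<open>Q\<close> form an ideal, and lifts of finitely many generators
  of that ideal account for \<open>t\<close>.
\<close>

lemma noetherian_relative_finite_generation:
  assumes noeth: "noetherian_ring R" and T: "finite T" "T \<subseteq> carrier M"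
    and N: "submodule N R M" and Q: "submodule Q R M" and QM: "Q \<subseteq> module_gen R M (N \<union> T)"
  shows "\<exists>T'\<subseteq>Q. finite T' \<and> Q \<subseteq> module_gen R M ((Q \<inter> N) \<union> T')"
  using T Q QM
proof (induction T arbitrary: Q rule: finite_induct)
  case empty
  then have "Q \<subseteq> N" using module_gen_eq_self[OF N] by simp
  then have "Q \<subseteq> module_gen R M (Q \<inter> N \<union> {})" using module_gen_superset[of "Q \<inter> N \<union> {}" R M] by blast
  then show ?case by blast
next
  case (insert t T)
  let ?W = "module_gen R M (N \<union> T)"
  have Nc: "N \<subseteq> carrier M" and Qc: "Q \<subseteq> carrier M" using N insert.prems submoduleE(1) by auto
  have t: "t \<in> carrier M" and Tc: "T \<subseteq> carrier M" using insert.prems by auto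
  have W: "submodule ?W R M" by (rule module_gen_submodule) (use Nc Tc in blast)
  have Wc: "?W \<subseteq> carrier M" using W submoduleE(1) by blast
  define I where "I = {k \<in> carrier R. \<exists>w\<in>?W. w \<oplus>\<^bsub>M\<^esub> k \<odot>\<^bsub>M\<^esub> t \<in> Q}"
  have "ideal I R"
    unfolding I_def using coefficient_ideal[OF W insert.prems(2) t] .
  then obtain G where G: "G \<subseteq> carrier R" "finite G" "I = Idl\<^bsub>R\<^esub> G"
    using noetherian_ring.finetely_gen[OF noeth] by blast
  have "G \<subseteq> I" using G R.genideal_self by blast
  then have "\<forall>g\<in>G. \<exists>q\<in>Q. \<exists>w\<in>?W. q = w \<oplus>\<^bsub>M\<^esub> g \<odot>\<^bsub>M\<^esub> t" using I_def by blast
  then obtain q where q: "\<And>g. g \<in> G \<Longrightarrow> q g \<in> Q \<and> (\<exists>w\<in>?W. q g = w \<oplus>\<^bsub>M\<^esub> g \<odot>\<^bsub>M\<^esub> t)" by metis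
  let ?S = "module_gen R M (q ` G)"
  have qG: "q ` G \<subseteq> Q" using q by blast
  then have S: "submodule ?S R M" using module_gen_submodule Qc by blast
  have SQ: "?S \<subseteq> Q" using module_gen_least[OF insert.prems(2) qG] .
  \<comment> \<open>the coefficient ideal of the span of the lifts contains \<open>G\<close>, hence all of \<open>I\<close>\<close>
  let ?J = "{k \<in> carrier R. \<exists>w\<in>?W. w \<oplus>\<^bsub>M\<^esub> k \<odot>\<^bsub>M\<^esub> t \<in> ?S}"
  have "ideal ?J R" using coefficient_ideal[OF W S t] .
  moreover have "G \<subseteq> ?J"
  proof
    fix g assume g: "g \<in> G"
    then obtain w where "w \<in> ?W" "q g = w \<oplus>\<^bsub>M\<^esub> g \<odot>\<^bsub>M\<^esub> t" using q by blast
    moreover have "q g \<in> ?S" using g module_gen_superset[of "q ` G" R M] by blast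
    ultimately show "g \<in> ?J" using g G by auto
  qed
  ultimately have IJ: "I \<subseteq> ?J" using G R.genideal_minimal by blast
  let ?Q = "Q \<inter> ?W"
  have Q': "submodule ?Q R M" using submodule_Int[OF insert.prems(2) W] .
  then obtain T' where T': "T' \<subseteq> ?Q" "finite T'" "?Q \<subseteq> module_gen R M ((?Q \<inter> N) \<union> T')"
    using insert.IH[of ?Q] Tc by blast
  let ?U = "module_gen R M ((Q \<inter> N) \<union> (T' \<union> q ` G))"
  have Uc: "(Q \<inter> N) \<union> (T' \<union> q ` G) \<subseteq> carrier M" using Nc T'(1) qG Qc by blast
  have U: "submodule ?U R M" by (rule module_gen_submodule[OF Uc])
  have QU: "?Q \<subseteq> ?U"
    using T'(3) module_gen_mono[of "(?Q \<inter> N) \<union> T'" "(Q \<inter> N) \<union> (T' \<union> q ` G)"] by blast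
  have SU: "?S \<subseteq> ?U" by (rule module_gen_mono) blast
  have "Q \<subseteq> ?U"
  proof
    fix x assume x: "x \<in> Q"
    have "module_gen R M (N \<union> insert t T) \<subseteq> module_gen R M (insert t ?W)"
      by (rule module_gen_least[OF module_gen_submodule])
        (use Wc t module_gen_superset[of "N \<union> T" R M] module_gen_superset[of "insert t ?W" R M] in blast)+
    then obtain w k where wk: "w \<in> ?W" "k \<in> carrier R" "x = w \<oplus>\<^bsub>M\<^esub> k \<odot>\<^bsub>M\<^esub> t"
      using module_gen_insert_decomp[OF W t] x insert.prems by blast
    then have "k \<in> I" using x I_def by blast
    then obtain v where v: "v \<in> ?W" "v \<oplus>\<^bsub>M\<^esub> k \<odot>\<^bsub>M\<^esub> t \<in> ?S" using IJ by blast
    let ?s = "v \<oplus>\<^bsub>M\<^esub> k \<odot>\<^bsub>M\<^esub> t"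
    have c: "w \<in> carrier M" "v \<in> carrier M" "k \<odot>\<^bsub>M\<^esub> t \<in> carrier M" using wk v Wc t by auto
    have "x \<ominus>\<^bsub>M\<^esub> ?s = w \<ominus>\<^bsub>M\<^esub> v"
    proof -
      have "x \<ominus>\<^bsub>M\<^esub> ?s = w \<oplus>\<^bsub>M\<^esub> (k \<odot>\<^bsub>M\<^esub> t \<oplus>\<^bsub>M\<^esub> (\<ominus>\<^bsub>M\<^esub> (k \<odot>\<^bsub>M\<^esub> t) \<oplus>\<^bsub>M\<^esub> (\<ominus>\<^bsub>M\<^esub> v)))"
        unfolding wk(3) M.minus_eq using c by (simp add: M.minus_add M.a_ac)
      also have "\<dots> = w \<ominus>\<^bsub>M\<^esub> v" using c by (simp add: M.r_neg2 M.minus_eq)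
      finally show ?thesis .
    qed
    then have "x \<ominus>\<^bsub>M\<^esub> ?s \<in> ?Q"
      using submodule_minus[OF W wk(1) v(1)] submodule_minus[OF insert.prems(2) x, of ?s] SQ v(2) by auto
    then have "x \<ominus>\<^bsub>M\<^esub> ?s \<in> ?U" "?s \<in> ?U" using QU SU v(2) by blast+
    then have "(x \<ominus>\<^bsub>M\<^esub> ?s) \<oplus>\<^bsub>M\<^esub> ?s \<in> ?U" using U unfolding submodule_iff by blast
    moreover have "(x \<ominus>\<^bsub>M\<^esub> ?s) \<oplus>\<^bsub>M\<^esub> ?s = x"
      using x Qc c by (simp add: M.minus_eq M.a_assoc M.l_neg subset_eq)
    ultimately show "x \<in> ?U" by simp
  qed
  then show ?case using T' qG insert.hyps G by (metis Int_subset_iff Un_least finite_Un finite_imageI)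
qed

end

section \<open>Linear maps, homomorphisms and generated subobjects\<close>

definition lin_map ::
    "('k, 'm) ring_scheme \<Rightarrow> ('k, 'a, 'n) module_scheme \<Rightarrow> ('k, 'b, 'p) module_scheme \<Rightarrow> ('a \<Rightarrow> 'b) set" where
  "lin_map K A B = {h. h \<in> carrier A \<rightarrow> carrier B \<and>
    (\<forall>x\<in>carrier A. \<forall>y\<in>carrier A. h (x \<oplus>\<^bsub>A\<^esub> y) = h x \<oplus>\<^bsub>B\<^esub> h y) \<and>
    (\<forall>a\<in>carrier K. \<forall>x\<in>carrier A. h (a \<odot>\<^bsub>A\<^esub> x) = a \<odot>\<^bsub>B\<^esub> h x)}"

abbreviation alg_ker ::
    "('k, 'a, 'n) module_scheme \<Rightarrow> ('k, 'b, 'p) module_scheme \<Rightarrow> ('a \<Rightarrow> 'b) \<Rightarrow> 'a set" where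
  "alg_ker A B h \<equiv> {x \<in> carrier A. h x = \<zero>\<^bsub>B\<^esub>}"

definition fin_gen_ideal :: "('k, 'm) ring_scheme \<Rightarrow> ('k, 'a, 'n) module_scheme \<Rightarrow> 'a set \<Rightarrow> bool" where
  "fin_gen_ideal K A I \<longleftrightarrow> (\<exists>R\<subseteq>carrier A. finite R \<and> ideal_gen K A R = I)"

lemma alg_hom_lin_map: "h \<in> alg_hom K A B \<Longrightarrow> h \<in> lin_map K A B"
  unfolding alg_hom_def lin_map_def by blast

lemma alg_homE:
  assumes "h \<in> alg_hom K A B"
  shows "x \<in> carrier A \<Longrightarrow> h x \<in> carrier B"
    and "x \<in> carrier A \<Longrightarrow> y \<in> carrier A \<Longrightarrow> h (x \<oplus>\<^bsub>A\<^esub> y) = h x \<oplus>\<^bsub>B\<^esub> h y"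
    and "x \<in> carrier A \<Longrightarrow> y \<in> carrier A \<Longrightarrow> h (x \<otimes>\<^bsub>A\<^esub> y) = h x \<otimes>\<^bsub>B\<^esub> h y"
    and "a \<in> carrier K \<Longrightarrow> x \<in> carrier A \<Longrightarrow> h (a \<odot>\<^bsub>A\<^esub> x) = a \<odot>\<^bsub>B\<^esub> h x"
  using assms unfolding alg_hom_def by auto

lemma alg_hom_compose:
  "h \<in> alg_hom K A B \<Longrightarrow> g \<in> alg_hom K B C \<Longrightarrow> (\<lambda>x. g (h x)) \<in> alg_hom K A C"
  unfolding alg_hom_def by (auto simp: Pi_iff)

lemma lin_mapE:
  assumes "h \<in> lin_map K A B"
  shows "x \<in> carrier A \<Longrightarrow> h x \<in> carrier B"
    and "x \<in> carrier A \<Longrightarrow> y \<in> carrier A \<Longrightarrow> h (x \<oplus>\<^bsub>A\<^esub> y) = h x \<oplus>\<^bsub>B\<^esub> h y"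
    and "a \<in> carrier K \<Longrightarrow> x \<in> carrier A \<Longrightarrow> h (a \<odot>\<^bsub>A\<^esub> x) = a \<odot>\<^bsub>B\<^esub> h x"
  using assms unfolding lin_map_def by auto

lemma lin_map_zero:
  assumes "module K A" "module K B" "h \<in> lin_map K A B"
  shows "h \<zero>\<^bsub>A\<^esub> = \<zero>\<^bsub>B\<^esub>"
proof -
  interpret A: module K A by fact
  interpret B: module K B by fact
  have "h \<zero>\<^bsub>A\<^esub> = h (\<zero>\<^bsub>K\<^esub> \<odot>\<^bsub>A\<^esub> \<zero>\<^bsub>A\<^esub>)" by simp
  also have "\<dots> = \<zero>\<^bsub>K\<^esub> \<odot>\<^bsub>B\<^esub> h \<zero>\<^bsub>A\<^esub>" using lin_mapE(3)[OF assms(3)] by blast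
  also have "\<dots> = \<zero>\<^bsub>B\<^esub>" using lin_mapE(1)[OF assms(3)] by simp
  finally show ?thesis .
qed

lemma lin_map_minus:
  assumes "module K A" "module K B" "h \<in> lin_map K A B" "x \<in> carrier A" "y \<in> carrier A"
  shows "h (x \<ominus>\<^bsub>A\<^esub> y) = h x \<ominus>\<^bsub>B\<^esub> h y"
proof -
  interpret A: module K A by fact
  interpret B: module K B by fact
  note h = lin_mapE[OF assms(3)]
  have hc: "h x \<in> carrier B" "h y \<in> carrier B" "h (x \<ominus>\<^bsub>A\<^esub> y) \<in> carrier B" using h assms by auto
  have "(x \<ominus>\<^bsub>A\<^esub> y) \<oplus>\<^bsub>A\<^esub> y = x"
    using assms by (simp add: A.M.minus_eq A.M.a_assoc A.M.l_neg)
  then have "h x = h (x \<ominus>\<^bsub>A\<^esub> y) \<oplus>\<^bsub>B\<^esub> h y" using h(2)[of "x \<ominus>\<^bsub>A\<^esub> y" y] assms by simp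
  then show ?thesis using hc by (simp add: B.M.minus_eq B.M.a_assoc B.M.r_neg)
qed

lemma submodule_vimage:
  assumes "module K A" "module K B" "h \<in> lin_map K A B" "submodule Q K B"
  shows "submodule {x \<in> carrier A. h x \<in> Q} K A"
  using assms(4) lin_mapE[OF assms(3)] lin_map_zero[OF assms(1-3)]
  unfolding module.submodule_iff[OF assms(1)] module.submodule_iff[OF assms(2)]
  using module.axioms(2)[OF assms(1)]
  by (auto simp: abelian_monoid.a_closed abelian_group_def abelian_monoid.zero_closed module.smult_closed[OF assms(1)])

lemma submodule_image:
  assumes "module K A" "module K B" "h \<in> lin_map K A B" "submodule Q K A"
  shows "submodule (h ` Q) K B"
  unfolding module.submodule_iff[OF assms(2)]
proof (intro conjI ballI)
  note Q = assms(4)[unfolded module.submodule_iff[OF assms(1)]]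
  show "h ` Q \<subseteq> carrier B" using Q lin_mapE(1)[OF assms(3)] by blast
  show "\<zero>\<^bsub>B\<^esub> \<in> h ` Q" using Q lin_map_zero[OF assms(1-3)] by (metis imageI)
  show "x \<oplus>\<^bsub>B\<^esub> y \<in> h ` Q" if xy: "x \<in> h ` Q" "y \<in> h ` Q" for x y
  proof -
    obtain u v where uv: "u \<in> Q" "v \<in> Q" "x = h u" "y = h v" using xy by blast
    then have "x \<oplus>\<^bsub>B\<^esub> y = h (u \<oplus>\<^bsub>A\<^esub> v)" using lin_mapE(2)[OF assms(3), of u v] Q by fastforce
    then show ?thesis using Q uv by blast
  qed
  show "a \<odot>\<^bsub>B\<^esub> x \<in> h ` Q" if ax: "a \<in> carrier K" "x \<in> h ` Q" for a x
  proof -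
    obtain u where u: "u \<in> Q" "x = h u" using ax by blast
    then have "a \<odot>\<^bsub>B\<^esub> x = h (a \<odot>\<^bsub>A\<^esub> u)" using lin_mapE(3)[OF assms(3) ax(1), of u] Q by fastforce
    then show ?thesis using Q u ax by blast
  qed
qed

lemma lin_map_module_gen:
  assumes "module K A" "module K B" "h \<in> lin_map K A B" "S \<subseteq> carrier A"
    and "submodule Q K B" "\<And>s. s \<in> S \<Longrightarrow> h s \<in> Q" "x \<in> module_gen K A S"
  shows "h x \<in> Q"
  using module_gen_least[OF submodule_vimage[OF assms(1-3,5)], of S] assms(4,6,7) by blast

lemma image_module_gen:
  assumes "module K A" "module K B" "h \<in> lin_map K A B" "S \<subseteq> carrier A"
  shows "h ` module_gen K A S = module_gen K B (h ` S)"
proof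
  have "h ` S \<subseteq> carrier B" using assms(4) lin_mapE(1)[OF assms(3)] by blast
  then show "h ` module_gen K A S \<subseteq> module_gen K B (h ` S)"
    using lin_map_module_gen[OF assms module.module_gen_submodule[OF assms(2)], of "h ` S"]
      module_gen_superset[of "h ` S" K B] by blast
  show "module_gen K B (h ` S) \<subseteq> h ` module_gen K A S"
    by (rule module_gen_least)
      (use submodule_image[OF assms(1-3) module.module_gen_submodule[OF assms(1,4)]]
        module_gen_superset[of S K A] in blast)+
qed

lemma lin_map_compose:
  "h \<in> lin_map K A B \<Longrightarrow> g \<in> lin_map K B C \<Longrightarrow> (\<lambda>x. g (h x)) \<in> lin_map K A C"
  unfolding lin_map_def by (auto simp: Pi_iff)

lemma lin_maps_eq_on_span:
  assumes "module K A" "module K B" "h \<in> lin_map K A B" "g \<in> lin_map K A B" "S \<subseteq> carrier A"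
    and "\<And>s. s \<in> S \<Longrightarrow> h s = g s" "x \<in> module_gen K A S"
  shows "h x = g x"
proof -
  interpret A: module K A by fact
  have "submodule {x \<in> carrier A. h x = g x} K A"
    unfolding A.submodule_iff
    using lin_mapE[OF assms(3)] lin_mapE[OF assms(4)] lin_map_zero[OF assms(1-3)]
      lin_map_zero[OF assms(1,2,4)] by auto
  then show ?thesis using module_gen_least[of "{x \<in> carrier A. h x = g x}" K A S] assms(5-7) by blast
qed

subsection \<open>Subalgebras and ideals\<close>

lemma subalg_gen_superset: "S \<subseteq> subalg_gen K A S"
  unfolding subalg_gen_def by blast

lemma subalg_gen_least: "subalg K A H \<Longrightarrow> S \<subseteq> H \<Longrightarrow> subalg_gen K A S \<subseteq> H"
  unfolding subalg_gen_def by blast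

lemma ideal_gen_superset: "S \<subseteq> ideal_gen K A S"
  unfolding ideal_gen_def by blast

lemma ideal_gen_least: "alg_ideal K A H \<Longrightarrow> S \<subseteq> H \<Longrightarrow> ideal_gen K A S \<subseteq> H"
  unfolding ideal_gen_def by blast

lemma subalg_gen_mono: "S \<subseteq> T \<Longrightarrow> subalg_gen K A S \<subseteq> subalg_gen K A T"
  unfolding subalg_gen_def by blast

lemma ideal_gen_mono: "S \<subseteq> T \<Longrightarrow> ideal_gen K A S \<subseteq> ideal_gen K A T"
  unfolding ideal_gen_def by blast

context nonunital_algebra
begin

lemma is_module: "module K A"
  by unfold_locales

lemma is_nonunital_algebra: "nonunital_algebra K A"
  by unfold_locales

lemma subalg_iff:
  "subalg K A H \<longleftrightarrow> H \<subseteq> carrier A \<and> \<zero>\<^bsub>A\<^esub> \<in> H \<and>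
    (\<forall>x\<in>H. \<forall>y\<in>H. x \<oplus>\<^bsub>A\<^esub> y \<in> H) \<and> (\<forall>a\<in>carrier K. \<forall>x\<in>H. a \<odot>\<^bsub>A\<^esub> x \<in> H) \<and>
    (\<forall>x\<in>H. \<forall>y\<in>H. x \<otimes>\<^bsub>A\<^esub> y \<in> H)"
  unfolding subalg_def submodule_iff by blast

lemma alg_ideal_iff:
  "alg_ideal K A H \<longleftrightarrow> H \<subseteq> carrier A \<and> \<zero>\<^bsub>A\<^esub> \<in> H \<and>
    (\<forall>x\<in>H. \<forall>y\<in>H. x \<oplus>\<^bsub>A\<^esub> y \<in> H) \<and> (\<forall>a\<in>carrier K. \<forall>x\<in>H. a \<odot>\<^bsub>A\<^esub> x \<in> H) \<and>
    (\<forall>x\<in>H. \<forall>a\<in>carrier A. a \<otimes>\<^bsub>A\<^esub> x \<in> H \<and> x \<otimes>\<^bsub>A\<^esub> a \<in> H)"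
  unfolding alg_ideal_def submodule_iff by blast

lemma mult_zero_left: "x \<in> carrier A \<Longrightarrow> \<zero>\<^bsub>A\<^esub> \<otimes>\<^bsub>A\<^esub> x = \<zero>\<^bsub>A\<^esub>"
  using mult_smult_left[of "\<zero>\<^bsub>K\<^esub>" "\<zero>\<^bsub>A\<^esub>" x] by (simp add: mult_closed)

lemma mult_zero_right: "x \<in> carrier A \<Longrightarrow> x \<otimes>\<^bsub>A\<^esub> \<zero>\<^bsub>A\<^esub> = \<zero>\<^bsub>A\<^esub>"
  using mult_smult_right[of "\<zero>\<^bsub>K\<^esub>" x "\<zero>\<^bsub>A\<^esub>"] by (simp add: mult_closed)

lemma left_mult_lin_map: "a \<in> carrier A \<Longrightarrow> (\<lambda>x. a \<otimes>\<^bsub>A\<^esub> x) \<in> lin_map K A A"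
  unfolding lin_map_def by (auto simp: mult_closed mult_add_right mult_smult_right)

lemma right_mult_lin_map: "a \<in> carrier A \<Longrightarrow> (\<lambda>x. x \<otimes>\<^bsub>A\<^esub> a) \<in> lin_map K A A"
  unfolding lin_map_def by (auto simp: mult_closed mult_add_left mult_smult_left)

lemma module_gen_mult_left:
  assumes "S \<subseteq> carrier A" "a \<in> carrier A" "submodule Q K A"
    "\<And>s. s \<in> S \<Longrightarrow> a \<otimes>\<^bsub>A\<^esub> s \<in> Q" "x \<in> module_gen K A S"
  shows "a \<otimes>\<^bsub>A\<^esub> x \<in> Q"
  using lin_map_module_gen[OF is_module is_module left_mult_lin_map[OF assms(2)] assms(1,3,4,5)] .

lemma module_gen_mult_right:
  assumes "S \<subseteq> carrier A" "a \<in> carrier A" "submodule Q K A"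
    "\<And>s. s \<in> S \<Longrightarrow> s \<otimes>\<^bsub>A\<^esub> a \<in> Q" "x \<in> module_gen K A S"
  shows "x \<otimes>\<^bsub>A\<^esub> a \<in> Q"
  using lin_map_module_gen[OF is_module is_module right_mult_lin_map[OF assms(2)] assms(1,3,4,5)] .

lemma alg_ideal_imp_subalg: "alg_ideal K A I \<Longrightarrow> subalg K A I"
  unfolding alg_ideal_iff subalg_iff by blast

lemma subalg_carrier: "subalg K A (carrier A)"
  unfolding subalg_iff by (auto simp: mult_closed)

lemma alg_ideal_carrier: "alg_ideal K A (carrier A)"
  unfolding alg_ideal_iff by (auto simp: mult_closed)

lemma alg_ideal_zero: "alg_ideal K A {\<zero>\<^bsub>A\<^esub>}"
  unfolding alg_ideal_iff by (auto simp: mult_zero_left mult_zero_right)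

lemma subalg_gen_subalg:
  assumes "S \<subseteq> carrier A"
  shows "subalg K A (subalg_gen K A S)"
  unfolding subalg_iff
proof (intro conjI)
  show "subalg_gen K A S \<subseteq> carrier A" using subalg_gen_least[OF subalg_carrier assms] .
qed (auto simp: subalg_gen_def subalg_iff)

lemma ideal_gen_alg_ideal:
  assumes "S \<subseteq> carrier A"
  shows "alg_ideal K A (ideal_gen K A S)"
  unfolding alg_ideal_iff
proof (intro conjI)
  show "ideal_gen K A S \<subseteq> carrier A" using ideal_gen_least[OF alg_ideal_carrier assms] .
qed (auto simp: ideal_gen_def alg_ideal_iff)

lemma subalg_algebra:
  assumes H: "subalg K A H"
  shows "nonunital_algebra K (A\<lparr>carrier := H\<rparr>)"
proof -
  have "module K (A\<lparr>carrier := H\<rparr>)"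
    by (rule submodule.submodule_is_module[OF _ is_module]) (use H in \<open>simp add: subalg_def\<close>)
  moreover have "x \<in> carrier A" if "x \<in> H" for x using that H unfolding subalg_iff by blast
  moreover have "x \<otimes>\<^bsub>A\<^esub> y \<in> H" if "x \<in> H" "y \<in> H" for x y using that H unfolding subalg_iff by blast
  ultimately show ?thesis
    by (intro nonunital_algebra.intro nonunital_algebra_axioms.intro)
      (simp_all add: mult_assoc mult_add_left mult_add_right mult_smult_left mult_smult_right)
qed

lemma submodule_restrict_iff:
  assumes H: "subalg K A H"
  shows "submodule G K (A\<lparr>carrier := H\<rparr>) \<longleftrightarrow> submodule G K A \<and> G \<subseteq> H"
proof -
  interpret H: nonunital_algebra K "A\<lparr>carrier := H\<rparr>" using subalg_algebra[OF H] .
  show ?thesis using H unfolding submodule_iff H.submodule_iff subalg_iff by auto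
qed

lemma subalg_restrict_iff:
  "subalg K A H \<Longrightarrow> subalg K (A\<lparr>carrier := H\<rparr>) G \<longleftrightarrow> subalg K A G \<and> G \<subseteq> H"
  unfolding subalg_def[of K "A\<lparr>carrier := H\<rparr>"] subalg_def[of K A G]
  using submodule_restrict_iff by auto

lemma module_gen_restrict:
  assumes H: "subalg K A H" and S: "S \<subseteq> H"
  shows "module_gen K (A\<lparr>carrier := H\<rparr>) S = module_gen K A S"
proof
  interpret H: nonunital_algebra K "A\<lparr>carrier := H\<rparr>" using subalg_algebra[OF H] .
  have "submodule H K A" using H unfolding subalg_def by blast
  then have "module_gen K A S \<subseteq> H" using module_gen_least S by blast
  moreover have "S \<subseteq> carrier A" using S H unfolding subalg_iff by blast
  ultimately show "module_gen K (A\<lparr>carrier := H\<rparr>) S \<subseteq> module_gen K A S"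
    by (intro module_gen_least) (auto simp: submodule_restrict_iff[OF H] module_gen_submodule
        module_gen_superset[THEN subsetD])
  have "submodule (module_gen K (A\<lparr>carrier := H\<rparr>) S) K (A\<lparr>carrier := H\<rparr>)"
    using H.module_gen_submodule S by simp
  then show "module_gen K A S \<subseteq> module_gen K (A\<lparr>carrier := H\<rparr>) S"
    by (intro module_gen_least) (auto simp: submodule_restrict_iff[OF H]
        module_gen_superset[THEN subsetD])
qed

lemma subalg_gen_restrict:
  assumes H: "subalg K A H" and S: "S \<subseteq> H"
  shows "subalg_gen K (A\<lparr>carrier := H\<rparr>) S = subalg_gen K A S"
proof
  interpret H: nonunital_algebra K "A\<lparr>carrier := H\<rparr>" using subalg_algebra[OF H] .
  have Sc: "S \<subseteq> carrier A" using S H unfolding subalg_iff by blast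
  show "subalg_gen K (A\<lparr>carrier := H\<rparr>) S \<subseteq> subalg_gen K A S"
    by (intro subalg_gen_least) (auto simp: subalg_restrict_iff[OF H] subalg_gen_subalg[OF Sc]
        subalg_gen_superset[THEN subsetD] subalg_gen_least[OF H S, THEN subsetD])
  have "subalg K (A\<lparr>carrier := H\<rparr>) (subalg_gen K (A\<lparr>carrier := H\<rparr>) S)"
    using H.subalg_gen_subalg S by simp
  then show "subalg_gen K A S \<subseteq> subalg_gen K (A\<lparr>carrier := H\<rparr>) S"
    by (intro subalg_gen_least) (auto simp: subalg_restrict_iff[OF H]
        subalg_gen_superset[THEN subsetD])
qed

lemma fin_gen_restrict_iff:
  assumes H: "subalg K A H"
  shows "fin_gen_alg K (A\<lparr>carrier := H\<rparr>) \<longleftrightarrow> (\<exists>S\<subseteq>H. finite S \<and> subalg_gen K A S = H)"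
  unfolding fin_gen_alg_def using subalg_gen_restrict[OF H] by auto

text \<open>
  To see that a subspace is everything it suffices to multiply by generators on one side: the
  elements that multiply \<open>W\<close> into itself form a subalgebra.
\<close>

lemma right_closed_submodule_eq_carrier:
  assumes S: "S \<subseteq> carrier A" "subalg_gen K A S = carrier A"
    and W: "submodule W K A" "S \<subseteq> W" and cl: "\<And>w s. w \<in> W \<Longrightarrow> s \<in> S \<Longrightarrow> w \<otimes>\<^bsub>A\<^esub> s \<in> W"
  shows "W = carrier A"
proof -
  note Wcl = W(1)[unfolded submodule_iff]
  let ?Q = "{a \<in> carrier A. \<forall>w\<in>W. w \<otimes>\<^bsub>A\<^esub> a \<in> W}"
  have "subalg K A ?Q"
    unfolding subalg_iff using Wcl
    by (auto simp: mult_closed mult_add_right mult_smult_right mult_zero_right subset_iff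
        mult_assoc[symmetric])
  then have "subalg_gen K A S \<subseteq> ?Q" by (rule subalg_gen_least) (use S cl in blast)
  then have "subalg K A W" using S Wcl unfolding subalg_iff by blast
  then have "carrier A \<subseteq> W" using subalg_gen_least W S by blast
  then show ?thesis using Wcl by blast
qed

lemma left_closed_submodule_eq_carrier:
  assumes S: "S \<subseteq> carrier A" "subalg_gen K A S = carrier A"
    and W: "submodule W K A" "S \<subseteq> W" and cl: "\<And>w s. w \<in> W \<Longrightarrow> s \<in> S \<Longrightarrow> s \<otimes>\<^bsub>A\<^esub> w \<in> W"
  shows "W = carrier A"
proof -
  note Wcl = W(1)[unfolded submodule_iff]
  let ?Q = "{a \<in> carrier A. \<forall>w\<in>W. a \<otimes>\<^bsub>A\<^esub> w \<in> W}"
  have "subalg K A ?Q"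
    unfolding subalg_iff using Wcl
    by (auto simp: mult_closed mult_add_left mult_smult_left mult_zero_left subset_iff mult_assoc)
  then have "subalg_gen K A S \<subseteq> ?Q" by (rule subalg_gen_least) (use S cl in blast)
  then have "subalg K A W" using S Wcl unfolding subalg_iff by blast
  then have "carrier A \<subseteq> W" using subalg_gen_least W S by blast
  then show ?thesis using Wcl by blast
qed

end

lemma subalg_submodule: "subalg K A H \<Longrightarrow> submodule H K A"
  unfolding subalg_def by blast

lemma alg_ideal_submodule: "alg_ideal K A I \<Longrightarrow> submodule I K A"
  unfolding alg_ideal_def by blast

context nonunital_algebra
begin

lemma subalg_subset: "subalg K A H \<Longrightarrow> H \<subseteq> carrier A"
  unfolding subalg_iff by blast

lemma alg_ideal_subset: "alg_ideal K A I \<Longrightarrow> I \<subseteq> carrier A"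
  unfolding alg_ideal_iff by blast

end

subsection \<open>Transport along homomorphisms\<close>

lemma alg_hom_zero:
  assumes "nonunital_algebra K A" "nonunital_algebra K B" "h \<in> alg_hom K A B"
  shows "h \<zero>\<^bsub>A\<^esub> = \<zero>\<^bsub>B\<^esub>"
  using lin_map_zero[OF assms(1,2)[THEN nonunital_algebra.is_module] alg_hom_lin_map[OF assms(3)]] .

lemma alg_hom_restrict:
  assumes "h \<in> alg_hom K A B" "H \<subseteq> carrier A" "h ` H \<subseteq> G"
  shows "h \<in> alg_hom K (A\<lparr>carrier := H\<rparr>) (B\<lparr>carrier := G\<rparr>)"
  using assms unfolding alg_hom_def by (auto simp: Pi_iff subset_iff)

lemma alg_hom_restrict_dom:
  assumes "h \<in> alg_hom K A B" "H \<subseteq> carrier A"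
  shows "h \<in> alg_hom K (A\<lparr>carrier := H\<rparr>) B"
  using assms unfolding alg_hom_def by (auto simp: Pi_iff subset_iff)

lemma subalg_vimage:
  assumes "nonunital_algebra K A" "nonunital_algebra K B" "h \<in> alg_hom K A B" "subalg K B G"
  shows "subalg K A {x \<in> carrier A. h x \<in> G}"
proof -
  interpret A: nonunital_algebra K A by fact
  interpret B: nonunital_algebra K B by fact
  show ?thesis using assms(4) submodule_vimage[OF A.is_module B.is_module alg_hom_lin_map[OF assms(3)], of G]
      alg_homE(3)[OF assms(3)]
    unfolding subalg_def by (auto simp: A.mult_closed)
qed

lemma alg_ideal_vimage:
  assumes "nonunital_algebra K A" "nonunital_algebra K B" "h \<in> alg_hom K A B" "alg_ideal K B J"
  shows "alg_ideal K A {x \<in> carrier A. h x \<in> J}"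
proof -
  interpret A: nonunital_algebra K A by fact
  interpret B: nonunital_algebra K B by fact
  show ?thesis using assms(4) submodule_vimage[OF A.is_module B.is_module alg_hom_lin_map[OF assms(3)], of J]
      alg_homE(1,3)[OF assms(3)]
    unfolding alg_ideal_def by (auto simp: A.mult_closed)
qed

lemma alg_ker_ideal:
  assumes "nonunital_algebra K A" "nonunital_algebra K B" "h \<in> alg_hom K A B"
  shows "alg_ideal K A (alg_ker A B h)"
  using alg_ideal_vimage[OF assms nonunital_algebra.alg_ideal_zero[OF assms(2)]] by simp

lemma subalg_image:
  assumes "nonunital_algebra K A" "nonunital_algebra K B" "h \<in> alg_hom K A B" "subalg K A H"
  shows "subalg K B (h ` H)"
proof -
  interpret A: nonunital_algebra K A by fact
  interpret B: nonunital_algebra K B by fact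
  have "H \<subseteq> carrier A" using assms(4) unfolding A.subalg_iff by blast
  then have "h x \<otimes>\<^bsub>B\<^esub> h y \<in> h ` H" if "x \<in> H" "y \<in> H" for x y
    using that assms(4) alg_homE(3)[OF assms(3), of x y] unfolding subalg_def by (metis imageI subsetD)
  then show ?thesis using assms(4) submodule_image[OF A.is_module B.is_module alg_hom_lin_map[OF assms(3)], of H]
    unfolding subalg_def by blast
qed

lemma image_subalg_gen:
  assumes "nonunital_algebra K A" "nonunital_algebra K B" "h \<in> alg_hom K A B" "S \<subseteq> carrier A"
  shows "h ` subalg_gen K A S = subalg_gen K B (h ` S)"
proof
  interpret A: nonunital_algebra K A by fact
  interpret B: nonunital_algebra K B by fact
  have c: "h ` S \<subseteq> carrier B" using assms(4) alg_homE(1)[OF assms(3)] by blast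
  have "subalg_gen K A S \<subseteq> {x \<in> carrier A. h x \<in> subalg_gen K B (h ` S)}"
    by (rule subalg_gen_least[OF subalg_vimage[OF assms(1-3) B.subalg_gen_subalg[OF c]]])
      (use assms(4) subalg_gen_superset[of "h ` S" K B] in blast)
  then show "h ` subalg_gen K A S \<subseteq> subalg_gen K B (h ` S)" by blast
  show "subalg_gen K B (h ` S) \<subseteq> h ` subalg_gen K A S"
    by (rule subalg_gen_least[OF subalg_image[OF assms(1-3) A.subalg_gen_subalg[OF assms(4)]]])
      (use subalg_gen_superset[of S K A] in blast)
qed

lemma image_ideal_gen_subset:
  assumes "nonunital_algebra K A" "nonunital_algebra K B" "h \<in> alg_hom K A B" "S \<subseteq> carrier A"
    and "alg_ideal K B J" "h ` S \<subseteq> J"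
  shows "h ` ideal_gen K A S \<subseteq> J"
  using ideal_gen_least[OF alg_ideal_vimage[OF assms(1-3,5)], of S] assms(4,6) by blast

lemma fin_gen_alg_image:
  assumes "nonunital_algebra K A" "nonunital_algebra K B" "h \<in> alg_hom K A B"
    "h ` carrier A = carrier B" "fin_gen_alg K A"
  shows "fin_gen_alg K B"
proof -
  obtain S where S: "S \<subseteq> carrier A" "finite S" "subalg_gen K A S = carrier A"
    using assms(5) unfolding fin_gen_alg_def by blast
  then have "subalg_gen K B (h ` S) = carrier B" using image_subalg_gen[OF assms(1-3) S(1)] assms(4) by simp
  moreover have "h ` S \<subseteq> carrier B" using S(1) assms(4) by blast
  ultimately show ?thesis unfolding fin_gen_alg_def using S(2) by blast
qed

lemma fibre_difference_in_ker:
  assumes "nonunital_algebra K A" "nonunital_algebra K B" "h \<in> alg_hom K A B"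
    and "x \<in> carrier A" "y \<in> carrier A" "h x = h y"
  shows "x \<ominus>\<^bsub>A\<^esub> y \<in> alg_ker A B h"
proof -
  interpret A: nonunital_algebra K A by fact
  interpret B: nonunital_algebra K B by fact
  have "h (x \<ominus>\<^bsub>A\<^esub> y) = h x \<ominus>\<^bsub>B\<^esub> h y"
    using lin_map_minus[OF A.is_module B.is_module alg_hom_lin_map[OF assms(3)] assms(4,5)] .
  then show ?thesis using assms alg_homE(1)[OF assms(3)] by (simp add: B.M.minus_eq B.M.r_neg)
qed

section \<open>Free algebras\<close>

definition free_word :: "('k, 'm) ring_scheme \<Rightarrow> 'x list \<Rightarrow> 'x list \<Rightarrow> 'k" where
  "free_word K w = (\<lambda>u. if u = w then \<one>\<^bsub>K\<^esub> else \<zero>\<^bsub>K\<^esub>)"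

context cring
begin

lemma free_alg_simps:
  "\<zero>\<^bsub>free_alg R V\<^esub> = (\<lambda>w. \<zero>)"
  "f \<oplus>\<^bsub>free_alg R V\<^esub> g = (\<lambda>w. f w \<oplus> g w)"
  "a \<odot>\<^bsub>free_alg R V\<^esub> f = (\<lambda>w. a \<otimes> f w)"
  "f \<otimes>\<^bsub>free_alg R V\<^esub> g = (\<lambda>w. \<Oplus>j\<in>{0<..<length w}. f (take j w) \<otimes> g (drop j w))"
  unfolding free_alg_def by simp_all

lemma free_alg_carrier:
  "f \<in> carrier (free_alg R V) \<longleftrightarrow> (\<forall>w. f w \<in> carrier R) \<and> finite {w. f w \<noteq> \<zero>} \<and>
    {w. f w \<noteq> \<zero>} \<subseteq> lists V - {[]}"
  unfolding free_alg_def by simp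

lemma free_alg_coeff [simp]: "f \<in> carrier (free_alg R V) \<Longrightarrow> f w \<in> carrier R"
  unfolding free_alg_carrier by blast

lemma free_alg_carrierI:
  assumes "\<And>w. f w \<in> carrier R" "finite F" "F \<subseteq> lists V - {[]}" "\<And>w. w \<notin> F \<Longrightarrow> f w = \<zero>"
  shows "f \<in> carrier (free_alg R V)"
proof -
  have "{w. f w \<noteq> \<zero>} \<subseteq> F" using assms(4) by blast
  then show ?thesis using assms(1-3) finite_subset[of _ F] unfolding free_alg_carrier by blast
qed

lemma free_alg_supp:
  assumes "f \<in> carrier (free_alg R V)"
  shows "finite {w. f w \<noteq> \<zero>}" "{w. f w \<noteq> \<zero>} \<subseteq> lists V - {[]}"
  using assms unfolding free_alg_carrier by auto

lemma free_word_closed: "w \<in> lists V - {[]} \<Longrightarrow> free_word R w \<in> carrier (free_alg R V)"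
  by (rule free_alg_carrierI[of _ "{w}"]) (auto simp: free_word_def)

lemma free_letter_closed: "x \<in> V \<Longrightarrow> free_word R [x] \<in> carrier (free_alg R V)"
  by (rule free_word_closed) simp

lemma free_alg_module: "module R (free_alg R V)"
proof (rule moduleI)
  show "cring R" by (rule is_cring)
  have add: "f \<oplus>\<^bsub>free_alg R V\<^esub> g \<in> carrier (free_alg R V)"
    if "f \<in> carrier (free_alg R V)" "g \<in> carrier (free_alg R V)" for f g
    by (rule free_alg_carrierI[of _ "{w. f w \<noteq> \<zero>} \<union> {w. g w \<noteq> \<zero>}"])
      (use free_alg_supp[OF that(1)] free_alg_supp[OF that(2)] that in \<open>auto simp: free_alg_simps\<close>)
  show smult: "a \<odot>\<^bsub>free_alg R V\<^esub> f \<in> carrier (free_alg R V)"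
    if "a \<in> carrier R" "f \<in> carrier (free_alg R V)" for a f
    by (rule free_alg_carrierI[of _ "{w. f w \<noteq> \<zero>}"])
      (use free_alg_supp[OF that(2)] that in \<open>auto simp: free_alg_simps\<close>)
  show "abelian_group (free_alg R V)"
  proof (rule abelian_groupI)
    show "\<zero>\<^bsub>free_alg R V\<^esub> \<in> carrier (free_alg R V)"
      by (rule free_alg_carrierI[of _ "{}"]) (auto simp: free_alg_simps)
    fix f assume f: "f \<in> carrier (free_alg R V)"
    have "(\<ominus> \<one>) \<odot>\<^bsub>free_alg R V\<^esub> f \<oplus>\<^bsub>free_alg R V\<^esub> f = \<zero>\<^bsub>free_alg R V\<^esub>"
      using f by (auto simp: free_alg_simps l_minus l_neg)
    then show "\<exists>g\<in>carrier (free_alg R V). g \<oplus>\<^bsub>free_alg R V\<^esub> f = \<zero>\<^bsub>free_alg R V\<^esub>"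
      using smult[OF _ f, of "\<ominus> \<one>"] by auto
  qed (auto simp: free_alg_simps a_ac add[unfolded free_alg_simps])
qed (auto simp: free_alg_simps l_distr r_distr m_assoc)

lemma free_alg_span_words:
  assumes "finite F" "F \<subseteq> lists V - {[]}" "f \<in> carrier (free_alg R V)" "\<And>w. w \<notin> F \<Longrightarrow> f w = \<zero>"
  shows "f \<in> module_gen R (free_alg R V) (free_word R ` F)"
  using assms
proof (induction F arbitrary: f rule: finite_induct)
  case empty
  then have "f = \<zero>\<^bsub>free_alg R V\<^esub>" by (auto simp: free_alg_simps)
  then show ?case using module.module_gen_closed(1)[OF free_alg_module, of "{}" V] by simp
next
  case (insert w F)
  let ?M = "module_gen R (free_alg R V) (free_word R ` insert w F)"
  have S: "free_word R ` insert w F \<subseteq> carrier (free_alg R V)"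
    by (intro image_subsetI free_word_closed) (use insert.prems in blast)
  note cl = module.module_gen_closed[OF free_alg_module S]
  define g where "g = f(w := \<zero>)"
  have "g \<in> carrier (free_alg R V)"
    by (rule free_alg_carrierI[of _ F]) (use insert in \<open>auto simp: g_def\<close>)
  then have "g \<in> module_gen R (free_alg R V) (free_word R ` F)"
    by (rule insert.IH[rotated]) (use insert.prems in \<open>auto simp: g_def\<close>)
  moreover have "module_gen R (free_alg R V) (free_word R ` F) \<subseteq> ?M"
    by (rule module_gen_mono) blast
  ultimately have "g \<in> ?M" by blast
  moreover have "f w \<odot>\<^bsub>free_alg R V\<^esub> free_word R w \<in> ?M"
    by (rule cl(3)[OF _ module_gen_superset[THEN subsetD]]) (use insert.prems in auto)
  moreover have "f = g \<oplus>\<^bsub>free_alg R V\<^esub> f w \<odot>\<^bsub>free_alg R V\<^esub> free_word R w"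
    using insert.prems by (auto simp: free_alg_simps g_def free_word_def)
  ultimately show ?case using cl(2) by metis
qed

lemma free_alg_span:
  "module_gen R (free_alg R V) (free_word R ` (lists V - {[]})) = carrier (free_alg R V)"
proof
  have S: "free_word R ` (lists V - {[]}) \<subseteq> carrier (free_alg R V)"
    by (intro image_subsetI free_word_closed)
  then show "module_gen R (free_alg R V) (free_word R ` (lists V - {[]})) \<subseteq> carrier (free_alg R V)"
    by (rule module.module_gen_carrier[OF free_alg_module])
  show "carrier (free_alg R V) \<subseteq> module_gen R (free_alg R V) (free_word R ` (lists V - {[]}))"
  proof
    fix f assume f: "f \<in> carrier (free_alg R V)"
    have "f \<in> module_gen R (free_alg R V) (free_word R ` {w. f w \<noteq> \<zero>})"
      by (rule free_alg_span_words) (use f free_alg_supp[OF f] in auto)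
    then show "f \<in> module_gen R (free_alg R V) (free_word R ` (lists V - {[]}))"
      using module_gen_mono[of "free_word R ` {w. f w \<noteq> \<zero>}" "free_word R ` (lists V - {[]})"]
        free_alg_supp[OF f] by blast
  qed
qed

lemma free_alg_mult_support:
  assumes f: "f \<in> carrier (free_alg R V)" and g: "g \<in> carrier (free_alg R V)"
    and w: "(f \<otimes>\<^bsub>free_alg R V\<^esub> g) w \<noteq> \<zero>"
  obtains (cut) j where "j \<in> {0<..<length w}" "f (take j w) \<noteq> \<zero>" "g (drop j w) \<noteq> \<zero>"
proof (rule ccontr)
  assume "\<not> thesis"
  then have "f (take j w) = \<zero> \<or> g (drop j w) = \<zero>" if "j \<in> {0<..<length w}" for j
    using cut[OF that] by blast
  then have "f (take j w) \<otimes> g (drop j w) = \<zero>" if "j \<in> {0<..<length w}" for j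
    using that f g by (metis free_alg_coeff l_null r_null)
  then have "(f \<otimes>\<^bsub>free_alg R V\<^esub> g) w = \<zero>"
    unfolding free_alg_simps by (intro add.finprod_one_eqI) auto
  then show False using w by blast
qed

lemma free_alg_mult_closed:
  assumes f: "f \<in> carrier (free_alg R V)" and g: "g \<in> carrier (free_alg R V)"
  shows "f \<otimes>\<^bsub>free_alg R V\<^esub> g \<in> carrier (free_alg R V)"
proof (rule free_alg_carrierI)
  let ?F = "(\<lambda>(u, v). u @ v) ` ({w. f w \<noteq> \<zero>} \<times> {w. g w \<noteq> \<zero>})"
  show "finite ?F" using free_alg_supp(1)[OF f] free_alg_supp(1)[OF g] by blast
  have app: "u @ v \<in> lists V - {[]}" if "f u \<noteq> \<zero>" "g v \<noteq> \<zero>" for u v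
  proof -
    have "u \<in> lists V - {[]}" "v \<in> lists V - {[]}"
      using that free_alg_supp(2)[OF f] free_alg_supp(2)[OF g] by blast+
    then show ?thesis by simp
  qed
  show "?F \<subseteq> lists V - {[]}"
  proof (rule image_subsetI)
    fix p assume "p \<in> {w. f w \<noteq> \<zero>} \<times> {w. g w \<noteq> \<zero>}"
    then show "(case p of (u, v) \<Rightarrow> u @ v) \<in> lists V - {[]}"
      using app[of "fst p" "snd p"] by (simp add: case_prod_beta mem_Times_iff)
  qed
  show "(f \<otimes>\<^bsub>free_alg R V\<^esub> g) w \<in> carrier R" for w
    unfolding free_alg_simps using f g by (intro finsum_closed) auto
  show "(f \<otimes>\<^bsub>free_alg R V\<^esub> g) w = \<zero>" if w: "w \<notin> ?F" for w
  proof (rule ccontr)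
    assume "(f \<otimes>\<^bsub>free_alg R V\<^esub> g) w \<noteq> \<zero>"
    then obtain j where "f (take j w) \<noteq> \<zero>" "g (drop j w) \<noteq> \<zero>"
      using free_alg_mult_support[OF f g] by metis
    then have "take j w @ drop j w \<in> ?F" by blast
    then show False using w by simp
  qed
qed

lemma free_alg_left_mult_lin_map:
  assumes f: "f \<in> carrier (free_alg R V)"
  shows "(\<lambda>g. f \<otimes>\<^bsub>free_alg R V\<^esub> g) \<in> lin_map R (free_alg R V) (free_alg R V)"
proof -
  have "f \<otimes>\<^bsub>free_alg R V\<^esub> (g \<oplus>\<^bsub>free_alg R V\<^esub> h) =
      f \<otimes>\<^bsub>free_alg R V\<^esub> g \<oplus>\<^bsub>free_alg R V\<^esub> f \<otimes>\<^bsub>free_alg R V\<^esub> h"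
    if "g \<in> carrier (free_alg R V)" "h \<in> carrier (free_alg R V)" for g h
    using f that unfolding free_alg_simps by (auto simp: r_distr finsum_addf Pi_iff)
  moreover have "f \<otimes>\<^bsub>free_alg R V\<^esub> (a \<odot>\<^bsub>free_alg R V\<^esub> g) =
      a \<odot>\<^bsub>free_alg R V\<^esub> (f \<otimes>\<^bsub>free_alg R V\<^esub> g)"
    if "a \<in> carrier R" "g \<in> carrier (free_alg R V)" for a g
    using f that unfolding free_alg_simps
    by (subst finsum_rdistr) (auto simp: m_lcomm Pi_iff)
  ultimately show ?thesis unfolding lin_map_def using free_alg_mult_closed[OF f] by blast
qed

lemma free_alg_right_mult_lin_map:
  assumes f: "f \<in> carrier (free_alg R V)"
  shows "(\<lambda>g. g \<otimes>\<^bsub>free_alg R V\<^esub> f) \<in> lin_map R (free_alg R V) (free_alg R V)"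
proof -
  have "(g \<oplus>\<^bsub>free_alg R V\<^esub> h) \<otimes>\<^bsub>free_alg R V\<^esub> f =
      g \<otimes>\<^bsub>free_alg R V\<^esub> f \<oplus>\<^bsub>free_alg R V\<^esub> h \<otimes>\<^bsub>free_alg R V\<^esub> f"
    if "g \<in> carrier (free_alg R V)" "h \<in> carrier (free_alg R V)" for g h
    using f that unfolding free_alg_simps by (auto simp: l_distr finsum_addf Pi_iff)
  moreover have "(a \<odot>\<^bsub>free_alg R V\<^esub> g) \<otimes>\<^bsub>free_alg R V\<^esub> f =
      a \<odot>\<^bsub>free_alg R V\<^esub> (g \<otimes>\<^bsub>free_alg R V\<^esub> f)"
    if "a \<in> carrier R" "g \<in> carrier (free_alg R V)" for a g
    using f that unfolding free_alg_simps
    by (subst finsum_rdistr) (auto simp: m_assoc Pi_iff)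
  ultimately show ?thesis unfolding lin_map_def using free_alg_mult_closed[OF _ f] by blast
qed

text \<open>
  In the convolution sum at \<open>w\<close> only the cut at position \<open>k\<close> contributes; this computes products
  of words, and later leading coefficients of products.
\<close>

lemma free_alg_mult_single_cut:
  assumes f: "f \<in> carrier (free_alg R V)" and g: "g \<in> carrier (free_alg R V)"
    and k: "k \<in> {0<..<length w}"
    and other: "\<And>j. j \<in> {0<..<length w} \<Longrightarrow> j \<noteq> k \<Longrightarrow> f (take j w) = \<zero> \<or> g (drop j w) = \<zero>"
  shows "(f \<otimes>\<^bsub>free_alg R V\<^esub> g) w = f (take k w) \<otimes> g (drop k w)"
proof -
  have "f (take j w) \<otimes> g (drop j w) = (if k = j then f (take j w) \<otimes> g (drop j w) else \<zero>)"
    if "j \<in> {0<..<length w}" for j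
    using other[OF that] f g by (metis free_alg_coeff l_null r_null)
  then have "(f \<otimes>\<^bsub>free_alg R V\<^esub> g) w
      = (\<Oplus>j\<in>{0<..<length w}. if k = j then f (take j w) \<otimes> g (drop j w) else \<zero>)"
    unfolding free_alg_simps using f g by (intro finsum_cong') auto
  also have "\<dots> = f (take k w) \<otimes> g (drop k w)"
    using k f g by (intro finsum_singleton) auto
  finally show ?thesis .
qed

lemma free_word_mult:
  assumes u: "u \<in> lists V - {[]}" and v: "v \<in> lists V - {[]}"
  shows "free_word R u \<otimes>\<^bsub>free_alg R V\<^esub> free_word R v = free_word R (u @ v)"
proof
  fix w
  note c = free_word_closed[OF u] free_word_closed[OF v]
  show "(free_word R u \<otimes>\<^bsub>free_alg R V\<^esub> free_word R v) w = free_word R (u @ v) w"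
  proof (cases "w = u @ v")
    case True
    have "take j w \<noteq> u" if "j \<in> {0<..<length w}" "j \<noteq> length u" for j using that by auto
    then have "(free_word R u \<otimes>\<^bsub>free_alg R V\<^esub> free_word R v) w
        = free_word R u (take (length u) w) \<otimes> free_word R v (drop (length u) w)"
      by (intro free_alg_mult_single_cut[OF c]) (use u v True in \<open>auto simp: free_word_def\<close>)
    then show ?thesis using True by (simp add: free_word_def)
  next
    case False
    have "(free_word R u \<otimes>\<^bsub>free_alg R V\<^esub> free_word R v) w = \<zero>"
    proof (rule ccontr)
      assume "(free_word R u \<otimes>\<^bsub>free_alg R V\<^esub> free_word R v) w \<noteq> \<zero>"
      then obtain j where "free_word R u (take j w) \<noteq> \<zero>" "free_word R v (drop j w) \<noteq> \<zero>"
        using free_alg_mult_support[OF c] by metis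
      then have "take j w = u" "drop j w = v" unfolding free_word_def by metis+
      then show False using False append_take_drop_id[of j w] by simp
    qed
    then show ?thesis using False by (simp add: free_word_def)
  qed
qed

text \<open>
  Both sides are linear in each argument, and on words the multiplication is concatenation.
\<close>

lemma free_alg_mult_assoc:
  assumes "f \<in> carrier (free_alg R V)" "g \<in> carrier (free_alg R V)" "h \<in> carrier (free_alg R V)"
  shows "(f \<otimes>\<^bsub>free_alg R V\<^esub> g) \<otimes>\<^bsub>free_alg R V\<^esub> h = f \<otimes>\<^bsub>free_alg R V\<^esub> (g \<otimes>\<^bsub>free_alg R V\<^esub> h)"
proof -
  let ?F = "free_alg R V" and ?W = "lists V - {[]} :: 'c list set"
  have S: "free_word R ` ?W \<subseteq> carrier ?F" by (intro image_subsetI free_word_closed)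
  note eq = lin_maps_eq_on_span[OF free_alg_module free_alg_module _ _ S, unfolded free_alg_span]
  note left = free_alg_left_mult_lin_map[where V = V]
  note right = free_alg_right_mult_lin_map[where V = V]
  note mc = free_alg_mult_closed[where V = V] and wc = free_word_closed[where V = V]
  have 1: "(free_word R u \<otimes>\<^bsub>?F\<^esub> free_word R v) \<otimes>\<^bsub>?F\<^esub> h = free_word R u \<otimes>\<^bsub>?F\<^esub> (free_word R v \<otimes>\<^bsub>?F\<^esub> h)"
    if u: "u \<in> ?W" and v: "v \<in> ?W" and h: "h \<in> carrier ?F" for u v h
    by (rule eq[OF left[OF mc[OF wc[OF u] wc[OF v]]]
          lin_map_compose[OF left[OF wc[OF v]] left[OF wc[OF u]]] _ h])
      (elim imageE, use u v in \<open>simp add: free_word_mult\<close>)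
  have 2: "(free_word R u \<otimes>\<^bsub>?F\<^esub> g) \<otimes>\<^bsub>?F\<^esub> h = free_word R u \<otimes>\<^bsub>?F\<^esub> (g \<otimes>\<^bsub>?F\<^esub> h)"
    if u: "u \<in> ?W" and g: "g \<in> carrier ?F" and h: "h \<in> carrier ?F" for u g h
    by (rule eq[OF lin_map_compose[OF left[OF wc[OF u]] right[OF h]]
          lin_map_compose[OF right[OF h] left[OF wc[OF u]]] _ g])
      (use 1[OF u _ h] in auto)
  show ?thesis
    by (rule eq[OF lin_map_compose[OF right[OF assms(2)] right[OF assms(3)]]
          right[OF mc[OF assms(2,3)]] _ assms(1)])
      (use 2[OF _ assms(2,3)] in auto)
qed

lemma free_alg_algebra: "nonunital_algebra R (free_alg R V)"
proof (intro nonunital_algebra.intro nonunital_algebra_axioms.intro free_alg_module)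
qed (simp_all add: free_alg_mult_closed free_alg_mult_assoc
    lin_mapE(2,3)[OF free_alg_left_mult_lin_map] lin_mapE(2,3)[OF free_alg_right_mult_lin_map])

lemma free_alg_generated: 
  "subalg_gen R (free_alg R V) ((\<lambda>x. free_word R [x]) ` V) = carrier (free_alg R V)"
proof -
  interpret F: nonunital_algebra R "free_alg R V" by (rule free_alg_algebra)
  let ?H = "subalg_gen R (free_alg R V) ((\<lambda>x. free_word R [x]) ` V)"
  have "(\<lambda>x. free_word R [x]) ` V \<subseteq> carrier (free_alg R V)" by (auto intro: free_letter_closed)
  then have H: "subalg R (free_alg R V) ?H" by (rule F.subalg_gen_subalg)
  have "free_word R w \<in> ?H" if "w \<in> lists V - {[]}" for w
    using that
  proof (induction w)
    case (Cons x w)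
    have x: "free_word R [x] \<in> ?H" by (rule subalg_gen_superset[THEN subsetD]) (use Cons.prems in auto)
    show ?case
    proof (cases "w = []")
      case False
      then have "free_word R [x] \<otimes>\<^bsub>free_alg R V\<^esub> free_word R w \<in> ?H"
        using Cons x H unfolding subalg_def by auto
      then show ?thesis using free_word_mult[of "[x]" V w] Cons.prems False by simp
    qed (use x in simp)
  qed simp
  then have "free_word R ` (lists V - {[]}) \<subseteq> ?H" by (rule image_subsetI)
  then have "carrier (free_alg R V) \<subseteq> ?H"
    using module_gen_least[of ?H R "free_alg R V"] H unfolding subalg_def free_alg_span[symmetric] by simp
  then show ?thesis using H unfolding F.subalg_iff by blast
qed

end

subsection \<open>The universal property\<close>

fun word_val :: "('k, 'a, 'n) module_scheme \<Rightarrow> ('x \<Rightarrow> 'a) \<Rightarrow> 'x list \<Rightarrow> 'a" where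
  "word_val A g [] = \<zero>\<^bsub>A\<^esub>"
| "word_val A g [x] = g x"
| "word_val A g (x # y # w) = g x \<otimes>\<^bsub>A\<^esub> word_val A g (y # w)"

context nonunital_algebra
begin

lemma word_val_closed:
  assumes "g \<in> V \<rightarrow> carrier A" "w \<in> lists V"
  shows "word_val A g w \<in> carrier A"
  using assms(2)
proof (induction w)
  case (Cons x w)
  then show ?case using assms(1) by (cases w) (auto intro!: mult_closed)
qed simp

lemma word_val_append:
  assumes "g \<in> V \<rightarrow> carrier A" "u \<in> lists V - {[]}" "v \<in> lists V - {[]}"
  shows "word_val A g (u @ v) = word_val A g u \<otimes>\<^bsub>A\<^esub> word_val A g v"
  using assms(2)
proof (induction u)
  case (Cons x u)
  have v: "word_val A g v \<in> carrier A" "word_val A g u \<in> carrier A" and x: "g x \<in> carrier A"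
    using assms Cons.prems word_val_closed[OF assms(1)] by auto
  obtain y w where yw: "v = y # w" using assms(3) by (cases v) auto
  show ?case
  proof (cases u)
    case Nil
    then show ?thesis using yw by simp
  next
    case (Cons z t)
    then show ?thesis using Cons.IH Cons.prems v x by (simp add: mult_assoc)
  qed
qed simp

definition word_eval :: "('x \<Rightarrow> 'a) \<Rightarrow> ('x list \<Rightarrow> 'k) \<Rightarrow> 'a" where
  "word_eval g f = (\<Oplus>\<^bsub>A\<^esub>w\<in>{w. f w \<noteq> \<zero>\<^bsub>K\<^esub>}. f w \<odot>\<^bsub>A\<^esub> word_val A g w)"

lemma word_eval_superset:
  assumes g: "g \<in> V \<rightarrow> carrier A" and f: "f \<in> carrier (free_alg K V)"
    and F: "finite F" "F \<subseteq> lists V" "{w. f w \<noteq> \<zero>\<^bsub>K\<^esub>} \<subseteq> F"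
  shows "word_eval g f = (\<Oplus>\<^bsub>A\<^esub>w\<in>F. f w \<odot>\<^bsub>A\<^esub> word_val A g w)"
proof -
  have c: "word_val A g w \<in> carrier A" if "w \<in> F" for w using that F word_val_closed[OF g] by blast
  show ?thesis unfolding word_eval_def
    by (rule M.add.finprod_mono_neutral_cong_left)
      (use F c R.free_alg_coeff[OF f] in auto)
qed

lemma word_eval_free_word:
  assumes g: "g \<in> V \<rightarrow> carrier A" and w: "w \<in> lists V - {[]}"
  shows "word_eval g (free_word K w) = word_val A g w"
proof -
  have c: "word_val A g w \<in> carrier A" using word_val_closed[OF g] w by blast
  have "word_eval g (free_word K w) = (\<Oplus>\<^bsub>A\<^esub>u\<in>{w}. free_word K w u \<odot>\<^bsub>A\<^esub> word_val A g u)"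
    by (rule word_eval_superset[OF g R.free_word_closed[OF w]]) (use w in \<open>auto simp: free_word_def\<close>)
  also have "\<dots> = word_val A g w" using c by (simp add: free_word_def)
  finally show ?thesis .
qed

lemma word_eval_lin_map:
  assumes g: "g \<in> V \<rightarrow> carrier A"
  shows "word_eval g \<in> lin_map K (free_alg K V) A"
proof -
  let ?F = "free_alg K V"
  interpret F: module K ?F by (rule R.free_alg_module)
  have c: "f w \<odot>\<^bsub>A\<^esub> word_val A g w \<in> carrier A" if "f \<in> carrier ?F" "w \<in> lists V" for f w
    using that word_val_closed[OF g] R.free_alg_coeff[of f V] by blast
  have cP: "(\<lambda>w. f w \<odot>\<^bsub>A\<^esub> word_val A g w) \<in> S \<rightarrow> carrier A"
    if "f \<in> carrier ?F" "S \<subseteq> lists V" for f S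
    using c that by blast
  have supp: "finite {w. f w \<noteq> \<zero>\<^bsub>K\<^esub>}" "{w. f w \<noteq> \<zero>\<^bsub>K\<^esub>} \<subseteq> lists V" if "f \<in> carrier ?F" for f
    using R.free_alg_supp[OF that] by blast+
  have "word_eval g f \<in> carrier A" if f: "f \<in> carrier ?F" for f
    unfolding word_eval_def by (intro M.finsum_closed cP f supp)
  moreover have "word_eval g (f \<oplus>\<^bsub>?F\<^esub> h) = word_eval g f \<oplus>\<^bsub>A\<^esub> word_eval g h"
    if f: "f \<in> carrier ?F" and h: "h \<in> carrier ?F" for f h
  proof -
    let ?S = "{w. f w \<noteq> \<zero>\<^bsub>K\<^esub>} \<union> {w. h w \<noteq> \<zero>\<^bsub>K\<^esub>}"
    have S: "finite ?S" "?S \<subseteq> lists V" using supp f h by auto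
    have "word_eval g (f \<oplus>\<^bsub>?F\<^esub> h) = (\<Oplus>\<^bsub>A\<^esub>w\<in>?S. (f \<oplus>\<^bsub>?F\<^esub> h) w \<odot>\<^bsub>A\<^esub> word_val A g w)"
      by (rule word_eval_superset[OF g F.M.a_closed[OF f h] S]) (use f h in \<open>auto simp: R.free_alg_simps\<close>)
    also have "\<dots> = (\<Oplus>\<^bsub>A\<^esub>w\<in>?S. f w \<odot>\<^bsub>A\<^esub> word_val A g w \<oplus>\<^bsub>A\<^esub> h w \<odot>\<^bsub>A\<^esub> word_val A g w)"
    proof (rule M.finsum_cong')
      fix w assume "w \<in> ?S"
      then have "w \<in> lists V" using S by blast
      then show "(f \<oplus>\<^bsub>?F\<^esub> h) w \<odot>\<^bsub>A\<^esub> word_val A g w = f w \<odot>\<^bsub>A\<^esub> word_val A g w \<oplus>\<^bsub>A\<^esub> h w \<odot>\<^bsub>A\<^esub> word_val A g w"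
        using word_val_closed[OF g] f h by (simp add: R.free_alg_simps smult_l_distr)
    qed (use cP[OF f S(2)] cP[OF h S(2)] in auto)
    also have "\<dots> = (\<Oplus>\<^bsub>A\<^esub>w\<in>?S. f w \<odot>\<^bsub>A\<^esub> word_val A g w) \<oplus>\<^bsub>A\<^esub> (\<Oplus>\<^bsub>A\<^esub>w\<in>?S. h w \<odot>\<^bsub>A\<^esub> word_val A g w)"
      by (rule M.finsum_addf[OF cP[OF f S(2)] cP[OF h S(2)]])
    also have "\<dots> = word_eval g f \<oplus>\<^bsub>A\<^esub> word_eval g h"
      using word_eval_superset[OF g f S] word_eval_superset[OF g h S] by simp
    finally show ?thesis .
  qed
  moreover have "word_eval g (a \<odot>\<^bsub>?F\<^esub> f) = a \<odot>\<^bsub>A\<^esub> word_eval g f"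
    if a: "a \<in> carrier K" and f: "f \<in> carrier ?F" for a f
  proof -
    let ?S = "{w. f w \<noteq> \<zero>\<^bsub>K\<^esub>}"
    have "word_eval g (a \<odot>\<^bsub>?F\<^esub> f) = (\<Oplus>\<^bsub>A\<^esub>w\<in>?S. (a \<odot>\<^bsub>?F\<^esub> f) w \<odot>\<^bsub>A\<^esub> word_val A g w)"
      by (rule word_eval_superset[OF g module.smult_closed[OF R.free_alg_module a f] supp[OF f]])
        (use a in \<open>auto simp: R.free_alg_simps\<close>)
    also have "\<dots> = (\<Oplus>\<^bsub>A\<^esub>w\<in>?S. a \<odot>\<^bsub>A\<^esub> (f w \<odot>\<^bsub>A\<^esub> word_val A g w))"
    proof (rule M.finsum_cong')
      fix w assume "w \<in> ?S"
      then have "w \<in> lists V" using supp[OF f] by blast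
      then show "(a \<odot>\<^bsub>?F\<^esub> f) w \<odot>\<^bsub>A\<^esub> word_val A g w = a \<odot>\<^bsub>A\<^esub> (f w \<odot>\<^bsub>A\<^esub> word_val A g w)"
        using word_val_closed[OF g] f a by (simp add: R.free_alg_simps smult_assoc1)
    qed (use cP[OF f supp(2)[OF f]] a in auto)
    also have "\<dots> = a \<odot>\<^bsub>A\<^esub> word_eval g f"
      unfolding word_eval_def by (intro finsum_smult_ldistr[symmetric] supp f a cP)
    finally show ?thesis .
  qed
  ultimately show ?thesis unfolding lin_map_def by blast
qed

lemma word_eval_hom:
  assumes g: "g \<in> V \<rightarrow> carrier A"
  shows "word_eval g \<in> alg_hom K (free_alg K V) A"
proof -
  let ?F = "free_alg K V" and ?W = "lists V - {[]}" and ?e = "word_eval g"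
  interpret F: nonunital_algebra K ?F by (rule R.free_alg_algebra)
  have S: "free_word K ` ?W \<subseteq> carrier ?F" by (intro image_subsetI R.free_word_closed)
  note eq = lin_maps_eq_on_span[OF F.is_module is_module _ _ S, unfolded R.free_alg_span]
  note e = word_eval_lin_map[OF g] and wc = R.free_word_closed[where V = V]
  note ec = lin_mapE(1)[OF e]
  have 1: "?e (free_word K u \<otimes>\<^bsub>?F\<^esub> h) = ?e (free_word K u) \<otimes>\<^bsub>A\<^esub> ?e h"
    if u: "u \<in> ?W" and h: "h \<in> carrier ?F" for u h
  proof (rule eq[OF _ _ _ h])
    show "(\<lambda>h. ?e (free_word K u \<otimes>\<^bsub>?F\<^esub> h)) \<in> lin_map K ?F A"
      by (rule lin_map_compose[OF F.left_mult_lin_map[OF wc[OF u]] e])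
    show "(\<lambda>h. ?e (free_word K u) \<otimes>\<^bsub>A\<^esub> ?e h) \<in> lin_map K ?F A"
      by (rule lin_map_compose[OF e left_mult_lin_map[OF ec[OF wc[OF u]]]])
    fix s assume "s \<in> free_word K ` ?W"
    then obtain v where v: "v \<in> ?W" "s = free_word K v" by blast
    then show "?e (free_word K u \<otimes>\<^bsub>?F\<^esub> s) = ?e (free_word K u) \<otimes>\<^bsub>A\<^esub> ?e s"
      using u by (simp add: R.free_word_mult[of u V v] word_eval_free_word[OF g] word_val_append[OF g])
  qed
  have 2: "?e (f \<otimes>\<^bsub>?F\<^esub> h) = ?e f \<otimes>\<^bsub>A\<^esub> ?e h" if f: "f \<in> carrier ?F" and h: "h \<in> carrier ?F" for f h
    by (rule eq[OF lin_map_compose[OF F.right_mult_lin_map[OF h] e]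
          lin_map_compose[OF e right_mult_lin_map[OF ec[OF h]]] _ f]) (use 1[OF _ h] in auto)
  show ?thesis using e 2 unfolding alg_hom_def lin_map_def by blast
qed

lemma free_alg_hom_exists:
  assumes "g \<in> V \<rightarrow> carrier A"
  obtains h where "h \<in> alg_hom K (free_alg K V) A" "\<And>x. x \<in> V \<Longrightarrow> h (free_word K [x]) = g x"
proof
  show "word_eval g \<in> alg_hom K (free_alg K V) A" by (rule word_eval_hom[OF assms])
  show "word_eval g (free_word K [x]) = g x" if "x \<in> V" for x
    using word_eval_free_word[OF assms, of "[x]"] that by simp
qed

end

section \<open>Quotients, finite corank and finite presentability\<close>

context module
begin

lemma submodule_abelian_subgroup:
  assumes "submodule N R M"
  shows "abelian_subgroup N M"
  by (intro abelian_subgroupI3 additive_subgroupI M.abelian_group_axioms submodule.axioms(1)[OF assms])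

lemma coset_eq_iff:
  assumes N: "submodule N R M" and x: "x \<in> carrier M" and y: "y \<in> carrier M"
  shows "N +>\<^bsub>M\<^esub> x = N +>\<^bsub>M\<^esub> y \<longleftrightarrow> x \<ominus>\<^bsub>M\<^esub> y \<in> N"
proof -
  interpret N: abelian_subgroup N M using submodule_abelian_subgroup[OF N] .
  show ?thesis
    using N.a_rcos_module[OF y x] N.a_repr_independence'[of x y] N.a_rcos_self[OF x] y
    unfolding M.minus_eq by auto
qed

lemma quot_simps:
  assumes N: "submodule N R M"
  shows "carrier (quot M N) = (\<lambda>x. N +>\<^bsub>M\<^esub> x) ` carrier M"
    and "\<zero>\<^bsub>quot M N\<^esub> = N"
    and "x \<in> carrier M \<Longrightarrow> y \<in> carrier M \<Longrightarrow>
      (N +>\<^bsub>M\<^esub> x) \<oplus>\<^bsub>quot M N\<^esub> (N +>\<^bsub>M\<^esub> y) = N +>\<^bsub>M\<^esub> (x \<oplus>\<^bsub>M\<^esub> y)"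
    and "a \<in> carrier R \<Longrightarrow> x \<in> carrier M \<Longrightarrow>
      a \<odot>\<^bsub>quot M N\<^esub> (N +>\<^bsub>M\<^esub> x) = N +>\<^bsub>M\<^esub> (a \<odot>\<^bsub>M\<^esub> x)"
proof -
  interpret N: abelian_subgroup N M using submodule_abelian_subgroup[OF N] .
  show "carrier (quot M N) = (\<lambda>x. N +>\<^bsub>M\<^esub> x) ` carrier M" "\<zero>\<^bsub>quot M N\<^esub> = N"
    by (auto simp: quot_def ring.defs FactRing_def A_RCOSETS_def')
  show "(N +>\<^bsub>M\<^esub> x) \<oplus>\<^bsub>quot M N\<^esub> (N +>\<^bsub>M\<^esub> y) = N +>\<^bsub>M\<^esub> (x \<oplus>\<^bsub>M\<^esub> y)"
    if "x \<in> carrier M" "y \<in> carrier M"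
    using N.a_rcos_sum[OF that] by (simp add: quot_def ring.defs FactRing_def)
  show "a \<odot>\<^bsub>quot M N\<^esub> (N +>\<^bsub>M\<^esub> x) = N +>\<^bsub>M\<^esub> (a \<odot>\<^bsub>M\<^esub> x)"
    if a: "a \<in> carrier R" and x: "x \<in> carrier M"
  proof -
    have const: "N +>\<^bsub>M\<^esub> (a \<odot>\<^bsub>M\<^esub> x') = N +>\<^bsub>M\<^esub> (a \<odot>\<^bsub>M\<^esub> x)" if x': "x' \<in> N +>\<^bsub>M\<^esub> x" for x'
    proof -
      have c: "x' \<in> carrier M" using N.a_elemrcos_carrier[OF x x'] .
      have "x' \<ominus>\<^bsub>M\<^esub> x \<in> N" using N.a_rcos_module[OF x c] x' by (simp add: M.minus_eq)
      then have "a \<odot>\<^bsub>M\<^esub> (x' \<ominus>\<^bsub>M\<^esub> x) \<in> N" using submoduleE(4)[OF N a] by blast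
      moreover have "a \<odot>\<^bsub>M\<^esub> (x' \<ominus>\<^bsub>M\<^esub> x) = a \<odot>\<^bsub>M\<^esub> x' \<ominus>\<^bsub>M\<^esub> a \<odot>\<^bsub>M\<^esub> x"
        using a x c by (simp add: M.minus_eq smult_r_distr smult_r_minus)
      ultimately show ?thesis using coset_eq_iff[OF N] a x c by simp
    qed
    have "(\<Union>x'\<in>N +>\<^bsub>M\<^esub> x. N +>\<^bsub>M\<^esub> (a \<odot>\<^bsub>M\<^esub> x')) = N +>\<^bsub>M\<^esub> (a \<odot>\<^bsub>M\<^esub> x)"
      by (rule SUP_eq_const[OF _ const]) (use N.a_rcos_self[OF x] in blast)+
    then show ?thesis by (simp add: quot_def ring.defs)
  qed
qed

lemma quot_module:
  assumes N: "submodule N R M"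
  shows "module R (quot M N)"
proof -
  interpret N: abelian_subgroup N M using submodule_abelian_subgroup[OF N] .
  note s = quot_simps[OF N]
  have N0: "N +>\<^bsub>M\<^esub> \<zero>\<^bsub>M\<^esub> = N" using N.a_rcos_const N.zero_closed by blast
  have ab: "abelian_group (quot M N)"
  proof (rule abelian_groupI)
    show "\<zero>\<^bsub>quot M N\<^esub> \<in> carrier (quot M N)" unfolding s(1,2) using N0 by blast
    show "\<zero>\<^bsub>quot M N\<^esub> \<oplus>\<^bsub>quot M N\<^esub> U = U" if "U \<in> carrier (quot M N)" for U
      using that s(3)[OF M.zero_closed] unfolding s(1) s(2) N0 by auto
    show "\<exists>V\<in>carrier (quot M N). V \<oplus>\<^bsub>quot M N\<^esub> U = \<zero>\<^bsub>quot M N\<^esub>"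
      if U: "U \<in> carrier (quot M N)" for U
    proof -
      obtain x where x: "x \<in> carrier M" "U = N +>\<^bsub>M\<^esub> x" using U unfolding s(1) by blast
      then have "(N +>\<^bsub>M\<^esub> (\<ominus>\<^bsub>M\<^esub> x)) \<oplus>\<^bsub>quot M N\<^esub> U = \<zero>\<^bsub>quot M N\<^esub>"
        using s(3)[of "\<ominus>\<^bsub>M\<^esub> x" x] N0 by (simp add: s(2) M.l_neg)
      then show ?thesis using x unfolding s(1) by blast
    qed
  qed (auto simp: s M.a_ac)
  show ?thesis
    by (rule moduleI[OF R.is_cring ab]) 
      (auto simp: s smult_l_distr smult_r_distr smult_assoc1)
qed

lemma quot_proj_lin_map:
  assumes N: "submodule N R M"
  shows "(\<lambda>x. N +>\<^bsub>M\<^esub> x) \<in> lin_map R M (quot M N)"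
  unfolding lin_map_def using quot_simps[OF N] by auto

text \<open>
  Together with the converse \<open>finite_corankI\<close>, this lets later arguments work inside \<open>M\<close> instead
  of with cosets.
\<close>

lemma finite_corank_span:
  assumes "finite_corank R M N"
  obtains T where "finite T" "T \<subseteq> carrier M" "module_gen R M (N \<union> T) = carrier M"
proof -
  let ?p = "\<lambda>x. N +>\<^bsub>M\<^esub> x"
  have N: "submodule N R M" using assms unfolding finite_corank_def by blast
  note s = quot_simps[OF N]
  obtain S where S: "S \<subseteq> ?p ` carrier M" "finite S" "module_gen R (quot M N) S = carrier (quot M N)"
    using assms s(1) unfolding finite_corank_def fin_gen_module_def by auto
  then obtain T where T: "T \<subseteq> carrier M" "finite T" "S = ?p ` T"
    by (meson finite_subset_image)
  have Nc: "N \<subseteq> carrier M" using submoduleE(1)[OF N] .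
  have NT: "N \<union> T \<subseteq> carrier M" using Nc T by blast
  have "carrier M \<subseteq> module_gen R M (N \<union> T)"
  proof
    fix x assume x: "x \<in> carrier M"
    have "?p ` module_gen R M T = ?p ` carrier M"
      using image_module_gen[OF module_axioms quot_module[OF N] quot_proj_lin_map[OF N] T(1)] S(3) T(3) s(1)
      by simp
    then obtain t where t: "t \<in> module_gen R M T" "?p x = ?p t" using x by blast
    have tc: "t \<in> carrier M" using t module_gen_carrier[OF T(1)] by blast
    have "x \<ominus>\<^bsub>M\<^esub> t \<in> N" using coset_eq_iff[OF N x tc] t by blast
    then have "x \<ominus>\<^bsub>M\<^esub> t \<in> module_gen R M (N \<union> T)"
      by (intro module_gen_superset[THEN subsetD]) simp
    moreover have "t \<in> module_gen R M (N \<union> T)" using t module_gen_mono[of T "N \<union> T"] by blast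
    ultimately have "(x \<ominus>\<^bsub>M\<^esub> t) \<oplus>\<^bsub>M\<^esub> t \<in> module_gen R M (N \<union> T)"
      by (rule module_gen_closed(2)[OF NT])
    moreover have "(x \<ominus>\<^bsub>M\<^esub> t) \<oplus>\<^bsub>M\<^esub> t = x" using x tc by (simp add: M.minus_eq M.a_assoc M.l_neg)
    ultimately show "x \<in> module_gen R M (N \<union> T)" by simp
  qed
  then show thesis using that[OF T(2,1)] module_gen_carrier[OF NT] by blast
qed

lemma finite_corankI:
  assumes N: "submodule N R M" and T: "finite T" "T \<subseteq> carrier M" "carrier M \<subseteq> module_gen R M (N \<union> T)"
  shows "finite_corank R M N"
proof -
  let ?p = "\<lambda>x. N +>\<^bsub>M\<^esub> x"
  interpret Q: module R "quot M N" by (rule quot_module[OF N])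
  interpret N: abelian_subgroup N M using submodule_abelian_subgroup[OF N] .
  note s = quot_simps[OF N]
  have NT: "N \<union> T \<subseteq> carrier M" using submoduleE(1)[OF N] T(2) by blast
  have pT: "?p ` T \<subseteq> carrier (quot M N)" unfolding s(1) using T(2) by blast
  have "?p x = \<zero>\<^bsub>quot M N\<^esub>" if "x \<in> N" for x using N.a_rcos_const[OF that] s(2) by simp
  then have "?p ` (N \<union> T) \<subseteq> module_gen R (quot M N) (?p ` T)"
    using Q.module_gen_closed(1)[OF pT] module_gen_superset[of "?p ` T" R "quot M N"] by auto
  then have "module_gen R (quot M N) (?p ` (N \<union> T)) \<subseteq> module_gen R (quot M N) (?p ` T)"
    by (rule module_gen_least[OF Q.module_gen_submodule[OF pT]])
  moreover have "carrier (quot M N) \<subseteq> module_gen R (quot M N) (?p ` (N \<union> T))"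
    unfolding s(1) image_module_gen[OF module_axioms Q.module_axioms quot_proj_lin_map[OF N] NT, symmetric]
    using T(3) by blast
  ultimately have "module_gen R (quot M N) (?p ` T) = carrier (quot M N)"
    using Q.module_gen_carrier[OF pT] by blast
  then show ?thesis
    unfolding finite_corank_def fin_gen_module_def using N T(1) pT by blast
qed

text \<open>The module \<open>Q / (Q \<inter> N)\<close> embeds into the Noetherian module \<open>M / N\<close>.\<close>

lemma finite_corank_Int_subset:
  assumes noeth: "noetherian_ring R" and N: "finite_corank R M N" and Q: "submodule Q R M"
  obtains T where "finite T" "T \<subseteq> Q" "Q \<subseteq> module_gen R M ((Q \<inter> N) \<union> T)"
proof -
  have Nsm: "submodule N R M" using N unfolding finite_corank_def by blast
  obtain T where T: "finite T" "T \<subseteq> carrier M" "module_gen R M (N \<union> T) = carrier M"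
    using finite_corank_span[OF N] by blast
  show thesis
    using noetherian_relative_finite_generation[OF noeth T(1,2) Nsm Q] submoduleE(1)[OF Q] T(3) that by blast
qed

end

context nonunital_algebra
begin

lemma quot_mult:
  assumes I: "alg_ideal K A I" and x: "x \<in> carrier A" and y: "y \<in> carrier A"
  shows "(I +>\<^bsub>A\<^esub> x) \<otimes>\<^bsub>quot A I\<^esub> (I +>\<^bsub>A\<^esub> y) = I +>\<^bsub>A\<^esub> (x \<otimes>\<^bsub>A\<^esub> y)"
proof -
  have N: "submodule I K A" using I unfolding alg_ideal_def by blast
  interpret N: abelian_subgroup I A using submodule_abelian_subgroup[OF N] .
  have const: "I +>\<^bsub>A\<^esub> (x' \<otimes>\<^bsub>A\<^esub> y') = I +>\<^bsub>A\<^esub> (x \<otimes>\<^bsub>A\<^esub> y)"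
    if x': "x' \<in> I +>\<^bsub>A\<^esub> x" and y': "y' \<in> I +>\<^bsub>A\<^esub> y" for x' y'
  proof -
    obtain i j where ij: "i \<in> I" "j \<in> I" "x' = i \<oplus>\<^bsub>A\<^esub> x" "y' = j \<oplus>\<^bsub>A\<^esub> y"
      using x' y' unfolding a_r_coset_def' by auto
    have c: "i \<in> carrier A" "j \<in> carrier A" using ij I unfolding alg_ideal_iff by auto
    have m: "i \<otimes>\<^bsub>A\<^esub> y' \<in> I" "x \<otimes>\<^bsub>A\<^esub> j \<in> I" using ij c x y I unfolding alg_ideal_iff by auto
    have "x' \<otimes>\<^bsub>A\<^esub> y' = i \<otimes>\<^bsub>A\<^esub> y' \<oplus>\<^bsub>A\<^esub> (x \<otimes>\<^bsub>A\<^esub> j \<oplus>\<^bsub>A\<^esub> x \<otimes>\<^bsub>A\<^esub> y)"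
      using ij c x y by (simp add: mult_add_left mult_add_right mult_closed M.a_ac)
    then have "x' \<otimes>\<^bsub>A\<^esub> y' = (i \<otimes>\<^bsub>A\<^esub> y' \<oplus>\<^bsub>A\<^esub> x \<otimes>\<^bsub>A\<^esub> j) \<oplus>\<^bsub>A\<^esub> x \<otimes>\<^bsub>A\<^esub> y"
      using ij c x y by (simp add: mult_closed M.a_assoc)
    moreover have "i \<otimes>\<^bsub>A\<^esub> y' \<oplus>\<^bsub>A\<^esub> x \<otimes>\<^bsub>A\<^esub> j \<in> I" using m I unfolding alg_ideal_iff by blast
    ultimately have "x' \<otimes>\<^bsub>A\<^esub> y' \<in> I +>\<^bsub>A\<^esub> (x \<otimes>\<^bsub>A\<^esub> y)" unfolding a_r_coset_def' by blast
    then show ?thesis using N.a_repr_independence' mult_closed[OF x y] by simp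
  qed
  have ne: "I +>\<^bsub>A\<^esub> x \<noteq> {}" "I +>\<^bsub>A\<^esub> y \<noteq> {}"
    using N.a_rcos_self x y by auto
  have "(\<Union>x'\<in>I +>\<^bsub>A\<^esub> x. \<Union>y'\<in>I +>\<^bsub>A\<^esub> y. I +>\<^bsub>A\<^esub> (x' \<otimes>\<^bsub>A\<^esub> y')) = I +>\<^bsub>A\<^esub> (x \<otimes>\<^bsub>A\<^esub> y)"
    by (rule SUP_eq_const[OF ne(1) SUP_eq_const[OF ne(2) const]])
  then show ?thesis by (simp add: quot_def ring.defs FactRing_def rcoset_mult_def)
qed

lemma quot_proj_hom:
  assumes I: "alg_ideal K A I"
  shows "(\<lambda>x. I +>\<^bsub>A\<^esub> x) \<in> alg_hom K A (quot A I)"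
proof -
  have "submodule I K A" using I unfolding alg_ideal_def by blast
  from quot_proj_lin_map[OF this] show ?thesis
    unfolding alg_hom_def lin_map_def using quot_mult[OF I] by auto
qed

end

text \<open>
  The first isomorphism theorem. Kernels of surjections from free algebras, unlike quotients by
  given relators, can be compared for different generating sets.
\<close>

lemma fin_pres_alg_iff:
  assumes A: "nonunital_algebra K A"
  shows "fin_pres_alg K A \<longleftrightarrow> (\<exists>(m::nat) h. h \<in> alg_hom K (free_alg K {..<m}) A \<and>
    h ` carrier (free_alg K {..<m}) = carrier A \<and>
    fin_gen_ideal K (free_alg K {..<m}) (alg_ker (free_alg K {..<m}) A h))"
proof -
  interpret A: nonunital_algebra K A by fact
  show ?thesis
  proof
    assume "fin_pres_alg K A"
    then obtain m :: nat and R where R: "R \<subseteq> carrier (free_alg K {..<m})" "finite R"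
      and iso: "alg_isomorphic K (quot (free_alg K {..<m}) (ideal_gen K (free_alg K {..<m}) R)) A"
      unfolding fin_pres_alg_def by blast
    let ?F = "free_alg K {..<m}" and ?I = "ideal_gen K (free_alg K {..<m}) R"
    interpret F: nonunital_algebra K ?F by (rule A.R.free_alg_algebra)
    have I: "alg_ideal K ?F ?I" by (rule F.ideal_gen_alg_ideal[OF R(1)])
    then have N: "submodule ?I K ?F" unfolding alg_ideal_def by blast
    interpret N: abelian_subgroup ?I ?F using F.submodule_abelian_subgroup[OF N] .
    let ?p = "\<lambda>x. ?I +>\<^bsub>?F\<^esub> x"
    obtain g where g: "g \<in> alg_hom K (quot ?F ?I) A" "bij_betw g (carrier (quot ?F ?I)) (carrier A)"
      using iso unfolding alg_isomorphic_def by blast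
    have gp: "(\<lambda>x. g (?p x)) \<in> alg_hom K ?F A"
      by (rule alg_hom_compose[OF F.quot_proj_hom[OF I] g(1)])
    have surj: "(\<lambda>x. g (?p x)) ` carrier ?F = carrier A"
      using bij_betw_imp_surj_on[OF g(2)] F.quot_simps(1)[OF N] by (simp add: image_image)
    have g0: "g ?I = \<zero>\<^bsub>A\<^esub>"
      using lin_map_zero[OF F.quot_module[OF N] A.is_module alg_hom_lin_map[OF g(1)]]
        F.quot_simps(2)[OF N] by simp
    have Ic: "?I \<in> carrier (quot ?F ?I)"
      using F.quot_simps(2)[OF N] module.axioms(2)[OF F.quot_module[OF N]]
      by (metis abelian_group.axioms(1) abelian_monoid.zero_closed)
    have "g (?p x) = \<zero>\<^bsub>A\<^esub> \<longleftrightarrow> x \<in> ?I" if x: "x \<in> carrier ?F" for x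
    proof
      assume "g (?p x) = \<zero>\<^bsub>A\<^esub>"
      then have "?p x = ?I"
        using g0 bij_betw_imp_inj_on[OF g(2)] Ic x F.quot_simps(1)[OF N] by (metis image_eqI inj_onD)
      then show "x \<in> ?I" using N.a_rcos_self[OF x] by simp
    next
      assume "x \<in> ?I"
      then show "g (?p x) = \<zero>\<^bsub>A\<^esub>" using g0 N.a_rcos_const by simp
    qed
    then have "alg_ker ?F A (\<lambda>x. g (?p x)) = ?I" using I unfolding F.alg_ideal_iff by blast
    then have "fin_gen_ideal K ?F (alg_ker ?F A (\<lambda>x. g (?p x)))"
      unfolding fin_gen_ideal_def using R by blast
    then show "\<exists>(m::nat) h. h \<in> alg_hom K (free_alg K {..<m}) A \<and>
      h ` carrier (free_alg K {..<m}) = carrier A \<and>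
      fin_gen_ideal K (free_alg K {..<m}) (alg_ker (free_alg K {..<m}) A h)"
      using gp surj by blast
  next
    assume "\<exists>(m::nat) h. h \<in> alg_hom K (free_alg K {..<m}) A \<and>
      h ` carrier (free_alg K {..<m}) = carrier A \<and>
      fin_gen_ideal K (free_alg K {..<m}) (alg_ker (free_alg K {..<m}) A h)"
    then obtain m :: nat and h R where h: "h \<in> alg_hom K (free_alg K {..<m}) A"
      "h ` carrier (free_alg K {..<m}) = carrier A"
      and R: "R \<subseteq> carrier (free_alg K {..<m})" "finite R"
      and ker: "ideal_gen K (free_alg K {..<m}) R = alg_ker (free_alg K {..<m}) A h"
      unfolding fin_gen_ideal_def by blast
    let ?F = "free_alg K {..<m}" and ?I = "ideal_gen K (free_alg K {..<m}) R"
    interpret F: nonunital_algebra K ?F by (rule A.R.free_alg_algebra)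
    have I: "alg_ideal K ?F ?I" by (rule F.ideal_gen_alg_ideal[OF R(1)])
    then have N: "submodule ?I K ?F" unfolding alg_ideal_def by blast
    interpret N: abelian_subgroup ?I ?F using F.submodule_abelian_subgroup[OF N] .
    let ?p = "\<lambda>x. ?I +>\<^bsub>?F\<^esub> x"
    have heq: "h x = h y \<longleftrightarrow> ?p x = ?p y" if xy: "x \<in> carrier ?F" "y \<in> carrier ?F" for x y
    proof -
      have c: "x \<ominus>\<^bsub>?F\<^esub> y \<in> carrier ?F" using xy by simp
      have hc: "h x \<in> carrier A" "h y \<in> carrier A" using alg_homE(1)[OF h(1)] xy by auto
      have "?p x = ?p y \<longleftrightarrow> h (x \<ominus>\<^bsub>?F\<^esub> y) = \<zero>\<^bsub>A\<^esub>"
        unfolding F.coset_eq_iff[OF N xy] unfolding ker using c by simp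
      also have "\<dots> \<longleftrightarrow> h x \<ominus>\<^bsub>A\<^esub> h y = \<zero>\<^bsub>A\<^esub>"
        using lin_map_minus[OF F.is_module A.is_module alg_hom_lin_map[OF h(1)] xy] by simp
      also have "\<dots> \<longleftrightarrow> h x = h y" using hc A.minus_eq_zero_iff by simp
      finally show ?thesis by blast
    qed
    define g where "g U = h (SOME x. x \<in> carrier ?F \<and> ?p x = U)" for U
    have gp: "g (?p x) = h x" if x: "x \<in> carrier ?F" for x
    proof -
      have "(SOME y. y \<in> carrier ?F \<and> ?p y = ?p x) \<in> carrier ?F \<and>
          ?p (SOME y. y \<in> carrier ?F \<and> ?p y = ?p x) = ?p x"
        by (rule someI[of _ x]) (use x in simp)
      then show ?thesis unfolding g_def using heq x by blast
    qed
    note s = F.quot_simps[OF N]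
    have "g \<in> alg_hom K (quot ?F ?I) A"
      unfolding alg_hom_def s(1)
      by (auto simp: s(3,4) F.quot_mult[OF I] gp alg_homE[OF h(1)] F.mult_closed)
    moreover have "bij_betw g (carrier (quot ?F ?I)) (carrier A)"
    proof (rule bij_betw_imageI)
      show "inj_on g (carrier (quot ?F ?I))"
        unfolding s(1) by (rule inj_onI) (auto simp: gp heq)
      show "g ` carrier (quot ?F ?I) = carrier A"
        unfolding s(1) image_image using gp h(2) by (metis (no_types, lifting) image_cong)
    qed
    ultimately have "alg_isomorphic K (quot ?F ?I) A" unfolding alg_isomorphic_def by blast
    then show "fin_pres_alg K A" unfolding fin_pres_alg_def using R by blast
  qed
qed

subsection \<open>Working with presentations\<close>

context nonunital_algebra
begin

text \<open>
  The letters correspond to prescribed generators, so that relators can be written in terms of the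
  latter.
\<close>

lemma free_cover:
  assumes "finite S" "S \<subseteq> carrier A" "subalg_gen K A S = carrier A"
  obtains m :: nat and h l where "h \<in> alg_hom K (free_alg K {..<m}) A"
    "h ` carrier (free_alg K {..<m}) = carrier A"
    "l ` S = (\<lambda>i. free_word K [i]) ` {..<m}" "\<And>s. s \<in> S \<Longrightarrow> h (l s) = s"
proof -
  obtain e where e: "bij_betw e {..<card S} S"
    using ex_bij_betw_nat_finite[OF assms(1)] by (auto simp: atLeast0LessThan)
  let ?V = "{..<card S}" and ?l = "\<lambda>s. free_word K [inv_into {..<card S} e s]"
  have eV: "e ` ?V = S" using bij_betw_imp_surj_on[OF e] .
  then have "e \<in> ?V \<rightarrow> carrier A" using assms(2) by blast
  then obtain h where h: "h \<in> alg_hom K (free_alg K ?V) A" "\<And>x. x \<in> ?V \<Longrightarrow> h (free_word K [x]) = e x"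
    by (rule free_alg_hom_exists) blast
  let ?F = "free_alg K ?V"
  interpret F: nonunital_algebra K ?F by (rule R.free_alg_algebra)
  have "h ` carrier ?F = subalg_gen K A (h ` (\<lambda>i. free_word K [i]) ` ?V)"
    using image_subalg_gen[OF F.is_nonunital_algebra is_nonunital_algebra h(1), of "(\<lambda>i. free_word K [i]) ` ?V"]
      R.free_letter_closed[of _ ?V] R.free_alg_generated[of ?V] by auto
  also have "h ` (\<lambda>i. free_word K [i]) ` ?V = S" using h(2) eV by (auto simp: image_image)
  finally have surj: "h ` carrier ?F = carrier A" using assms(3) by simp
  have "?l ` S = (\<lambda>i. free_word K [i]) ` (inv_into ?V e ` S)" by (simp add: image_image)
  also have "inv_into ?V e ` S = ?V" using bij_betw_inv_into[OF e] bij_betw_imp_surj_on by blast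
  finally have l: "?l ` S = (\<lambda>i. free_word K [i]) ` ?V" .
  have "h (?l s) = s" if "s \<in> S" for s
    using h(2)[of "inv_into ?V e s"] that eV by (metis f_inv_into_f inv_into_into)
  then show thesis using that[OF h(1) surj l] by blast
qed

lemma fin_pres_imp_fin_gen:
  assumes "fin_pres_alg K A"
  shows "fin_gen_alg K A"
proof -
  obtain m :: nat and h where h: "h \<in> alg_hom K (free_alg K {..<m}) A"
    "h ` carrier (free_alg K {..<m}) = carrier A"
    using assms unfolding fin_pres_alg_iff[OF is_nonunital_algebra] by blast
  have "fin_gen_alg K (free_alg K {..<m})"
    unfolding fin_gen_alg_def using R.free_alg_generated[of "{..<m}"] R.free_letter_closed[of _ "{..<m}"]
    by (intro exI[of _ "(\<lambda>i. free_word K [i]) ` {..<m}"]) auto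
  then show ?thesis
    by (rule fin_gen_alg_image[OF R.free_alg_algebra is_nonunital_algebra h])
qed

lemma ideal_restrict:
  assumes H: "subalg K A H" and I: "alg_ideal K A I"
  shows "alg_ideal K (A\<lparr>carrier := H\<rparr>) (I \<inter> H)"
proof -
  interpret H: nonunital_algebra K "A\<lparr>carrier := H\<rparr>" using subalg_algebra[OF H] .
  have "H \<subseteq> carrier A" using H unfolding subalg_iff by blast
  then show ?thesis
    using H[unfolded subalg_iff] I[unfolded alg_ideal_iff] unfolding H.alg_ideal_iff by auto
qed

end

lemma alg_ideal_image:
  assumes "nonunital_algebra K A" "nonunital_algebra K B" "h \<in> alg_hom K A B"
    "h ` carrier A = carrier B" "alg_ideal K A J"
  shows "alg_ideal K B (h ` J)"
proof -
  interpret A: nonunital_algebra K A by fact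
  interpret B: nonunital_algebra K B by fact
  have J: "J \<subseteq> carrier A" using assms(5) unfolding A.alg_ideal_iff by blast
  have "b \<otimes>\<^bsub>B\<^esub> h x \<in> h ` J \<and> h x \<otimes>\<^bsub>B\<^esub> b \<in> h ` J" if x: "x \<in> J" and b: "b \<in> carrier B" for x b
  proof -
    obtain a where a: "a \<in> carrier A" "b = h a" using b assms(4) by blast
    have "x \<in> carrier A" using x J by blast
    then have "b \<otimes>\<^bsub>B\<^esub> h x = h (a \<otimes>\<^bsub>A\<^esub> x)" "h x \<otimes>\<^bsub>B\<^esub> b = h (x \<otimes>\<^bsub>A\<^esub> a)"
      using a alg_homE(3)[OF assms(3)] by auto
    moreover have "a \<otimes>\<^bsub>A\<^esub> x \<in> J" "x \<otimes>\<^bsub>A\<^esub> a \<in> J"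
      using assms(5) a x unfolding alg_ideal_def by auto
    ultimately show ?thesis by auto
  qed
  moreover have "submodule (h ` J) K B"
    using submodule_image[OF A.is_module B.is_module alg_hom_lin_map[OF assms(3)]] assms(5)
    unfolding alg_ideal_def by blast
  ultimately show ?thesis unfolding alg_ideal_def by blast
qed

text \<open>
  Finite presentability does not depend on the chosen generators: lift the given presentation
  along \<open>h\<close>; besides the images of its relators, one only has to rewrite each generator of \<open>B\<close> in
  terms of the lifted ones.
\<close>

lemma fin_pres_kernel_fin_gen:
  assumes "nonunital_algebra K A" "nonunital_algebra K B" "fin_pres_alg K A" "fin_gen_alg K B"
    "h \<in> alg_hom K B A" "h ` carrier B = carrier A"
  shows "fin_gen_ideal K B (alg_ker B A h)"
proof -
  interpret A: nonunital_algebra K A by fact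
  interpret B: nonunital_algebra K B by fact
  obtain m :: nat and p R where p: "p \<in> alg_hom K (free_alg K {..<m}) A"
      "p ` carrier (free_alg K {..<m}) = carrier A"
    and R: "R \<subseteq> carrier (free_alg K {..<m})" "finite R"
      "ideal_gen K (free_alg K {..<m}) R = alg_ker (free_alg K {..<m}) A p"
    using assms(3) unfolding fin_pres_alg_iff[OF assms(1)] fin_gen_ideal_def by blast
  let ?F = "free_alg K {..<m}"
  interpret F: nonunital_algebra K ?F by (rule A.R.free_alg_algebra)
  let ?L = "(\<lambda>i. free_word K [i]) ` {..<m}"
  have L: "?L \<subseteq> carrier ?F" using A.R.free_letter_closed[of _ "{..<m}"] by auto
  have "\<exists>b\<in>carrier B. h b = p (free_word K [i])" if "i \<in> {..<m}" for i
    using that alg_homE(1)[OF p(1) A.R.free_letter_closed] assms(6) by (metis imageE)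
  then obtain b where b: "\<And>i. i \<in> {..<m} \<Longrightarrow> b i \<in> carrier B \<and> h (b i) = p (free_word K [i])" by metis
  then have "b \<in> {..<m} \<rightarrow> carrier B" by blast
  then obtain f where f: "f \<in> alg_hom K ?F B" "\<And>x. x \<in> {..<m} \<Longrightarrow> f (free_word K [x]) = b x"
    by (rule B.free_alg_hom_exists) blast
  have hf: "h (f x) = p x" if x: "x \<in> carrier ?F" for x
  proof -
    have "subalg K ?F {x \<in> carrier ?F. h (f x) = p x}"
      unfolding F.subalg_iff
      using alg_homE[OF alg_hom_compose[OF f(1) assms(5)]] alg_homE[OF p(1)]
        alg_hom_zero[OF F.is_nonunital_algebra A.is_nonunital_algebra p(1)]
        alg_hom_zero[OF F.is_nonunital_algebra A.is_nonunital_algebra alg_hom_compose[OF f(1) assms(5)]]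
      by (simp add: F.mult_closed)
    moreover have "?L \<subseteq> {x \<in> carrier ?F. h (f x) = p x}" using L f(2) b by auto
    ultimately show ?thesis
      using subalg_gen_least x unfolding A.R.free_alg_generated[symmetric] by blast
  qed
  obtain S where S: "S \<subseteq> carrier B" "finite S" "subalg_gen K B S = carrier B"
    using assms(4) unfolding fin_gen_alg_def by blast
  have "\<exists>w\<in>carrier ?F. p w = h s" if "s \<in> S" for s
  proof -
    have "h s \<in> p ` carrier ?F" unfolding p(2) using that S(1) alg_homE(1)[OF assms(5)] by blast
    then show ?thesis by auto
  qed
  then obtain w where w: "\<And>s. s \<in> S \<Longrightarrow> w s \<in> carrier ?F \<and> p (w s) = h s" by metis
  define Z where "Z = f ` R \<union> (\<lambda>s. s \<ominus>\<^bsub>B\<^esub> f (w s)) ` S"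
  have fwc: "f (w s) \<in> carrier B" if "s \<in> S" for s using that w alg_homE(1)[OF f(1)] by blast
  have Zker: "Z \<subseteq> alg_ker B A h"
  proof
    fix z assume "z \<in> Z"
    then consider (R) r where "r \<in> R" "z = f r" | (S) s where "s \<in> S" "z = s \<ominus>\<^bsub>B\<^esub> f (w s)"
      unfolding Z_def by blast
    then show "z \<in> alg_ker B A h"
    proof cases
      case R
      then have "r \<in> alg_ker ?F A p"
        unfolding \<open>ideal_gen K ?F R = _\<close>[symmetric] by (intro ideal_gen_superset[THEN subsetD])
      then show ?thesis using R(2) hf alg_homE(1)[OF f(1)] by auto
    next
      case S
      have "h s = h (f (w s))" using hf[of "w s"] w[OF S(1)] by simp
      then show ?thesis
        using fibre_difference_in_ker[OF B.is_nonunital_algebra A.is_nonunital_algebra assms(5) _ fwc[OF S(1)]]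
          S \<open>S \<subseteq> carrier B\<close> by blast
    qed
  qed
  have Zc: "Z \<subseteq> carrier B" using Zker by blast
  let ?I = "ideal_gen K B Z"
  have I: "alg_ideal K B ?I" by (rule B.ideal_gen_alg_ideal[OF Zc])
  have kerI: "alg_ideal K B (alg_ker B A h)"
    by (rule alg_ker_ideal[OF B.is_nonunital_algebra A.is_nonunital_algebra assms(5)])
  have Ism: "submodule ?I K B" using I unfolding alg_ideal_def by blast
  let ?fF = "f ` carrier ?F"
  have fF: "subalg K B ?fF"
    by (rule subalg_image[OF F.is_nonunital_algebra B.is_nonunital_algebra f(1) F.subalg_carrier])
  have fFsm: "submodule ?fF K B" using fF unfolding subalg_def by blast
  have sumI: "subalg K B {x \<oplus>\<^bsub>B\<^esub> y | x y. x \<in> ?fF \<and> y \<in> ?I}" (is "subalg K B ?W")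
    unfolding subalg_def
  proof (intro conjI ballI)
    show sm: "submodule ?W K B" by (rule B.submodule_add_set[OF fFsm Ism])
    fix u v assume "u \<in> ?W" "v \<in> ?W"
    then obtain x y x' y' where xy: "x \<in> ?fF" "y \<in> ?I" "x' \<in> ?fF" "y' \<in> ?I" "u = x \<oplus>\<^bsub>B\<^esub> y" "v = x' \<oplus>\<^bsub>B\<^esub> y'"
      by blast
    have c: "x \<in> carrier B" "y \<in> carrier B" "x' \<in> carrier B" "y' \<in> carrier B"
      using xy fF[unfolded B.subalg_iff] I[unfolded B.alg_ideal_iff] by auto
    have "u \<otimes>\<^bsub>B\<^esub> v = x \<otimes>\<^bsub>B\<^esub> x' \<oplus>\<^bsub>B\<^esub> (x \<otimes>\<^bsub>B\<^esub> y' \<oplus>\<^bsub>B\<^esub> y \<otimes>\<^bsub>B\<^esub> v)"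
      using c xy by (simp add: B.mult_add_left B.mult_add_right B.mult_closed B.M.a_ac)
    moreover have "x \<otimes>\<^bsub>B\<^esub> y' \<oplus>\<^bsub>B\<^esub> y \<otimes>\<^bsub>B\<^esub> v \<in> ?I"
      using I[unfolded B.alg_ideal_iff] xy c by auto
    moreover have "x \<otimes>\<^bsub>B\<^esub> x' \<in> ?fF" using fF xy unfolding subalg_def by blast
    ultimately show "u \<otimes>\<^bsub>B\<^esub> v \<in> ?W" by blast
  qed
  have "S \<subseteq> ?W"
  proof
    fix s assume s: "s \<in> S"
    have "s \<ominus>\<^bsub>B\<^esub> f (w s) \<in> ?I" by (rule ideal_gen_superset[THEN subsetD]) (use s in \<open>auto simp: Z_def\<close>)
    moreover have "s = f (w s) \<oplus>\<^bsub>B\<^esub> (s \<ominus>\<^bsub>B\<^esub> f (w s))"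
      using B.minus_add_cancel[of s "f (w s)"] s S(1) fwc[OF s] B.M.a_comm by auto
    ultimately show "s \<in> ?W" using w[OF s] by blast
  qed
  then have W: "carrier B \<subseteq> ?W" using subalg_gen_least[OF sumI] S(3) by blast
  have "alg_ker B A h \<subseteq> ?I"
  proof
    fix x assume x: "x \<in> alg_ker B A h"
    then obtain y i where yi: "y \<in> carrier ?F" "i \<in> ?I" "x = f y \<oplus>\<^bsub>B\<^esub> i" using W by blast
    have i: "i \<in> carrier B" "h i = \<zero>\<^bsub>A\<^esub>" using ideal_gen_least[OF kerI Zker] yi(2) by auto
    have fy: "f y \<in> carrier B" using alg_homE(1)[OF f(1)] yi by blast
    have "h x = h (f y) \<oplus>\<^bsub>A\<^esub> \<zero>\<^bsub>A\<^esub>" using alg_homE(2)[OF assms(5) fy i(1)] yi i by simp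
    then have "p y = \<zero>\<^bsub>A\<^esub>" using x hf[OF yi(1)] alg_homE(1)[OF assms(5) fy] by simp
    then have "y \<in> ideal_gen K ?F R" using yi R(3) by blast
    moreover have "f ` ideal_gen K ?F R \<subseteq> ?I"
      by (rule image_ideal_gen_subset[OF F.is_nonunital_algebra B.is_nonunital_algebra f(1) R(1) I])
        (rule subset_trans[OF _ ideal_gen_superset], simp add: Z_def)
    ultimately have "f y \<in> ?I" by blast
    then show "x \<in> ?I" using yi I unfolding B.alg_ideal_iff by blast
  qed
  then have "?I = alg_ker B A h" using ideal_gen_least[OF kerI Zker] by blast
  moreover have "finite Z" using R S unfolding Z_def by blast
  ultimately show ?thesis unfolding fin_gen_ideal_def using Zc by blast
qed

text \<open>
  Lifts of generators of the kernel are added to the relators of \<open>A\<close>.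
\<close>

lemma fin_pres_quotient:
  assumes "nonunital_algebra K A" "nonunital_algebra K B" "fin_pres_alg K A"
    "h \<in> alg_hom K A B" "h ` carrier A = carrier B" "fin_gen_ideal K A (alg_ker A B h)"
  shows "fin_pres_alg K B"
proof -
  interpret A: nonunital_algebra K A by fact
  interpret B: nonunital_algebra K B by fact
  obtain m :: nat and p R where p: "p \<in> alg_hom K (free_alg K {..<m}) A"
      "p ` carrier (free_alg K {..<m}) = carrier A"
    and R: "R \<subseteq> carrier (free_alg K {..<m})" "finite R"
      "ideal_gen K (free_alg K {..<m}) R = alg_ker (free_alg K {..<m}) A p"
    using assms(3) unfolding fin_pres_alg_iff[OF assms(1)] fin_gen_ideal_def by blast
  let ?F = "free_alg K {..<m}"
  interpret F: nonunital_algebra K ?F by (rule A.R.free_alg_algebra)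
  obtain Z where Z: "Z \<subseteq> carrier A" "finite Z" "ideal_gen K A Z = alg_ker A B h"
    using assms(6) unfolding fin_gen_ideal_def by blast
  have "Z \<subseteq> p ` carrier ?F" using Z(1) p(2) by simp
  then obtain Z' where Z': "Z' \<subseteq> carrier ?F" "finite Z'" "Z = p ` Z'"
    using Z(2) by (meson finite_subset_image)
  have hp: "(\<lambda>x. h (p x)) \<in> alg_hom K ?F B" by (rule alg_hom_compose[OF p(1) assms(4)])
  let ?N = "alg_ker ?F B (\<lambda>x. h (p x))" and ?I = "ideal_gen K ?F (R \<union> Z')"
  have N: "alg_ideal K ?F ?N" by (rule alg_ker_ideal[OF F.is_nonunital_algebra B.is_nonunital_algebra hp])
  have RZ: "R \<union> Z' \<subseteq> carrier ?F" using R Z' by blast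
  have I: "alg_ideal K ?F ?I" by (rule F.ideal_gen_alg_ideal[OF RZ])
  have Ism: "submodule ?I K ?F" using I unfolding alg_ideal_def by blast
  have "R \<subseteq> alg_ker ?F A p" using R(3) ideal_gen_superset[of R K ?F] by simp
  moreover have "Z \<subseteq> alg_ker A B h" using Z(3) ideal_gen_superset[of Z K A] by simp
  ultimately have "R \<union> Z' \<subseteq> ?N"
    using Z' alg_hom_zero[OF A.is_nonunital_algebra B.is_nonunital_algebra assms(4)] by auto
  then have IN: "?I \<subseteq> ?N" by (rule ideal_gen_least[OF N])
  have "?N \<subseteq> ?I"
  proof
    fix x assume x: "x \<in> ?N"
    have "Z \<subseteq> p ` ?I" using Z'(3) ideal_gen_superset[of "R \<union> Z'" K ?F] by blast
    then have "alg_ker A B h \<subseteq> p ` ?I"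
      using ideal_gen_least[OF alg_ideal_image[OF F.is_nonunital_algebra A.is_nonunital_algebra p I]] Z(3)
      by metis
    then obtain y where y: "y \<in> ?I" "p x = p y" using x alg_homE(1)[OF p(1)] by blast
    have yc: "y \<in> carrier ?F" using y I unfolding F.alg_ideal_iff by blast
    have "x \<ominus>\<^bsub>?F\<^esub> y \<in> ideal_gen K ?F R"
      unfolding R(3) using fibre_difference_in_ker[OF F.is_nonunital_algebra A.is_nonunital_algebra p(1) _ yc, of x] x y(2)
      by blast
    then have "x \<ominus>\<^bsub>?F\<^esub> y \<in> ?I" using ideal_gen_mono[of R "R \<union> Z'" K ?F] by blast
    then show "x \<in> ?I" using F.submodule_minus_cancel[OF Ism _ y(1)] x by blast
  qed
  then have "?I = ?N" using IN by blast
  then have "fin_gen_ideal K ?F ?N" unfolding fin_gen_ideal_def using RZ R(2) Z'(2) by blast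
  moreover have "(\<lambda>x. h (p x)) ` carrier ?F = carrier B" using p(2) assms(5) by (simp add: image_image[symmetric])
  ultimately show ?thesis unfolding fin_pres_alg_iff[OF assms(2)] using hp by blast
qed

section \<open>Passing from a subalgebra of finite corank to the whole algebra\<close>

lemma subalg_gen_with_span:
  assumes B: "nonunital_algebra K B" and ST: "S \<union> T \<subseteq> carrier B"
    and span: "module_gen K B (subalg_gen K B S \<union> T) = carrier B"
  shows "subalg_gen K B (S \<union> T) = carrier B"
proof -
  interpret B: nonunital_algebra K B by fact
  let ?G = "subalg_gen K B (S \<union> T)"
  have G: "subalg K B ?G" by (rule B.subalg_gen_subalg[OF ST])
  have "subalg_gen K B S \<union> T \<subseteq> ?G"
    using subalg_gen_mono[of S "S \<union> T" K B] subalg_gen_superset[of "S \<union> T" K B] by blast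
  then have "carrier B \<subseteq> ?G"
    using module_gen_least[OF subalg_submodule[OF G]] span by blast
  then show ?thesis using B.subalg_subset[OF G] by blast
qed

text \<open>
  Adjoin to a presentation of \<open>C\<close> generators for a finite set \<open>T\<close> that spans \<open>B\<close> together with
  \<open>C\<close>. Rewriting the finitely many products that involve an element of \<open>T\<close> confines everything to
  the subalgebra \<open>H\<close> over \<open>C\<close> plus the span of \<open>T\<close>; by Noetherianity the linear dependencies of
  \<open>T\<close> modulo \<open>C\<close> are finitely generated and move the kernel into \<open>H\<close>, where the relators of \<open>C\<close>
  take over.
\<close>

theorem fin_pres_alg_of_finite_corank:
  assumes noeth: "noetherian_ring K" and B: "nonunital_algebra K B" and C: "subalg K B C"
    and corank: "finite_corank K B C" and fp: "fin_pres_alg K (B\<lparr>carrier := C\<rparr>)"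
  shows "fin_pres_alg K B"
proof -
  interpret B: nonunital_algebra K B by fact
  obtain T where T: "finite T" "T \<subseteq> carrier B" "module_gen K B (C \<union> T) = carrier B"
    using B.finite_corank_span[OF corank] by blast
  interpret C: nonunital_algebra K "B\<lparr>carrier := C\<rparr>" by (rule B.subalg_algebra[OF C])
  have Cc: "C \<subseteq> carrier B" and Csm: "submodule C K B"
    using B.subalg_subset[OF C] subalg_submodule[OF C] .
  obtain S where S: "S \<subseteq> C" "finite S" "subalg_gen K B S = C"
    using C.fin_pres_imp_fin_gen[OF fp] B.fin_gen_restrict_iff[OF C] by blast
  have ST: "S \<union> T \<subseteq> carrier B" using S(1) Cc T(2) by blast
  have gen: "subalg_gen K B (S \<union> T) = carrier B"
    by (rule subalg_gen_with_span[OF B ST]) (simp add: S(3) T(3))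
  have "finite (S \<union> T)" using S T by blast
  then obtain m :: nat and p l where p: "p \<in> alg_hom K (free_alg K {..<m}) B"
    "p ` carrier (free_alg K {..<m}) = carrier B"
    and l: "l ` (S \<union> T) = (\<lambda>i. free_word K [i]) ` {..<m}" "\<And>s. s \<in> S \<union> T \<Longrightarrow> p (l s) = s"
    by (rule B.free_cover[OF _ ST gen]) blast
  let ?F = "free_alg K {..<m}"
  interpret F: nonunital_algebra K ?F by (rule B.R.free_alg_algebra)
  note hom0 = alg_hom_zero[OF F.is_nonunital_algebra B.is_nonunital_algebra p(1)]
  note pc = alg_homE(1)[OF p(1)] and plin = alg_hom_lin_map[OF p(1)]
  define X Y where "X = l ` S" and "Y = l ` T"
  have fin: "finite X" "finite Y" using S(2) T(1) X_def Y_def by auto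
  have XYL: "X \<union> Y = (\<lambda>i. free_word K [i]) ` {..<m}" using l(1) unfolding X_def Y_def by (simp add: image_Un)
  then have XY: "X \<union> Y \<subseteq> carrier ?F" using B.R.free_letter_closed[of _ "{..<m}"] by auto
  have XYgen: "subalg_gen K ?F (X \<union> Y) = carrier ?F"
    unfolding XYL by (rule B.R.free_alg_generated)
  have X: "X \<subseteq> carrier ?F" and Y: "Y \<subseteq> carrier ?F" using XY by auto
  have pX: "p ` X = S" and pY: "p ` Y = T" using l(2) unfolding X_def Y_def by (force simp: image_image)+
  let ?H = "subalg_gen K ?F X"
  have H: "subalg K ?F ?H" by (rule F.subalg_gen_subalg[OF X])
  have Hc: "?H \<subseteq> carrier ?F" and Hsm: "submodule ?H K ?F"
    using F.subalg_subset[OF H] subalg_submodule[OF H] .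
  have XH: "X \<subseteq> ?H" by (rule subalg_gen_superset)
  have pH: "p ` ?H = C"
    using image_subalg_gen[OF F.is_nonunital_algebra B p(1) X] pX S(3) by simp
  let ?U = "module_gen K ?F (?H \<union> Y)"
  have HY: "?H \<union> Y \<subseteq> carrier ?F" using Hc Y by blast
  have Usm: "submodule ?U K ?F" by (rule F.module_gen_submodule[OF HY])
  have Uc: "?U \<subseteq> carrier ?F" by (rule F.module_gen_carrier[OF HY])
  have pU: "p ` ?U = carrier B"
    using image_module_gen[OF F.is_module B.is_module plin HY] pH pY T(3) by (simp add: image_Un)

  \<comment> \<open>relators for the products with an element over \<open>T\<close>: each is rewritten inside \<open>H\<close> plus the span of \<open>Y\<close>\<close>
  define P where "P = (\<lambda>(y, z). y \<otimes>\<^bsub>?F\<^esub> z) ` (Y \<times> (X \<union> Y)) \<union> (\<lambda>(x, y). x \<otimes>\<^bsub>?F\<^esub> y) ` (X \<times> Y)"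
  have Pfin: "finite P" unfolding P_def using fin by blast
  have Pc: "P \<subseteq> carrier ?F" unfolding P_def using X Y by (auto intro!: F.mult_closed)
  have "\<exists>u\<in>?U. p u = p q" if "q \<in> P" for q
  proof -
    have "p q \<in> p ` ?U" unfolding pU using pc that Pc by blast
    then show ?thesis by auto
  qed
  then obtain u where u: "\<And>q. q \<in> P \<Longrightarrow> u q \<in> ?U \<and> p (u q) = p q" by metis
  define Z1 where "Z1 = (\<lambda>q. q \<ominus>\<^bsub>?F\<^esub> u q) ` P"
  have Z1ker: "Z1 \<subseteq> alg_ker ?F B p"
  proof
    fix z assume "z \<in> Z1"
    then obtain q where q: "q \<in> P" "z = q \<ominus>\<^bsub>?F\<^esub> u q" unfolding Z1_def by blast
    have "u q \<in> carrier ?F" "q \<in> carrier ?F" "p q = p (u q)" using u[OF q(1)] Uc Pc q(1) by auto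
    then show "z \<in> alg_ker ?F B p"
      using fibre_difference_in_ker[OF F.is_nonunital_algebra B p(1), of q "u q"] q(2) by blast
  qed
  then have Z1c: "Z1 \<subseteq> carrier ?F" by blast
  let ?I1 = "ideal_gen K ?F Z1"
  have I1: "alg_ideal K ?F ?I1" by (rule F.ideal_gen_alg_ideal[OF Z1c])
  have I1c: "?I1 \<subseteq> carrier ?F" and I1sm: "submodule ?I1 K ?F"
    using F.alg_ideal_subset[OF I1] alg_ideal_submodule[OF I1] .
  have kerI: "alg_ideal K ?F (alg_ker ?F B p)"
    by (rule alg_ker_ideal[OF F.is_nonunital_algebra B p(1)])
  have I1ker: "?I1 \<subseteq> alg_ker ?F B p" by (rule ideal_gen_least[OF kerI Z1ker])

  let ?W = "module_gen K ?F (?H \<union> Y \<union> ?I1)"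
  have HYI: "?H \<union> Y \<union> ?I1 \<subseteq> carrier ?F" using Hc Y I1c by blast
  have Wsm: "submodule ?W K ?F" by (rule F.module_gen_submodule[OF HYI])
  have sup: "?H \<union> Y \<union> ?I1 \<subseteq> ?W" by (rule module_gen_superset)
  have UW: "?U \<subseteq> ?W" by (rule module_gen_mono) blast
  have PW: "q \<in> ?W" if q: "q \<in> P" for q
  proof (rule F.submodule_minus_cancel[OF Wsm])
    show "q \<in> carrier ?F" using q Pc by blast
    show "u q \<in> ?W" using u[OF q] UW by blast
    have "q \<ominus>\<^bsub>?F\<^esub> u q \<in> ?I1" by (rule ideal_gen_superset[THEN subsetD]) (use q Z1_def in blast)
    then show "q \<ominus>\<^bsub>?F\<^esub> u q \<in> ?W" using sup by blast
  qed
  have HW: "h \<otimes>\<^bsub>?F\<^esub> y \<in> ?W" if h: "h \<in> ?H" and y: "y \<in> Y" for h y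
  proof -
    let ?Q = "{h \<in> ?H. \<forall>y\<in>Y. h \<otimes>\<^bsub>?F\<^esub> y \<in> ?W}"
    have "subalg K ?F ?Q"
      unfolding F.subalg_iff
    proof (intro conjI ballI)
      note Hcl = H[unfolded F.subalg_iff] and Wcl = Wsm[unfolded F.submodule_iff]
      show "?Q \<subseteq> carrier ?F" using Hc by blast
      show "\<zero>\<^bsub>?F\<^esub> \<in> ?Q" using Hcl Wcl Y F.mult_zero_left by auto
      show "a \<oplus>\<^bsub>?F\<^esub> b \<in> ?Q" if "a \<in> ?Q" "b \<in> ?Q" for a b
        using that Hcl Wcl Y by (auto simp: F.mult_add_left subset_iff)
      show "k \<odot>\<^bsub>?F\<^esub> a \<in> ?Q" if "k \<in> carrier K" "a \<in> ?Q" for k a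
        using that Hcl Wcl Y by (auto simp: F.mult_smult_left subset_iff)
      show "a \<otimes>\<^bsub>?F\<^esub> b \<in> ?Q" if a: "a \<in> ?Q" and b: "b \<in> ?Q" for a b
      proof -
        have ac: "a \<in> carrier ?F" "b \<in> carrier ?F" using a b Hc by auto
        have "a \<otimes>\<^bsub>?F\<^esub> (b \<otimes>\<^bsub>?F\<^esub> y) \<in> ?W" if y: "y \<in> Y" for y
        proof (rule F.module_gen_mult_left[OF HYI ac(1) Wsm])
          show "b \<otimes>\<^bsub>?F\<^esub> y \<in> ?W" using b y by blast
          fix s assume "s \<in> ?H \<union> Y \<union> ?I1"
          then consider "s \<in> ?H" | "s \<in> Y" | "s \<in> ?I1" by blast
          then show "a \<otimes>\<^bsub>?F\<^esub> s \<in> ?W"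
          proof cases
            case 1
            then have "a \<otimes>\<^bsub>?F\<^esub> s \<in> ?H" using a Hcl by blast
            then show ?thesis using sup by blast
          next
            case 2
            then show ?thesis using a by blast
          next
            case 3
            then have "a \<otimes>\<^bsub>?F\<^esub> s \<in> ?I1" using ac I1 unfolding alg_ideal_def by blast
            then show ?thesis using sup by blast
          qed
        qed
        moreover have "a \<otimes>\<^bsub>?F\<^esub> b \<in> ?H" using a b Hcl by blast
        ultimately show ?thesis using ac Y by (auto simp: F.mult_assoc subset_iff)
      qed
    qed
    moreover have "X \<subseteq> ?Q"
    proof
      fix x assume x: "x \<in> X"
      have "x \<otimes>\<^bsub>?F\<^esub> y \<in> ?W" if y: "y \<in> Y" for y
        by (rule PW) (use x y P_def in blast)
      then show "x \<in> ?Q" using x XH by blast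
    qed
    ultimately have "?H \<subseteq> ?Q" by (rule subalg_gen_least)
    then show ?thesis using h y by blast
  qed
  have W: "?W = carrier ?F"
  proof (rule F.right_closed_submodule_eq_carrier[OF XY XYgen Wsm])
    show "X \<union> Y \<subseteq> ?W" using sup XH by blast
    fix w s assume w: "w \<in> ?W" and s: "s \<in> X \<union> Y"
    have sc: "s \<in> carrier ?F" using s XY by blast
    show "w \<otimes>\<^bsub>?F\<^esub> s \<in> ?W"
    proof (rule F.module_gen_mult_right[OF HYI sc Wsm _ w])
      fix t assume "t \<in> ?H \<union> Y \<union> ?I1"
      then consider (a) "t \<in> ?H" "s \<in> X" | (b) "t \<in> ?H" "s \<in> Y" | (c) "t \<in> Y" | (d) "t \<in> ?I1"
        using s by blast
      then show "t \<otimes>\<^bsub>?F\<^esub> s \<in> ?W"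
      proof cases
        case a
        then have "t \<otimes>\<^bsub>?F\<^esub> s \<in> ?H" using XH H unfolding subalg_def by blast
        then show ?thesis using sup by blast
      next
        case b
        then show ?thesis by (rule HW)
      next
        case c
        then show ?thesis using s by (intro PW) (auto simp: P_def)
      next
        case d
        then have "t \<otimes>\<^bsub>?F\<^esub> s \<in> ?I1" using sc I1 unfolding alg_ideal_def by blast
        then show ?thesis using sup by blast
      qed
    qed
  qed

  \<comment> \<open>the preimage of \<open>C\<close> is finitely generated as a module modulo \<open>?N\<close>; its generators give the linear dependencies of \<open>T\<close> modulo \<open>C\<close>\<close>
  let ?N = "module_gen K ?F (?H \<union> ?I1)"
  have HI: "?H \<union> ?I1 \<subseteq> carrier ?F" using Hc I1c by blast
  have Nsm: "submodule ?N K ?F" by (rule F.module_gen_submodule[OF HI])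
  let ?Q = "{x \<in> carrier ?F. p x \<in> C}"
  have Qsm: "submodule ?Q K ?F" by (rule submodule_vimage[OF F.is_module B.is_module plin Csm])
  have "?W \<subseteq> module_gen K ?F (?N \<union> Y)"
    by (rule module_gen_mono) (use module_gen_superset[of "?H \<union> ?I1" K ?F] in blast)
  then have "?Q \<subseteq> module_gen K ?F (?N \<union> Y)" using W by blast
  then obtain T2 where T2: "T2 \<subseteq> ?Q" "finite T2" "?Q \<subseteq> module_gen K ?F ((?Q \<inter> ?N) \<union> T2)"
    using F.noetherian_relative_finite_generation[OF noeth fin(2) Y Nsm Qsm] by blast
  have "\<exists>h\<in>?H. p h = p q" if "q \<in> T2" for q
  proof -
    have "p q \<in> p ` ?H" unfolding pH using that T2(1) by blast
    then show ?thesis by auto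
  qed
  then obtain v where v: "\<And>q. q \<in> T2 \<Longrightarrow> v q \<in> ?H \<and> p (v q) = p q" by metis
  define Z2 where "Z2 = (\<lambda>q. q \<ominus>\<^bsub>?F\<^esub> v q) ` T2"
  have Z2ker: "Z2 \<subseteq> alg_ker ?F B p"
  proof
    fix z assume "z \<in> Z2"
    then obtain q where q: "q \<in> T2" "z = q \<ominus>\<^bsub>?F\<^esub> v q" unfolding Z2_def by blast
    have "v q \<in> carrier ?F" "q \<in> carrier ?F" "p q = p (v q)" using v[OF q(1)] Hc T2(1) q(1) by auto
    then show "z \<in> alg_ker ?F B p"
      using fibre_difference_in_ker[OF F.is_nonunital_algebra B p(1), of q "v q"] q(2) by blast
  qed

  \<comment> \<open>as \<open>H\<close> covers the finitely presented algebra \<open>C\<close>, the kernel restricted to \<open>H\<close> is finitely generated\<close>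
  let ?FH = "?F\<lparr>carrier := ?H\<rparr>"
  interpret H: nonunital_algebra K ?FH by (rule F.subalg_algebra[OF H])
  have pHC: "p \<in> alg_hom K ?FH (B\<lparr>carrier := C\<rparr>)"
    by (rule alg_hom_restrict[OF p(1) Hc]) (simp add: pH)
  have "fin_gen_alg K ?FH"
    unfolding F.fin_gen_restrict_iff[OF H] using XH fin(1) by blast
  then have "fin_gen_ideal K ?FH (alg_ker ?FH (B\<lparr>carrier := C\<rparr>) p)"
    by (rule fin_pres_kernel_fin_gen[OF C.is_nonunital_algebra H.is_nonunital_algebra fp _ pHC])
      (simp add: pH)
  then obtain Z3 where Z3: "Z3 \<subseteq> ?H" "finite Z3" "ideal_gen K ?FH Z3 = {x \<in> ?H. p x = \<zero>\<^bsub>B\<^esub>}"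
    unfolding fin_gen_ideal_def by auto
  have Z3ker: "Z3 \<subseteq> alg_ker ?F B p" using Z3(3) ideal_gen_superset[of Z3 K ?FH] Hc by blast

  let ?Z = "Z1 \<union> Z2 \<union> Z3" and ?I = "ideal_gen K ?F (Z1 \<union> Z2 \<union> Z3)"
  have Zker: "?Z \<subseteq> alg_ker ?F B p" using Z1ker Z2ker Z3ker by blast
  have Zc: "?Z \<subseteq> carrier ?F" using Zker by blast
  have I: "alg_ideal K ?F ?I" by (rule F.ideal_gen_alg_ideal[OF Zc])
  have Ic: "?I \<subseteq> carrier ?F" and Ism: "submodule ?I K ?F"
    using F.alg_ideal_subset[OF I] alg_ideal_submodule[OF I] .
  have ZI: "?Z \<subseteq> ?I" by (rule ideal_gen_superset)
  have Iker: "?I \<subseteq> alg_ker ?F B p" by (rule ideal_gen_least[OF kerI Zker])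
  let ?V = "{x \<oplus>\<^bsub>?F\<^esub> y | x y. x \<in> ?H \<and> y \<in> ?I}"
  have Veq: "module_gen K ?F (?H \<union> ?I) = ?V" by (rule F.module_gen_Un_submodules[OF Hsm Ism])
  have Vsm: "submodule ?V K ?F" by (rule F.submodule_add_set[OF Hsm Ism])
  have HIV: "?H \<union> ?I \<subseteq> ?V" unfolding Veq[symmetric] by (rule module_gen_superset)
  have "?I1 \<subseteq> ?I" by (rule ideal_gen_mono) blast
  then have "?N \<subseteq> ?V" by (intro module_gen_least[OF Vsm]) (use HIV in blast)
  moreover have "T2 \<subseteq> ?V"
  proof
    fix q assume q: "q \<in> T2"
    show "q \<in> ?V"
    proof (rule F.submodule_minus_cancel[OF Vsm])
      show "q \<in> carrier ?F" using q T2(1) by blast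
      show "v q \<in> ?V" using v[OF q] HIV by blast
      have "q \<ominus>\<^bsub>?F\<^esub> v q \<in> ?I" using q ZI unfolding Z2_def by blast
      then show "q \<ominus>\<^bsub>?F\<^esub> v q \<in> ?V" using HIV by blast
    qed
  qed
  ultimately have QV: "?Q \<subseteq> ?V"
    using T2(3) module_gen_least[OF Vsm, of "(?Q \<inter> ?N) \<union> T2"] by blast
  have "alg_ker ?F B p \<subseteq> ?I"
  proof
    fix x assume x: "x \<in> alg_ker ?F B p"
    then have "x \<in> ?Q" using Csm[unfolded B.submodule_iff] by auto
    then obtain h i where hi: "h \<in> ?H" "i \<in> ?I" "x = h \<oplus>\<^bsub>?F\<^esub> i" using QV by blast
    have c: "h \<in> carrier ?F" "i \<in> carrier ?F" "p i = \<zero>\<^bsub>B\<^esub>" using hi Hc Iker by auto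
    have "p x = p h" using alg_homE(2)[OF p(1) c(1,2)] hi(3) c(3) pc[OF c(1)] by simp
    then have "h \<in> ideal_gen K ?FH Z3" using x hi(1) Z3(3) by auto
    moreover have "ideal_gen K ?FH Z3 \<subseteq> ?I \<inter> ?H"
      by (rule ideal_gen_least[OF F.ideal_restrict[OF H I]]) (use Z3(1) ZI in blast)
    ultimately have "h \<in> ?I" by blast
    then show "x \<in> ?I" using hi I unfolding F.alg_ideal_iff by blast
  qed
  then have "?I = alg_ker ?F B p" using Iker by blast
  moreover have "finite ?Z" using Pfin T2(2) Z3(2) unfolding Z1_def Z2_def by blast
  ultimately have "fin_gen_ideal K ?F (alg_ker ?F B p)" unfolding fin_gen_ideal_def using Zc by blast
  then show ?thesis unfolding fin_pres_alg_iff[OF B] using p by blast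
qed

section \<open>Direct products\<close>

text \<open>
  Describing the product by its projections and inclusions keeps the carriers of \<open>B\<close>, \<open>M\<close> and \<open>N\<close>
  independent. The inclusions are homomorphisms because no units have to be preserved.
\<close>

locale direct_product =
  B: nonunital_algebra K B + M: nonunital_algebra K M + N: nonunital_algebra K N
  for K :: "('k, 'm) ring_scheme" and B :: "('k, 'b, 'p) module_scheme"
    and M :: "('k, 'c, 'q) module_scheme" and N :: "('k, 'd, 'r) module_scheme" +
  fixes p q i j
  assumes p: "p \<in> alg_hom K B M" and q: "q \<in> alg_hom K B N"
    and i: "i \<in> alg_hom K M B" and j: "j \<in> alg_hom K N B"
    and pi: "\<And>a. a \<in> carrier M \<Longrightarrow> p (i a) = a" and qj: "\<And>b. b \<in> carrier N \<Longrightarrow> q (j b) = b"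
    and pj: "\<And>b. b \<in> carrier N \<Longrightarrow> p (j b) = \<zero>\<^bsub>M\<^esub>" and qi: "\<And>a. a \<in> carrier M \<Longrightarrow> q (i a) = \<zero>\<^bsub>N\<^esub>"
    and ij: "\<And>a b. a \<in> carrier M \<Longrightarrow> b \<in> carrier N \<Longrightarrow> i a \<otimes>\<^bsub>B\<^esub> j b = \<zero>\<^bsub>B\<^esub>"
    and ji: "\<And>a b. a \<in> carrier M \<Longrightarrow> b \<in> carrier N \<Longrightarrow> j b \<otimes>\<^bsub>B\<^esub> i a = \<zero>\<^bsub>B\<^esub>"
    and decomp: "\<And>x. x \<in> carrier B \<Longrightarrow> x = i (p x) \<oplus>\<^bsub>B\<^esub> j (q x)"
begin

lemma p_surj: "p ` carrier B = carrier M"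
  using pi alg_homE(1)[OF i] alg_homE(1)[OF p] by (metis image_eqI image_subsetI subsetI subset_antisym)

lemma generating_set:
  assumes S: "S \<subseteq> carrier M" "subalg_gen K M S = carrier M"
    and T: "T \<subseteq> carrier N" "subalg_gen K N T = carrier N"
  shows "i ` S \<union> j ` T \<subseteq> carrier B" "subalg_gen K B (i ` S \<union> j ` T) = carrier B"
proof -
  show c: "i ` S \<union> j ` T \<subseteq> carrier B"
    using S(1) T(1) alg_homE(1)[OF i] alg_homE(1)[OF j] by blast
  let ?G = "subalg_gen K B (i ` S \<union> j ` T)"
  have G: "subalg K B ?G" by (rule B.subalg_gen_subalg[OF c])
  have "i ` carrier M = subalg_gen K B (i ` S)"
    using image_subalg_gen[OF M.is_nonunital_algebra B.is_nonunital_algebra i S(1)] S(2) by simp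
  also have "\<dots> \<subseteq> ?G" by (rule subalg_gen_mono) blast
  finally have iG: "i ` carrier M \<subseteq> ?G" .
  have "j ` carrier N = subalg_gen K B (j ` T)"
    using image_subalg_gen[OF N.is_nonunital_algebra B.is_nonunital_algebra j T(1)] T(2) by simp
  also have "\<dots> \<subseteq> ?G" by (rule subalg_gen_mono) blast
  finally have jG: "j ` carrier N \<subseteq> ?G" .
  have "x \<in> ?G" if x: "x \<in> carrier B" for x
  proof -
    have "i (p x) \<in> ?G" "j (q x) \<in> ?G"
      using iG jG alg_homE(1)[OF p x] alg_homE(1)[OF q x] by blast+
    then have "i (p x) \<oplus>\<^bsub>B\<^esub> j (q x) \<in> ?G" using G unfolding B.subalg_iff by blast
    then show ?thesis using decomp[OF x] by simp
  qed
  then show "?G = carrier B" using B.subalg_subset[OF G] by blast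
qed

lemma fin_gen_product:
  assumes "fin_gen_alg K M" "fin_gen_alg K N"
  shows "fin_gen_alg K B"
proof -
  obtain S where S: "S \<subseteq> carrier M" "finite S" "subalg_gen K M S = carrier M"
    using assms(1) unfolding fin_gen_alg_def by blast
  obtain T where T: "T \<subseteq> carrier N" "finite T" "subalg_gen K N T = carrier N"
    using assms(2) unfolding fin_gen_alg_def by blast
  have "finite (i ` S \<union> j ` T)" using S T by blast
  then show ?thesis unfolding fin_gen_alg_def using generating_set[OF S(1,3) T(1,3)] by blast
qed

text \<open>
  The kernel of the projection to \<open>M\<close> is \<open>j ` carrier N\<close>, a homomorphic image of \<open>B\<close>; as an
  algebra, hence also as an ideal, it inherits finite generation from \<open>B\<close>.
\<close>

lemma fin_pres_factor:
  assumes "fin_pres_alg K B"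
  shows "fin_pres_alg K M"
proof (rule fin_pres_quotient[OF B.is_nonunital_algebra M.is_nonunital_algebra assms p p_surj])
  have jq: "(\<lambda>x. j (q x)) \<in> alg_hom K B B" by (rule alg_hom_compose[OF q j])
  obtain S where S: "S \<subseteq> carrier B" "finite S" "subalg_gen K B S = carrier B"
    using B.fin_pres_imp_fin_gen[OF assms] unfolding fin_gen_alg_def by blast
  let ?Z = "(\<lambda>x. j (q x)) ` S"
  have Zc: "?Z \<subseteq> carrier B" using S(1) alg_homE(1)[OF jq] by blast
  have I: "alg_ideal K B (ideal_gen K B ?Z)" by (rule B.ideal_gen_alg_ideal[OF Zc])
  have ker: "alg_ideal K B (alg_ker B M p)"
    by (rule alg_ker_ideal[OF B.is_nonunital_algebra M.is_nonunital_algebra p])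
  have "?Z \<subseteq> alg_ker B M p" using Zc pj alg_homE(1)[OF q] S(1) by auto
  then have "ideal_gen K B ?Z \<subseteq> alg_ker B M p" by (rule ideal_gen_least[OF ker])
  moreover have "alg_ker B M p \<subseteq> ideal_gen K B ?Z"
  proof
    fix x assume x: "x \<in> alg_ker B M p"
    have i0: "i \<zero>\<^bsub>M\<^esub> = \<zero>\<^bsub>B\<^esub>"
      by (rule alg_hom_zero[OF M.is_nonunital_algebra B.is_nonunital_algebra i])
    have "j (q x) \<in> carrier B" using x alg_homE(1)[OF jq] by blast
    then have "x = j (q x)" using decomp[of x] x i0 by simp
    then have "x \<in> (\<lambda>x. j (q x)) ` subalg_gen K B S" using x S(3) by blast
    also have "\<dots> = subalg_gen K B ?Z"
      by (rule image_subalg_gen[OF B.is_nonunital_algebra B.is_nonunital_algebra jq S(1)])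
    also have "\<dots> \<subseteq> ideal_gen K B ?Z"
      by (rule subalg_gen_least[OF B.alg_ideal_imp_subalg[OF I] ideal_gen_superset])
    finally show "x \<in> ideal_gen K B ?Z" .
  qed
  ultimately have "ideal_gen K B ?Z = alg_ker B M p" by blast
  then show "fin_gen_ideal K B (alg_ker B M p)" unfolding fin_gen_ideal_def using Zc S(2) by blast
qed

text \<open>
  Presentations of the factors present the product once the generators from different factors are
  made to annihilate each other.
\<close>

lemma fin_pres_product:
  assumes fpM: "fin_pres_alg K M" and fpN: "fin_pres_alg K N"
  shows "fin_pres_alg K B"
proof -
  obtain S where S: "S \<subseteq> carrier M" "finite S" "subalg_gen K M S = carrier M"
    using M.fin_pres_imp_fin_gen[OF fpM] unfolding fin_gen_alg_def by blast
  obtain T where T: "T \<subseteq> carrier N" "finite T" "subalg_gen K N T = carrier N"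
    using N.fin_pres_imp_fin_gen[OF fpN] unfolding fin_gen_alg_def by blast
  have "finite (i ` S \<union> j ` T)" using S T by blast
  then obtain m :: nat and f l where f: "f \<in> alg_hom K (free_alg K {..<m}) B"
    "f ` carrier (free_alg K {..<m}) = carrier B"
    and l: "l ` (i ` S \<union> j ` T) = (\<lambda>i. free_word K [i]) ` {..<m}"
      "\<And>s. s \<in> i ` S \<union> j ` T \<Longrightarrow> f (l s) = s"
    by (rule B.free_cover[OF _ generating_set[OF S(1,3) T(1,3)]]) blast
  let ?F = "free_alg K {..<m}"
  interpret F: nonunital_algebra K ?F by (rule B.R.free_alg_algebra)
  note alg = F.is_nonunital_algebra B.is_nonunital_algebra M.is_nonunital_algebra N.is_nonunital_algebra
  define X Y where "X = l ` i ` S" and "Y = l ` j ` T"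
  have fin: "finite X" "finite Y" using S(2) T(2) X_def Y_def by auto
  have XYL: "X \<union> Y = (\<lambda>i. free_word K [i]) ` {..<m}" using l(1) unfolding X_def Y_def by (simp add: image_Un)
  then have XY: "X \<union> Y \<subseteq> carrier ?F" using B.R.free_letter_closed[of _ "{..<m}"] by auto
  have XYgen: "subalg_gen K ?F (X \<union> Y) = carrier ?F"
    unfolding XYL by (rule B.R.free_alg_generated)
  have X: "X \<subseteq> carrier ?F" and Y: "Y \<subseteq> carrier ?F" using XY by auto
  have fX: "f ` X = i ` S" and fY: "f ` Y = j ` T"
    using l(2) unfolding X_def Y_def by (force simp: image_image)+
  let ?H = "subalg_gen K ?F X" and ?G = "subalg_gen K ?F Y"
  have H: "subalg K ?F ?H" and G: "subalg K ?F ?G" using F.subalg_gen_subalg X Y by auto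
  have Hc: "?H \<subseteq> carrier ?F" and Gc: "?G \<subseteq> carrier ?F" using F.subalg_subset H G by auto
  have fH: "f ` ?H = i ` carrier M"
    using image_subalg_gen[OF alg(1,2) f(1) X] image_subalg_gen[OF alg(3,2) i S(1)] fX S(3) by simp
  have fG: "f ` ?G = j ` carrier N"
    using image_subalg_gen[OF alg(1,2) f(1) Y] image_subalg_gen[OF alg(4,2) j T(1)] fY T(3) by simp
  have kerI: "alg_ideal K ?F (alg_ker ?F B f)" by (rule alg_ker_ideal[OF alg(1,2) f(1)])
  define Z1 where "Z1 = (\<lambda>(x, y). x \<otimes>\<^bsub>?F\<^esub> y) ` (X \<times> Y) \<union> (\<lambda>(y, x). y \<otimes>\<^bsub>?F\<^esub> x) ` (Y \<times> X)"
  have fXY: "f x \<in> i ` carrier M" "f y \<in> j ` carrier N" if "x \<in> X" "y \<in> Y" for x y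
    using that fX fY S(1) T(1) by blast+
  have Z1ker: "Z1 \<subseteq> alg_ker ?F B f"
  proof -
    have "x \<otimes>\<^bsub>?F\<^esub> y \<in> alg_ker ?F B f \<and> y \<otimes>\<^bsub>?F\<^esub> x \<in> alg_ker ?F B f" if xy: "x \<in> X" "y \<in> Y" for x y
    proof -
      have "x \<in> carrier ?F" "y \<in> carrier ?F" using xy X Y by auto
      moreover obtain a b where "a \<in> carrier M" "b \<in> carrier N" "f x = i a" "f y = j b"
        using fXY[OF xy] by blast
      ultimately show ?thesis using alg_homE(3)[OF f(1)] ij ji F.mult_closed by simp
    qed
    then show ?thesis unfolding Z1_def by (intro Un_least image_subsetI) auto
  qed
  then have Z1c: "Z1 \<subseteq> carrier ?F" by blast
  let ?FH = "?F\<lparr>carrier := ?H\<rparr>" and ?FG = "?F\<lparr>carrier := ?G\<rparr>"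
  interpret FH: nonunital_algebra K ?FH by (rule F.subalg_algebra[OF H])
  interpret FG: nonunital_algebra K ?FG by (rule F.subalg_algebra[OF G])
  have fgH: "fin_gen_alg K ?FH" and fgG: "fin_gen_alg K ?FG"
    unfolding F.fin_gen_restrict_iff[OF H] F.fin_gen_restrict_iff[OF G]
    using subalg_gen_superset[of X K ?F] subalg_gen_superset[of Y K ?F] fin by blast+
  have pf: "(\<lambda>x. p (f x)) \<in> alg_hom K ?FH M" and qf: "(\<lambda>x. q (f x)) \<in> alg_hom K ?FG N"
    using alg_hom_restrict_dom[OF alg_hom_compose[OF f(1) p] Hc]
      alg_hom_restrict_dom[OF alg_hom_compose[OF f(1) q] Gc] by auto
  have pfH: "(\<lambda>x. p (f x)) ` carrier ?FH = carrier M"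
  proof -
    have "(\<lambda>x. p (f x)) ` ?H = p ` f ` ?H" by (simp add: image_image)
    also have "\<dots> = (\<lambda>a. p (i a)) ` carrier M" unfolding fH by (simp add: image_image)
    also have "\<dots> = carrier M" using pi by simp
    finally show ?thesis by simp
  qed
  have qfG: "(\<lambda>x. q (f x)) ` carrier ?FG = carrier N"
  proof -
    have "(\<lambda>x. q (f x)) ` ?G = q ` f ` ?G" by (simp add: image_image)
    also have "\<dots> = (\<lambda>a. q (j a)) ` carrier N" unfolding fG by (simp add: image_image)
    also have "\<dots> = carrier N" using qj by simp
    finally show ?thesis by simp
  qed
  obtain Z2 where Z2: "Z2 \<subseteq> ?H" "finite Z2" "ideal_gen K ?FH Z2 = {x \<in> ?H. p (f x) = \<zero>\<^bsub>M\<^esub>}"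
    using fin_pres_kernel_fin_gen[OF alg(3) FH.is_nonunital_algebra fpM fgH pf pfH]
    unfolding fin_gen_ideal_def by auto
  obtain Z3 where Z3: "Z3 \<subseteq> ?G" "finite Z3" "ideal_gen K ?FG Z3 = {x \<in> ?G. q (f x) = \<zero>\<^bsub>N\<^esub>}"
    using fin_pres_kernel_fin_gen[OF alg(4) FG.is_nonunital_algebra fpN fgG qf qfG]
    unfolding fin_gen_ideal_def by auto
  have i0: "i \<zero>\<^bsub>M\<^esub> = \<zero>\<^bsub>B\<^esub>" and j0: "j \<zero>\<^bsub>N\<^esub> = \<zero>\<^bsub>B\<^esub>"
    and p0: "p \<zero>\<^bsub>B\<^esub> = \<zero>\<^bsub>M\<^esub>" and q0: "q \<zero>\<^bsub>B\<^esub> = \<zero>\<^bsub>N\<^esub>"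
    using alg_hom_zero[OF alg(3,2) i] alg_hom_zero[OF alg(4,2) j]
      alg_hom_zero[OF alg(2,3) p] alg_hom_zero[OF alg(2,4) q] by auto
  have Z2ker: "Z2 \<subseteq> alg_ker ?F B f"
  proof
    fix z assume z: "z \<in> Z2"
    then have "z \<in> ?H" "p (f z) = \<zero>\<^bsub>M\<^esub>" using Z2(3) ideal_gen_superset[of Z2 K ?FH] by auto
    moreover obtain a where "a \<in> carrier M" "f z = i a" using fH \<open>z \<in> ?H\<close> by blast
    ultimately show "z \<in> alg_ker ?F B f" using pi i0 Hc by auto
  qed
  have Z3ker: "Z3 \<subseteq> alg_ker ?F B f"
  proof
    fix z assume z: "z \<in> Z3"
    then have "z \<in> ?G" "q (f z) = \<zero>\<^bsub>N\<^esub>" using Z3(3) ideal_gen_superset[of Z3 K ?FG] by auto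
    moreover obtain a where "a \<in> carrier N" "f z = j a" using fG \<open>z \<in> ?G\<close> by blast
    ultimately show "z \<in> alg_ker ?F B f" using qj j0 Gc by auto
  qed
  let ?Z = "Z1 \<union> Z2 \<union> Z3" and ?I = "ideal_gen K ?F (Z1 \<union> Z2 \<union> Z3)"
  have Zker: "?Z \<subseteq> alg_ker ?F B f" using Z1ker Z2ker Z3ker by blast
  have Zc: "?Z \<subseteq> carrier ?F" using Zker by blast
  have I: "alg_ideal K ?F ?I" by (rule F.ideal_gen_alg_ideal[OF Zc])
  have Ic: "?I \<subseteq> carrier ?F" using F.alg_ideal_subset[OF I] .
  have ZI: "?Z \<subseteq> ?I" by (rule ideal_gen_superset)
  have Iker: "?I \<subseteq> alg_ker ?F B f" by (rule ideal_gen_least[OF kerI Zker])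
  \<comment> \<open>modulo the ideal, the two generated subalgebras annihilate the other set of generators\<close>
  have annih: "a \<otimes>\<^bsub>?F\<^esub> y \<in> ?I"
    if gens: "Y' \<subseteq> carrier ?F" "X' \<subseteq> carrier ?F" "\<And>x y. x \<in> X' \<Longrightarrow> y \<in> Y' \<Longrightarrow> x \<otimes>\<^bsub>?F\<^esub> y \<in> ?I"
      and a: "a \<in> subalg_gen K ?F X'" and y: "y \<in> Y'" for X' Y' a y
  proof -
    let ?Q = "{a \<in> carrier ?F. a \<otimes>\<^bsub>?F\<^esub> y \<in> ?I}"
    have yc: "y \<in> carrier ?F" using y gens(1) by blast
    have "subalg K ?F ?Q"
      unfolding F.subalg_iff using I[unfolded F.alg_ideal_iff] yc
      by (auto simp: F.mult_add_left F.mult_smult_left F.mult_zero_left F.mult_closed F.mult_assoc)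
    moreover have "X' \<subseteq> ?Q" using gens y by blast
    ultimately show ?thesis using subalg_gen_least a by blast
  qed
  have HY: "a \<otimes>\<^bsub>?F\<^esub> y \<in> ?I" if "a \<in> ?H" "y \<in> Y" for a y
    by (rule annih[OF Y X _ that]) (use ZI Z1_def in blast)
  have GX: "a \<otimes>\<^bsub>?F\<^esub> y \<in> ?I" if "a \<in> ?G" "y \<in> X" for a y
    by (rule annih[OF X Y _ that]) (use ZI Z1_def in blast)
  let ?W = "module_gen K ?F (?H \<union> ?G \<union> ?I)"
  have HGI: "?H \<union> ?G \<union> ?I \<subseteq> carrier ?F" using Hc Gc Ic by blast
  have Wsm: "submodule ?W K ?F" by (rule F.module_gen_submodule[OF HGI])
  have sup: "?H \<union> ?G \<union> ?I \<subseteq> ?W" by (rule module_gen_superset)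
  have XH: "X \<subseteq> ?H" and YG: "Y \<subseteq> ?G" by (rule subalg_gen_superset)+
  have W: "?W = carrier ?F"
  proof (rule F.right_closed_submodule_eq_carrier[OF XY XYgen Wsm])
    show "X \<union> Y \<subseteq> ?W" using sup XH YG by blast
    fix w s assume w: "w \<in> ?W" and s: "s \<in> X \<union> Y"
    have sc: "s \<in> carrier ?F" using s XY by blast
    show "w \<otimes>\<^bsub>?F\<^esub> s \<in> ?W"
    proof (rule F.module_gen_mult_right[OF HGI sc Wsm _ w])
      fix t assume "t \<in> ?H \<union> ?G \<union> ?I"
      then have "t \<otimes>\<^bsub>?F\<^esub> s \<in> ?H \<union> ?G \<union> ?I"
        using s sc XH YG HY GX H G I unfolding subalg_def alg_ideal_def by blast
      then show "t \<otimes>\<^bsub>?F\<^esub> s \<in> ?W" using sup by blast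
    qed
  qed
  have "alg_ker ?F B f \<subseteq> ?I"
  proof
    fix x assume x: "x \<in> alg_ker ?F B f"
    have Hsm: "submodule ?H K ?F" and Gsm: "submodule ?G K ?F" and Ism: "submodule ?I K ?F"
      using subalg_submodule[OF H] subalg_submodule[OF G] alg_ideal_submodule[OF I] .
    have "?H \<union> ?G \<union> ?I \<subseteq> ?H \<union> module_gen K ?F (?G \<union> ?I)"
      using module_gen_superset[of "?G \<union> ?I" K ?F] by blast
    then have "?W \<subseteq> module_gen K ?F (?H \<union> module_gen K ?F (?G \<union> ?I))" by (rule module_gen_mono)
    then have "x \<in> module_gen K ?F (?H \<union> module_gen K ?F (?G \<union> ?I))" using x W by blast
    then obtain h g r where hgr: "h \<in> ?H" "g \<in> ?G" "r \<in> ?I" "x = h \<oplus>\<^bsub>?F\<^esub> (g \<oplus>\<^bsub>?F\<^esub> r)"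
      unfolding F.module_gen_Un_submodules[OF Gsm Ism]
        F.module_gen_Un_submodules[OF Hsm F.submodule_add_set[OF Gsm Ism]] by blast
    have c: "h \<in> carrier ?F" "g \<in> carrier ?F" "r \<in> carrier ?F" "f r = \<zero>\<^bsub>B\<^esub>"
      using hgr Hc Gc Iker by auto
    obtain a b where ab: "a \<in> carrier M" "b \<in> carrier N" "f h = i a" "f g = j b"
      using hgr fH fG by blast
    have fc: "i a \<in> carrier B" "j b \<in> carrier B" using ab alg_homE(1)[OF i] alg_homE(1)[OF j] by auto
    have fx: "i a \<oplus>\<^bsub>B\<^esub> j b = \<zero>\<^bsub>B\<^esub>"
      using x hgr(4) c alg_homE(2)[OF f(1)] ab fc by simp
    have "a = p (i a \<oplus>\<^bsub>B\<^esub> j b)" using alg_homE(2)[OF p fc] pi[OF ab(1)] pj[OF ab(2)] ab(1) by simp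
    then have "p (f h) = \<zero>\<^bsub>M\<^esub>" using fx p0 ab pi by simp
    then have hZ: "h \<in> ideal_gen K ?FH Z2" using Z2(3) hgr(1) by blast
    have "b = q (i a \<oplus>\<^bsub>B\<^esub> j b)" using alg_homE(2)[OF q fc] qj[OF ab(2)] qi[OF ab(1)] ab(2) by simp
    then have "q (f g) = \<zero>\<^bsub>N\<^esub>" using fx q0 ab qj by simp
    then have gZ: "g \<in> ideal_gen K ?FG Z3" using Z3(3) hgr(2) by blast
    have "ideal_gen K ?FH Z2 \<subseteq> ?I \<inter> ?H"
      by (rule ideal_gen_least[OF F.ideal_restrict[OF H I]]) (use Z2(1) ZI in blast)
    moreover have "ideal_gen K ?FG Z3 \<subseteq> ?I \<inter> ?G"
      by (rule ideal_gen_least[OF F.ideal_restrict[OF G I]]) (use Z3(1) ZI in blast)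
    ultimately have "h \<in> ?I" "g \<in> ?I" using hZ gZ by blast+
    then show "x \<in> ?I" using F.submoduleE(5)[OF Ism] hgr(3,4) by simp
  qed
  then have "?I = alg_ker ?F B f" using Iker by blast
  moreover have "finite ?Z" using fin Z2(2) Z3(2) unfolding Z1_def by blast
  ultimately have "fin_gen_ideal K ?F (alg_ker ?F B f)" unfolding fin_gen_ideal_def using Zc by blast
  then show ?thesis unfolding fin_pres_alg_iff[OF alg(2)] using f by blast
qed

end

section \<open>Ideals of finite corank in free algebras\<close>

text \<open>
  \<open>b x y\<close> differs from the word \<open>xy\<close> by a linear combination of letters. The right ideal generated
  by all \<open>b x y\<close> turns out to be a finitely presented algebra with a basis over the scalars: a
  word of length at least two is cut uniquely into blocks of length two, the last of length two or
  three, and the corresponding products of the elements \<open>b x y\<close> (the last one followed by a letter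
  if its block has length three) have the given words as their leading terms.
\<close>

locale block_rewriting = cring K for K :: "('k, 'm) ring_scheme" (structure) +
  fixes V :: "'x set" and b :: "'x \<Rightarrow> 'x \<Rightarrow> 'x list \<Rightarrow> 'k"
  assumes finite_V: "finite V"
    and b_closed: "\<And>x y. x \<in> V \<Longrightarrow> y \<in> V \<Longrightarrow> b x y \<in> carrier (free_alg K V)"
    and b_rewrite: "\<And>x y. x \<in> V \<Longrightarrow> y \<in> V \<Longrightarrow>
      \<exists>z\<in>module_gen K (free_alg K V) ((\<lambda>x. free_word K [x]) ` V). free_word K [x, y] = b x y \<oplus>\<^bsub>free_alg K V\<^esub> z"
begin

abbreviation "F \<equiv> free_alg K V"
abbreviation "letters \<equiv> (\<lambda>x. free_word K [x]) ` V"

sublocale F: nonunital_algebra K F by (rule free_alg_algebra)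

lemma letters_closed: "letters \<subseteq> carrier F"
  by (auto intro: free_letter_closed)

subsection \<open>Leading words\<close>

text \<open>
  Words are compared by length only: \<open>u\<close> is the only word of maximal length in \<open>f\<close>.
\<close>

definition leads :: "'x list \<Rightarrow> ('x list \<Rightarrow> 'k) \<Rightarrow> bool" where
  "leads u f \<longleftrightarrow> f u = \<one> \<and> (\<forall>w. length u \<le> length w \<longrightarrow> w \<noteq> u \<longrightarrow> f w = \<zero>)"

text \<open>
  If a word of the length of \<open>u @ v\<close> or longer is cut elsewhere than after \<open>length u\<close> letters, one
  piece is longer than \<open>u\<close> or \<open>v\<close>, so that its coefficient vanishes.
\<close>

lemma leads_mult:
  assumes f: "f \<in> carrier F" "leads u f" and g: "g \<in> carrier F" "leads v g"
    and ne: "u \<noteq> []" "v \<noteq> []"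
  shows "leads (u @ v) (f \<otimes>\<^bsub>F\<^esub> g)"
proof -
  have cut: "(f \<otimes>\<^bsub>F\<^esub> g) w = f (take (length u) w) \<otimes> g (drop (length u) w)"
    if w: "length (u @ v) \<le> length w" for w
  proof (rule free_alg_mult_single_cut[OF f(1) g(1)])
    show "length u \<in> {0<..<length w}" using w ne by (cases u; cases v) auto
    fix k assume k: "k \<in> {0<..<length w}" "k \<noteq> length u"
    show "f (take k w) = \<zero> \<or> g (drop k w) = \<zero>"
    proof (cases "length u < k")
      case True
      then have "length (take k w) = k" using k by simp
      then have "length u \<le> length (take k w)" "take k w \<noteq> u" using True by auto
      then show ?thesis using f(2) unfolding leads_def by blast
    next
      case False
      then have "length v < length (drop k w)" using k w by simp
      then have "length v \<le> length (drop k w)" "drop k w \<noteq> v" by auto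
      then show ?thesis using g(2) unfolding leads_def by blast
    qed
  qed
  have "(f \<otimes>\<^bsub>F\<^esub> g) (u @ v) = \<one>" using cut[of "u @ v"] f(2) g(2) by (simp add: leads_def)
  moreover have "(f \<otimes>\<^bsub>F\<^esub> g) w = \<zero>" if w: "length (u @ v) \<le> length w" "w \<noteq> u @ v" for w
  proof -
    have len: "length u \<le> length (take (length u) w)" "length v \<le> length (drop (length u) w)"
      using w(1) by auto
    have "take (length u) w \<noteq> u \<or> drop (length u) w \<noteq> v" using w(2) append_take_drop_id by metis
    then have "f (take (length u) w) = \<zero> \<or> g (drop (length u) w) = \<zero>"
      using f(2) g(2) len unfolding leads_def by blast
    then show ?thesis using cut[OF w(1)] f(1) g(1) by auto
  qed
  ultimately show ?thesis unfolding leads_def by blast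
qed

lemma leads_word: "leads w (free_word K w)"
  unfolding leads_def free_word_def by auto

lemma letter_span_coeff:
  assumes "z \<in> module_gen K F letters" "2 \<le> length w"
  shows "z w = \<zero>"
proof -
  have "submodule {z \<in> carrier F. z w = \<zero>} K F"
    unfolding F.submodule_iff
  proof (intro conjI ballI)
    show "f \<oplus>\<^bsub>F\<^esub> g \<in> {z \<in> carrier F. z w = \<zero>}"
      if "f \<in> {z \<in> carrier F. z w = \<zero>}" "g \<in> {z \<in> carrier F. z w = \<zero>}" for f g
      using that F.M.a_closed[of f g] by (simp add: free_alg_simps(2))
    show "a \<odot>\<^bsub>F\<^esub> f \<in> {z \<in> carrier F. z w = \<zero>}"
      if "a \<in> carrier K" "f \<in> {z \<in> carrier F. z w = \<zero>}" for a f
      using that F.smult_closed[of a f] by (simp add: free_alg_simps(3))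
    show "\<zero>\<^bsub>F\<^esub> \<in> {z \<in> carrier F. z w = \<zero>}" using F.M.zero_closed by (simp add: free_alg_simps(1))
  qed blast
  moreover have "letters \<subseteq> {z \<in> carrier F. z w = \<zero>}"
    using letters_closed assms(2) by (auto simp: free_word_def)
  ultimately show ?thesis using module_gen_least assms(1) by blast
qed

lemma leads_b:
  assumes "x \<in> V" "y \<in> V"
  shows "leads [x, y] (b x y)"
proof -
  obtain z where z: "z \<in> module_gen K F letters" "free_word K [x, y] = b x y \<oplus>\<^bsub>F\<^esub> z"
    using b_rewrite[OF assms] by blast
  have "b x y w = free_word K [x, y] w" if "2 \<le> length w" for w
  proof -
    have "free_word K [x, y] w = b x y w \<oplus> z w" using z(2) by (simp add: free_alg_simps)
    then show ?thesis using letter_span_coeff[OF z(1) that] b_closed[OF assms] by simp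
  qed
  then show ?thesis unfolding leads_def by (auto simp: free_word_def)
qed

subsection \<open>Blocks and normal words\<close>

definition blocks :: "'x list set" where
  "blocks = {u \<in> lists V. length u = 2 \<or> length u = 3}"

fun block_val :: "'x list \<Rightarrow> 'x list \<Rightarrow> 'k" where
  "block_val [x, y] = b x y"
| "block_val [x, y, z] = b x y \<otimes>\<^bsub>F\<^esub> free_word K [z]"
| "block_val _ = \<zero>\<^bsub>F\<^esub>"

lemma finite_blocks: "finite blocks"
proof -
  have "blocks \<subseteq> {u. set u \<subseteq> V \<and> length u \<le> 3}" unfolding blocks_def by auto
  then show ?thesis using finite_lists_length_le[OF finite_V] finite_subset by blast
qed

lemma blocks_cases:
  assumes "u \<in> blocks"
  obtains (two) x y where "u = [x, y]" "x \<in> V" "y \<in> V"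
  | (three) x y z where "u = [x, y, z]" "x \<in> V" "y \<in> V" "z \<in> V"
proof -
  consider "length u = Suc (Suc 0)" | "length u = Suc (Suc (Suc 0))" 
    using assms unfolding blocks_def by (auto simp: numeral_2_eq_2 numeral_3_eq_3)
  then show thesis
  proof cases
    case 1
    then obtain x y where "u = [x, y]" by (auto simp: length_Suc_conv)
    then show thesis using two assms unfolding blocks_def by auto
  next
    case 2
    then obtain x y z where "u = [x, y, z]" by (auto simp: length_Suc_conv)
    then show thesis using three assms unfolding blocks_def by auto
  qed
qed

lemma two_block: "x \<in> V \<Longrightarrow> y \<in> V \<Longrightarrow> [x, y] \<in> blocks"
  and three_block: "x \<in> V \<Longrightarrow> y \<in> V \<Longrightarrow> z \<in> V \<Longrightarrow> [x, y, z] \<in> blocks"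
  unfolding blocks_def by auto

lemma block_val_closed: "u \<in> blocks \<Longrightarrow> block_val u \<in> carrier F"
  by (elim blocks_cases) (auto intro!: b_closed F.mult_closed free_letter_closed)

lemma leads_block: "u \<in> blocks \<Longrightarrow> leads u (block_val u)"
proof (elim blocks_cases)
  fix x y z assume u: "u = [x, y, z]" "x \<in> V" "y \<in> V" "z \<in> V"
  have "leads ([x, y] @ [z]) (b x y \<otimes>\<^bsub>F\<^esub> free_word K [z])"
    by (rule leads_mult[OF b_closed leads_b free_letter_closed leads_word]) (use u in auto)
  then show "leads u (block_val u)" using u by simp
qed (simp add: leads_b)

end

text \<open>
  Blocks are numbered because a finite presentation starts from a free algebra on an initial
  segment of the natural numbers. The map \<open>ev\<close> sends each numbered block to the element that it
  stands for.
\<close>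

locale numbered_blocks = block_rewriting +
  fixes p :: nat and c :: "nat \<Rightarrow> 'c list" and ev :: "(nat list \<Rightarrow> 'a) \<Rightarrow> 'c list \<Rightarrow> 'a"
  assumes c: "bij_betw c {..<p} blocks"
    and ev: "ev \<in> alg_hom K (free_alg K {..<p}) F"
    and ev_letter: "\<And>i. i < p \<Longrightarrow> ev (free_word K [i]) = block_val (c i)"
begin

abbreviation "E \<equiv> free_alg K {..<p}"

sublocale E: nonunital_algebra K E by (rule free_alg_algebra)

inductive_set normal :: "nat list set" where
  single: "i < p \<Longrightarrow> [i] \<in> normal"
| cons: "i < p \<Longrightarrow> length (c i) = 2 \<Longrightarrow> w \<in> normal \<Longrightarrow> i # w \<in> normal"

abbreviation "flat w \<equiv> concat (map c w)"
abbreviation "S \<equiv> module_gen K E (free_word K ` normal)"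

lemma normal_words: "w \<in> normal \<Longrightarrow> w \<in> lists {..<p} - {[]}"
  by (induction rule: normal.induct) auto

lemma normal_closed: "free_word K ` normal \<subseteq> carrier E"
  by (intro image_subsetI free_word_closed normal_words)

lemma S_submodule: "submodule S K E"
  by (rule E.module_gen_submodule[OF normal_closed])

lemma normal_in_S: "w \<in> normal \<Longrightarrow> free_word K w \<in> S"
  by (rule module_gen_superset[THEN subsetD]) simp

lemma c_block: "i < p \<Longrightarrow> c i \<in> blocks"
  using bij_betwE[OF c] by auto

lemma c_length: "i < p \<Longrightarrow> length (c i) = 2 \<or> length (c i) = 3"
  using c_block unfolding blocks_def by auto

lemma block_index:
  assumes "u \<in> blocks"
  obtains i where "i < p" "c i = u"
proof -
  have "u \<in> c ` {..<p}" using bij_betw_imp_surj_on[OF c] assms by simp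
  then show thesis using that by auto
qed

lemma letter_closed: "i < p \<Longrightarrow> free_word K [i] \<in> carrier E"
  by (rule free_letter_closed) simp

lemma cons_word:
  assumes "i < p" "w \<in> lists {..<p} - {[]}"
  shows "free_word K (i # w) = free_word K [i] \<otimes>\<^bsub>E\<^esub> free_word K w"
  using free_word_mult[of "[i]" "{..<p}" w] assms by simp

lemma ev_cons:
  assumes "i < p" "w \<in> lists {..<p} - {[]}"
  shows "ev (free_word K (i # w)) = block_val (c i) \<otimes>\<^bsub>F\<^esub> ev (free_word K w)"
  using alg_homE(3)[OF ev letter_closed[OF assms(1)] free_word_closed[OF assms(2)]]
    ev_letter[OF assms(1)] cons_word[OF assms] by simp

lemma flat_length: "w \<in> normal \<Longrightarrow> 2 \<le> length (flat w)"
  by (induction rule: normal.induct) (use c_length in force)+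

lemma flat_inj:
  assumes "w \<in> normal" "w' \<in> normal" "flat w = flat w'"
  shows "w = w'"
  using assms
proof (induction arbitrary: w' rule: normal.induct)
  case (single i)
  from single(2,3,1) show ?case
  proof (cases rule: normal.cases)
    case (single i')
    then have "c i = c i'" using \<open>flat [i] = flat w'\<close> by simp
    then show ?thesis using single \<open>i < p\<close> bij_betw_imp_inj_on[OF c] by (simp add: inj_on_def)
  next
    case (cons i' v)
    then have "length (c i) = 2 + length (flat v)" using \<open>flat [i] = flat w'\<close> by simp
    then show ?thesis using flat_length[OF cons(4)] c_length[OF \<open>i < p\<close>] by arith
  qed
next
  case (cons i v)
  from cons.prems(1) show ?case
  proof (cases rule: normal.cases)
    case (single i')
    then have "length (c i') = 2 + length (flat v)" using cons.prems(2) cons.hyps(2)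
      by (metis append_Nil2 concat.simps length_append list.simps(8,9))
    then show ?thesis using flat_length[OF cons.hyps(3)] c_length[OF single(2)] by arith
  next
    case (cons i' v')
    then have "c i = c i' \<and> flat v = flat v'" using cons.prems \<open>length (c i) = 2\<close> by simp
    then show ?thesis
      using cons \<open>i < p\<close> cons.IH bij_betw_imp_inj_on[OF c] by (simp add: inj_on_def)
  qed
qed

lemma leads_normal: "w \<in> normal \<Longrightarrow> leads (flat w) (ev (free_word K w))"
proof (induction rule: normal.induct)
  case (single i)
  then show ?case using leads_block[OF c_block] ev_letter by simp
next
  case (cons i w)
  have w: "w \<in> lists {..<p} - {[]}" using normal_words[OF cons.hyps(3)] .
  have "ev (free_word K w) \<in> carrier F" using alg_homE(1)[OF ev free_word_closed[OF w]] .
  then have "leads (c i @ flat w) (block_val (c i) \<otimes>\<^bsub>F\<^esub> ev (free_word K w))"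
    using leads_mult[OF block_val_closed[OF c_block] leads_block[OF c_block] _ cons.IH] cons.hyps flat_length
    by fastforce
  then show ?case using ev_cons[OF cons.hyps(1) w] by simp
qed

text \<open>
  Distinct normal words have distinct leading words. Hence at the longest of the leading words
  that belong to words of \<open>f\<close>, the coefficient of \<open>ev f\<close> is a single coefficient of \<open>f\<close>.
\<close>

lemma ev_inj_on_S:
  assumes f: "f \<in> S" and 0: "ev f = \<zero>\<^bsub>F\<^esub>"
  shows "f = \<zero>\<^bsub>E\<^esub>"
proof (rule ccontr)
  assume ne: "f \<noteq> \<zero>\<^bsub>E\<^esub>"
  have fE: "f \<in> carrier E" using f E.module_gen_carrier[OF normal_closed] by blast
  let ?T = "{w. f w \<noteq> \<zero>}"
  have "submodule {g \<in> carrier E. \<forall>w. w \<notin> normal \<longrightarrow> g w = \<zero>} K E" (is "submodule ?N K E")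
    unfolding E.submodule_iff
  proof (intro conjI ballI)
    show "g \<oplus>\<^bsub>E\<^esub> h \<in> ?N" if "g \<in> ?N" "h \<in> ?N" for g h
      using that E.M.a_closed[of g h] by (simp add: free_alg_simps(2))
    show "a \<odot>\<^bsub>E\<^esub> g \<in> ?N" if "a \<in> carrier K" "g \<in> ?N" for a g
      using that E.smult_closed[of a g] by (simp add: free_alg_simps(3))
    show "\<zero>\<^bsub>E\<^esub> \<in> ?N" using E.M.zero_closed by (simp add: free_alg_simps(1))
  qed blast
  moreover have "free_word K ` normal \<subseteq> {g \<in> carrier E. \<forall>w. w \<notin> normal \<longrightarrow> g w = \<zero>}"
    using normal_closed by (auto simp: free_word_def)
  ultimately have "S \<subseteq> {g \<in> carrier E. \<forall>w. w \<notin> normal \<longrightarrow> g w = \<zero>}" by (rule module_gen_least)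
  then have Tn: "?T \<subseteq> normal" using f by blast
  have Tfin: "finite ?T" using free_alg_supp(1)[OF fE] .
  have Tne: "?T \<noteq> {}" using ne by (auto simp: free_alg_simps fun_eq_iff)
  let ?n = "\<lambda>w. length (flat w)"
  have "Max (?n ` ?T) \<in> ?n ` ?T" by (rule Max_in) (use Tfin Tne in blast)+
  then obtain w0 where w0': "w0 \<in> ?T" "Max (?n ` ?T) = ?n w0" by (rule imageE)
  have w0: "w0 \<in> ?T" "\<And>w. w \<in> ?T \<Longrightarrow> length (flat w) \<le> length (flat w0)"
    using w0' Max_ge[OF finite_imageI[OF Tfin], of _ ?n] by auto
  have wn: "w0 \<in> normal" using w0(1) Tn by blast
  let ?G = "{g \<in> carrier E. ev g (flat w0) = g w0}"
  have "submodule ?G K E"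
    unfolding E.submodule_iff
  proof (intro conjI ballI)
    show "\<zero>\<^bsub>E\<^esub> \<in> ?G"
      using alg_hom_zero[OF E.is_nonunital_algebra F.is_nonunital_algebra ev] E.M.zero_closed
      by (simp add: free_alg_simps(1))
    show "g \<oplus>\<^bsub>E\<^esub> h \<in> ?G" if "g \<in> ?G" "h \<in> ?G" for g h
      using that alg_homE(2)[OF ev, of g h] E.M.a_closed[of g h] by (simp add: free_alg_simps(2))
    show "a \<odot>\<^bsub>E\<^esub> g \<in> ?G" if "a \<in> carrier K" "g \<in> ?G" for a g
      using that alg_homE(4)[OF ev, of a g] E.smult_closed[of a g] by (simp add: free_alg_simps(3))
  qed blast
  moreover have "free_word K ` ?T \<subseteq> ?G"
  proof (rule image_subsetI)
    fix w assume w: "w \<in> ?T"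
    then have n: "w \<in> normal" using Tn by blast
    have "ev (free_word K w) (flat w0) = free_word K w w0"
    proof (cases "w = w0")
      case True
      then show ?thesis using leads_normal[OF n] unfolding leads_def by (simp add: free_word_def)
    next
      case False
      then have "flat w0 \<noteq> flat w" using flat_inj[OF n wn] by auto
      then have "ev (free_word K w) (flat w0) = \<zero>"
        using leads_normal[OF n] w0(2)[OF w] unfolding leads_def by blast
      then show ?thesis using False by (simp add: free_word_def)
    qed
    then show "free_word K w \<in> ?G" using free_word_closed[OF normal_words[OF n]] by blast
  qed
  ultimately have "module_gen K E (free_word K ` ?T) \<subseteq> ?G" by (rule module_gen_least)
  moreover have "f \<in> module_gen K E (free_word K ` ?T)"
    by (rule free_alg_span_words[OF Tfin _ fE]) (use Tn normal_words in blast)+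
  ultimately have "f w0 = \<zero>" using 0 by (auto simp: free_alg_simps(1))
  then show False using w0(1) by simp
qed

subsection \<open>The relations\<close>

lemma evS_submodule: "submodule (ev ` S) K F"
  by (rule submodule_image[OF E.is_module F.is_module alg_hom_lin_map[OF ev] S_submodule])

lemma S_closed: "S \<subseteq> carrier E"
  by (rule E.module_gen_carrier[OF normal_closed])

lemma short_mult_S:
  assumes "i < p" "length (c i) = 2" "s \<in> S"
  shows "free_word K [i] \<otimes>\<^bsub>E\<^esub> s \<in> S"
proof (rule E.module_gen_mult_left[OF normal_closed letter_closed[OF assms(1)] S_submodule _ assms(3)])
  fix t assume "t \<in> free_word K ` normal"
  then obtain w where w: "w \<in> normal" "t = free_word K w" by blast
  then show "free_word K [i] \<otimes>\<^bsub>E\<^esub> t \<in> S"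
    using cons_word[OF assms(1) normal_words[OF w(1)]] normal_in_S[OF normal.cons[OF assms(1,2) w(1)]] by simp
qed

lemma b_in_evS:
  assumes "x \<in> V" "y \<in> V"
  shows "b x y \<in> ev ` S"
proof -
  obtain i where "i < p" "c i = [x, y]" using block_index[OF two_block[OF assms]] by blast
  then have "b x y = ev (free_word K [i])" "free_word K [i] \<in> S"
    using ev_letter normal_in_S[OF normal.single] by auto
  then show ?thesis by blast
qed

lemma b_mult_evS:
  assumes "x \<in> V" "y \<in> V" "f \<in> ev ` S"
  shows "b x y \<otimes>\<^bsub>F\<^esub> f \<in> ev ` S"
proof -
  obtain i where i: "i < p" "c i = [x, y]" using block_index[OF two_block[OF assms(1,2)]] by blast
  obtain s where s: "s \<in> S" "f = ev s" using assms(3) by blast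
  have "b x y \<otimes>\<^bsub>F\<^esub> f = ev (free_word K [i] \<otimes>\<^bsub>E\<^esub> s)"
    using alg_homE(3)[OF ev letter_closed[OF i(1)]] s S_closed ev_letter[OF i(1)] i(2) by auto
  then show ?thesis using short_mult_S[OF i(1) _ s(1)] i(2) by simp
qed

lemma b_mult_letters:
  assumes "x \<in> V" "y \<in> V" "z \<in> module_gen K F letters"
  shows "b x y \<otimes>\<^bsub>F\<^esub> z \<in> ev ` S"
proof (rule F.module_gen_mult_left[OF letters_closed b_closed[OF assms(1,2)] evS_submodule _ assms(3)])
  fix s assume "s \<in> letters"
  then obtain t where t: "t \<in> V" "s = free_word K [t]" by blast
  obtain i where "i < p" "c i = [x, y, t]" using block_index[OF three_block[OF assms(1,2) t(1)]] by blast
  then have "b x y \<otimes>\<^bsub>F\<^esub> s = ev (free_word K [i])" "free_word K [i] \<in> S"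
    using ev_letter normal_in_S[OF normal.single] t by auto
  then show "b x y \<otimes>\<^bsub>F\<^esub> s \<in> ev ` S" by blast
qed

text \<open>
  Appending a letter lengthens a last block of length two. In a last block of length three, the
  third letter and the new one are rewritten, which either starts a new block or replaces the
  third letter.
\<close>

lemma normal_mult_letter:
  assumes "w \<in> normal" "t \<in> V"
  shows "ev (free_word K w) \<otimes>\<^bsub>F\<^esub> free_word K [t] \<in> ev ` S"
  using assms(1)
proof (induction rule: normal.induct)
  case (single i)
  show ?case
  proof (cases rule: blocks_cases[OF c_block[OF single]])
    case (1 x y)
    then show ?thesis
      using b_mult_letters[OF 1(2,3) module_gen_superset[THEN subsetD]] assms(2) ev_letter[OF single] by auto
  next
    case (2 x y z)
    obtain l where l: "l \<in> module_gen K F letters" "free_word K [z, t] = b z t \<oplus>\<^bsub>F\<^esub> l"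
      using b_rewrite[OF 2(4) assms(2)] by blast
    have lc: "l \<in> carrier F" using l(1) F.module_gen_carrier[OF letters_closed] by blast
    have "ev (free_word K [i]) \<otimes>\<^bsub>F\<^esub> free_word K [t] = b x y \<otimes>\<^bsub>F\<^esub> free_word K [z, t]"
      using ev_letter[OF single] 2 assms(2) F.mult_assoc[OF b_closed free_letter_closed free_letter_closed, of x y z t]
        free_word_mult[of "[z]" V "[t]"] by simp
    also have "\<dots> = b x y \<otimes>\<^bsub>F\<^esub> b z t \<oplus>\<^bsub>F\<^esub> b x y \<otimes>\<^bsub>F\<^esub> l"
      unfolding l(2) by (rule F.mult_add_right[OF b_closed lc b_closed]) (use 2 assms(2) in auto)
    finally show ?thesis
      using F.submoduleE(5)[OF evS_submodule b_mult_evS[OF 2(2,3) b_in_evS[OF 2(4) assms(2)]]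
          b_mult_letters[OF 2(2,3) l(1)]] by simp
  qed
next
  case (cons i w)
  obtain x y where xy: "c i = [x, y]" "x \<in> V" "y \<in> V"
    using blocks_cases[OF c_block[OF cons.hyps(1)]] cons.hyps(2) by (metis length_Cons list.size(3) numeral_2_eq_2 nat.inject old.nat.distinct(2))
  have w: "w \<in> lists {..<p} - {[]}" using normal_words[OF cons.hyps(3)] .
  have wc: "ev (free_word K w) \<in> carrier F" using alg_homE(1)[OF ev free_word_closed[OF w]] .
  have "ev (free_word K (i # w)) \<otimes>\<^bsub>F\<^esub> free_word K [t] = b x y \<otimes>\<^bsub>F\<^esub> (ev (free_word K w) \<otimes>\<^bsub>F\<^esub> free_word K [t])"
    using ev_cons[OF cons.hyps(1) w] xy F.mult_assoc[OF b_closed wc free_letter_closed, of x y t] assms(2) by simp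
  then show ?case using b_mult_evS[OF xy(2,3) cons.IH] by simp
qed

lemma span_evS_letters: "module_gen K F (ev ` S \<union> letters) = carrier F"
proof -
  let ?W = "module_gen K F (ev ` S \<union> letters)"
  have evSc: "ev ` S \<subseteq> carrier F" using evS_submodule F.submoduleE(1) by blast
  have c: "ev ` S \<union> letters \<subseteq> carrier F" using evSc letters_closed by blast
  have W: "submodule ?W K F" by (rule F.module_gen_submodule[OF c])
  have sup: "ev ` S \<union> letters \<subseteq> ?W" by (rule module_gen_superset)
  have LW: "module_gen K F letters \<subseteq> ?W" by (rule module_gen_mono) blast
  have evSW: "ev s \<otimes>\<^bsub>F\<^esub> free_word K [t] \<in> ?W" if s: "s \<in> S" and t: "t \<in> V" for s t
  proof (rule lin_map_module_gen[OF E.is_module F.is_module _ normal_closed W _ s])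
    show "(\<lambda>s. ev s \<otimes>\<^bsub>F\<^esub> free_word K [t]) \<in> lin_map K E F"
      by (rule lin_map_compose[OF alg_hom_lin_map[OF ev] F.right_mult_lin_map[OF free_letter_closed[OF t]]])
    fix s assume "s \<in> free_word K ` normal"
    then show "ev s \<otimes>\<^bsub>F\<^esub> free_word K [t] \<in> ?W" using normal_mult_letter[OF _ t] sup by blast
  qed
  show ?thesis
  proof (rule F.right_closed_submodule_eq_carrier[OF letters_closed free_alg_generated W])
    show "letters \<subseteq> ?W" using sup by blast
    fix w s assume w: "w \<in> ?W" and s: "s \<in> letters"
    obtain t where t: "t \<in> V" "s = free_word K [t]" using s by blast
    show "w \<otimes>\<^bsub>F\<^esub> s \<in> ?W"
    proof (rule F.module_gen_mult_right[OF c _ W _ w])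
      show "s \<in> carrier F" using s letters_closed by blast
      fix a assume "a \<in> ev ` S \<union> letters"
      then show "a \<otimes>\<^bsub>F\<^esub> s \<in> ?W"
      proof
        assume "a \<in> ev ` S"
        then show ?thesis using evSW t by blast
      next
        assume "a \<in> letters"
        then obtain x where x: "x \<in> V" "a = free_word K [x]" by blast
        obtain l where l: "l \<in> module_gen K F letters" "free_word K [x, t] = b x t \<oplus>\<^bsub>F\<^esub> l"
          using b_rewrite[OF x(1) t(1)] by blast
        have "a \<otimes>\<^bsub>F\<^esub> s = b x t \<oplus>\<^bsub>F\<^esub> l"
          using free_word_mult[of "[x]" V "[t]"] x t l(2) by simp
        moreover have "b x t \<in> ?W" "l \<in> ?W" using b_in_evS[OF x(1) t(1)] sup l(1) LW by blast+
        ultimately show ?thesis using F.submoduleE(5)[OF W] by simp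
      qed
    qed
  qed
qed

text \<open>
  For a block \<open>[x, y, z]\<close>, the letter \<open>z\<close> is moved to the second factor. The result splits into
  normal words and letters, and multiplication by \<open>b x y\<close> turns both kinds into normal words.
\<close>

lemma relation_exists:
  assumes i: "i < p" and j: "j < p"
  shows "\<exists>r\<in>S. ev r = ev (free_word K [i, j])"
proof (cases rule: blocks_cases[OF c_block[OF i]])
  case (1 x y)
  then have "[i, j] \<in> normal" using i j by (auto intro: normal.intros)
  then show ?thesis using normal_in_S by blast
next
  case (2 x y z)
  let ?f = "free_word K [z] \<otimes>\<^bsub>F\<^esub> block_val (c j)"
  have jc: "block_val (c j) \<in> carrier F" using block_val_closed[OF c_block[OF j]] .
  have zc: "free_word K [z] \<in> carrier F" using free_letter_closed[OF 2(4)] .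
  have "?f \<in> module_gen K F (ev ` S \<union> letters)"
    unfolding span_evS_letters using F.mult_closed[OF zc jc] .
  then obtain s l where sl: "s \<in> ev ` S" "l \<in> module_gen K F letters" "?f = s \<oplus>\<^bsub>F\<^esub> l"
    using F.module_gen_Un_decomp[OF evS_submodule letters_closed] by blast
  have sc: "s \<in> carrier F" "l \<in> carrier F"
    using sl F.submoduleE(1)[OF evS_submodule] F.module_gen_carrier[OF letters_closed] by auto
  have "ev (free_word K [i, j]) = b x y \<otimes>\<^bsub>F\<^esub> ?f"
    using ev_cons[OF i, of "[j]"] j ev_letter[OF j] 2 F.mult_assoc[OF b_closed zc jc, of x y] by simp
  also have "\<dots> = b x y \<otimes>\<^bsub>F\<^esub> s \<oplus>\<^bsub>F\<^esub> b x y \<otimes>\<^bsub>F\<^esub> l"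
    unfolding sl(3) by (rule F.mult_add_right[OF sc b_closed[OF 2(2,3)]])
  also have "\<dots> \<in> ev ` S"
    by (rule F.submoduleE(5)[OF evS_submodule b_mult_evS[OF 2(2,3) sl(1)] b_mult_letters[OF 2(2,3) sl(2)]])
  finally show ?thesis by auto
qed

text \<open>
  Every product of two generators is rewritten into a combination of normal words, and these
  relations already present the image of \<open>ev\<close>: multiplying a normal word by a generator on the
  left, the rewriting consumes the word from the left.
\<close>

lemma fin_gen_ideal_ker_ev: "fin_gen_ideal K E (alg_ker E F ev)"
proof -
  have "\<exists>r. \<forall>i j. i < p \<longrightarrow> j < p \<longrightarrow> r i j \<in> S \<and> ev (r i j) = ev (free_word K [i, j])"
    using relation_exists by metis
  then obtain r where r: "\<And>i j. i < p \<Longrightarrow> j < p \<Longrightarrow> r i j \<in> S \<and> ev (r i j) = ev (free_word K [i, j])"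
    by blast
  define Z where "Z = (\<lambda>(i, j). free_word K [i, j] \<ominus>\<^bsub>E\<^esub> r i j) ` ({..<p} \<times> {..<p})"
  have wc: "free_word K [i, j] \<in> carrier E" if "i < p" "j < p" for i j
    using free_word_closed[of "[i, j]" "{..<p}"] that by simp
  have Zker: "Z \<subseteq> alg_ker E F ev"
  proof -
    have "free_word K [i, j] \<ominus>\<^bsub>E\<^esub> r i j \<in> alg_ker E F ev" if ij: "i < p" "j < p" for i j
    proof (rule fibre_difference_in_ker[OF E.is_nonunital_algebra F.is_nonunital_algebra ev wc[OF ij]])
      show "r i j \<in> carrier E" "ev (free_word K [i, j]) = ev (r i j)" using r[OF ij] S_closed by auto
    qed
    then show ?thesis unfolding Z_def by (intro image_subsetI) auto
  qed
  then have Zc: "Z \<subseteq> carrier E" by blast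
  let ?I = "ideal_gen K E Z"
  have I: "alg_ideal K E ?I" by (rule E.ideal_gen_alg_ideal[OF Zc])
  have Ism: "submodule ?I K E" by (rule alg_ideal_submodule[OF I])
  have Ic: "?I \<subseteq> carrier E" by (rule E.alg_ideal_subset[OF I])
  have Iker: "?I \<subseteq> alg_ker E F ev"
    by (rule ideal_gen_least[OF alg_ker_ideal[OF E.is_nonunital_algebra F.is_nonunital_algebra ev] Zker])
  let ?W = "module_gen K E (S \<union> ?I)"
  have SI: "S \<union> ?I \<subseteq> carrier E" using S_closed Ic by blast
  have W: "submodule ?W K E" by (rule E.module_gen_submodule[OF SI])
  have sup: "S \<union> ?I \<subseteq> ?W" by (rule module_gen_superset)
  have short: "free_word K [i] \<otimes>\<^bsub>E\<^esub> w \<in> ?W" if i: "i < p" "length (c i) = 2" and w: "w \<in> ?W" for i w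
  proof (rule E.module_gen_mult_left[OF SI letter_closed[OF i(1)] W _ w])
    fix s assume "s \<in> S \<union> ?I"
    then have "free_word K [i] \<otimes>\<^bsub>E\<^esub> s \<in> S \<union> ?I"
      using short_mult_S[OF i] I letter_closed[OF i(1)] unfolding alg_ideal_def by blast
    then show "free_word K [i] \<otimes>\<^bsub>E\<^esub> s \<in> ?W" using sup by blast
  qed
  have pair: "free_word K [i, j] \<otimes>\<^bsub>E\<^esub> g \<in> ?W"
    if ij: "i < p" "j < p" and g: "g \<in> carrier E" and rg: "r i j \<otimes>\<^bsub>E\<^esub> g \<in> ?W" for i j g
  proof -
    have rc: "r i j \<in> carrier E" using r[OF ij] S_closed by blast
    let ?d = "free_word K [i, j] \<ominus>\<^bsub>E\<^esub> r i j"
    have d: "?d \<in> ?I" by (rule ideal_gen_superset[THEN subsetD]) (use ij in \<open>auto simp: Z_def\<close>)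
    have "free_word K [i, j] \<otimes>\<^bsub>E\<^esub> g = ?d \<otimes>\<^bsub>E\<^esub> g \<oplus>\<^bsub>E\<^esub> r i j \<otimes>\<^bsub>E\<^esub> g"
      using E.mult_add_left[of ?d "r i j" g] E.minus_add_cancel[OF wc[OF ij] rc] d Ic rc g by auto
    moreover have "?d \<otimes>\<^bsub>E\<^esub> g \<in> ?W" using d I g sup unfolding alg_ideal_def by blast
    ultimately show ?thesis using E.submoduleE(5)[OF W _ rg] by simp
  qed
  have cons: "free_word K (i # w) \<in> ?W" if "w \<in> normal" "i < p" for i w
    using that
  proof (induction arbitrary: i rule: normal.induct)
    case (single j)
    let ?d = "free_word K [i, j] \<ominus>\<^bsub>E\<^esub> r i j"
    have "?d \<in> ?I"
      by (rule ideal_gen_superset[THEN subsetD]) (use single in \<open>auto simp: Z_def\<close>)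
    then show ?case
      using E.submodule_minus_cancel[OF W wc, of i j "r i j"] r[of i j] single sup by blast
  next
    case (cons j w)
    have w: "w \<in> lists {..<p} - {[]}" using normal_words[OF cons.hyps(3)] .
    have wE: "free_word K w \<in> carrier E" using free_word_closed[OF w] .
    have append: "free_word K (v @ w) \<in> ?W" if "v \<in> normal" for v
      using that
    proof (induction rule: normal.induct)
      case (single k)
      then show ?case using cons.IH by simp
    next
      case (cons k v)
      have "v @ w \<in> lists {..<p} - {[]}" using normal_words[OF cons.hyps(3)] w by simp
      then show ?case using short[OF cons.hyps(1,2) cons.IH] cons_word[OF cons.hyps(1)] by simp
    qed
    have "r i j \<otimes>\<^bsub>E\<^esub> free_word K w \<in> ?W"
    proof (rule E.module_gen_mult_right[OF normal_closed wE W])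
      show "r i j \<in> S" using r cons by blast
      fix s assume "s \<in> free_word K ` normal"
      then obtain v where v: "v \<in> normal" "s = free_word K v" by blast
      then show "s \<otimes>\<^bsub>E\<^esub> free_word K w \<in> ?W"
        using append[OF v(1)] free_word_mult[OF normal_words[OF v(1)] w] by simp
    qed
    then have "free_word K [i, j] \<otimes>\<^bsub>E\<^esub> free_word K w \<in> ?W" using pair[OF _ _ wE] cons by blast
    then show ?case using free_word_mult[of "[i, j]" "{..<p}" w] w cons by simp
  qed
  have letters: "(\<lambda>i. free_word K [i]) ` {..<p} \<subseteq> carrier E" using letter_closed by auto
  have Wall: "?W = carrier E"
  proof (rule E.left_closed_submodule_eq_carrier[OF letters free_alg_generated W])
    show "(\<lambda>i. free_word K [i]) ` {..<p} \<subseteq> ?W"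
      using normal_in_S[OF normal.single] sup by blast
    fix w s assume w: "w \<in> ?W" and s: "s \<in> (\<lambda>i. free_word K [i]) ` {..<p}"
    obtain i where i: "i < p" "s = free_word K [i]" using s by blast
    have sc: "s \<in> carrier E" using s letters by blast
    show "s \<otimes>\<^bsub>E\<^esub> w \<in> ?W"
    proof (rule E.module_gen_mult_left[OF SI sc W _ w])
      fix t assume "t \<in> S \<union> ?I"
      then show "s \<otimes>\<^bsub>E\<^esub> t \<in> ?W"
      proof
        assume t: "t \<in> S"
        show ?thesis
        proof (rule E.module_gen_mult_left[OF normal_closed sc W _ t])
          fix a assume "a \<in> free_word K ` normal"
          then obtain v where v: "v \<in> normal" "a = free_word K v" by blast
          then show "s \<otimes>\<^bsub>E\<^esub> a \<in> ?W"
            using cons[OF v(1) i(1)] cons_word[OF i(1) normal_words[OF v(1)]] i(2) by simp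
        qed
      next
        assume "t \<in> ?I"
        then show ?thesis using I sc sup unfolding alg_ideal_def by blast
      qed
    qed
  qed
  have "alg_ker E F ev \<subseteq> ?I"
  proof
    fix x assume x: "x \<in> alg_ker E F ev"
    then have "x \<in> module_gen K E (S \<union> ?I)" using Wall by blast
    then obtain s d where sd: "s \<in> S" "d \<in> ?I" "x = s \<oplus>\<^bsub>E\<^esub> d"
      unfolding E.module_gen_Un_submodules[OF S_submodule Ism] by blast
    have cc: "s \<in> carrier E" "d \<in> carrier E" "ev d = \<zero>\<^bsub>F\<^esub>" using sd S_closed Iker by auto
    have "ev s = \<zero>\<^bsub>F\<^esub>" using x sd(3) cc alg_homE(2)[OF ev cc(1,2)] alg_homE(1)[OF ev cc(1)] by simp
    then have "s = \<zero>\<^bsub>E\<^esub>" by (rule ev_inj_on_S[OF sd(1)])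
    then show "x \<in> ?I" using sd cc by simp
  qed
  then have "?I = alg_ker E F ev" using Iker by blast
  then show ?thesis unfolding fin_gen_ideal_def using Zc by (intro exI[of _ Z]) (auto simp: Z_def)
qed

end

text \<open>
  A one-sided ideal inside \<open>L\<close> is not free as a module in general. The one generated by the
  elements \<open>b x y\<close> is: it is complemented by the span of the letters, whatever the module
  structure of the quotient by \<open>L\<close>, and this makes the presentation work over arbitrary scalars.
\<close>

theorem fin_pres_subalg_of_free_alg_ideal:
  fixes K :: "('k, 'm) ring_scheme" and V :: "'x set"
  assumes K: "cring K" and V: "finite V" and L: "alg_ideal K (free_alg K V) L"
    and span: "module_gen K (free_alg K V) (L \<union> (\<lambda>x. free_word K [x]) ` V) = carrier (free_alg K V)"
  obtains H where "subalg K (free_alg K V) H" "H \<subseteq> L"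
    "fin_pres_alg K ((free_alg K V)\<lparr>carrier := H\<rparr>)"
    "module_gen K (free_alg K V) (H \<union> (\<lambda>x. free_word K [x]) ` V) = carrier (free_alg K V)"
proof -
  interpret K: cring K by fact
  let ?F = "free_alg K V" and ?L = "(\<lambda>x. free_word K [x]) ` V"
  interpret F: nonunital_algebra K ?F by (rule K.free_alg_algebra)
  have Lc: "?L \<subseteq> carrier ?F" by (auto intro: K.free_letter_closed)
  have Lsm: "submodule L K ?F" by (rule alg_ideal_submodule[OF L])
  have "\<exists>l\<in>L. \<exists>z\<in>module_gen K ?F ?L. free_word K [x, y] = l \<oplus>\<^bsub>?F\<^esub> z" if xy: "x \<in> V" "y \<in> V" for x y
  proof -
    have "free_word K [x, y] \<in> module_gen K ?F (L \<union> ?L)"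
      unfolding span by (rule K.free_word_closed) (use xy in simp)
    then show ?thesis using F.module_gen_Un_decomp[OF Lsm Lc] by blast
  qed
  then have "\<exists>b. \<forall>x y. x \<in> V \<longrightarrow> y \<in> V \<longrightarrow>
      b x y \<in> L \<and> (\<exists>z\<in>module_gen K ?F ?L. free_word K [x, y] = b x y \<oplus>\<^bsub>?F\<^esub> z)"
    by metis
  then obtain b where b: "\<And>x y. x \<in> V \<Longrightarrow> y \<in> V \<Longrightarrow>
      b x y \<in> L \<and> (\<exists>z\<in>module_gen K ?F ?L. free_word K [x, y] = b x y \<oplus>\<^bsub>?F\<^esub> z)"
    by blast
  interpret B: block_rewriting K V b
    by unfold_locales (use V b F.alg_ideal_subset[OF L] in blast)+
  obtain c where c: "bij_betw c {..<card B.blocks} B.blocks"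
    using ex_bij_betw_nat_finite[OF B.finite_blocks] by (auto simp: atLeast0LessThan)
  let ?p = "card B.blocks" and ?g = "\<lambda>i. B.block_val (c i)"
  have g: "?g \<in> {..<?p} \<rightarrow> carrier ?F" using B.block_val_closed bij_betwE[OF c] by blast
  then obtain ev where ev: "ev \<in> alg_hom K (free_alg K {..<?p}) ?F"
    "\<And>i. i \<in> {..<?p} \<Longrightarrow> ev (free_word K [i]) = ?g i"
    by (rule F.free_alg_hom_exists) blast
  interpret N: numbered_blocks K V b ?p c ev
    by unfold_locales (use c ev in auto)
  let ?E = "free_alg K {..<?p}"
  let ?H = "ev ` carrier ?E"
  have H: "subalg K ?F ?H"
    by (rule subalg_image[OF N.E.is_nonunital_algebra F.is_nonunital_algebra ev(1) N.E.subalg_carrier])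
  have HL: "?H \<subseteq> L"
  proof -
    have "?H = subalg_gen K ?F (ev ` (\<lambda>i. free_word K [i]) ` {..<?p})"
      using image_subalg_gen[OF N.E.is_nonunital_algebra F.is_nonunital_algebra ev(1), of "(\<lambda>i. free_word K [i]) ` {..<?p}"]
        K.free_alg_generated[of "{..<?p}"] N.letter_closed by auto
    also have "\<dots> \<subseteq> L"
    proof (rule subalg_gen_least[OF F.alg_ideal_imp_subalg[OF L]])
      have "B.block_val u \<in> L" if "u \<in> B.blocks" for u
        using that
      proof (cases rule: B.blocks_cases)
        case (two x y)
        then show ?thesis using b by simp
      next
        case (three x y z)
        then show ?thesis using b[of x y] L K.free_letter_closed[of z V] unfolding alg_ideal_def by simp
      qed
      then show "ev ` (\<lambda>i. free_word K [i]) ` {..<?p} \<subseteq> L" using ev(2) bij_betwE[OF c] by auto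
    qed
    finally show ?thesis .
  qed
  have "nonunital_algebra K (?F\<lparr>carrier := ?H\<rparr>)" by (rule F.subalg_algebra[OF H])
  moreover have "ev \<in> alg_hom K ?E (?F\<lparr>carrier := ?H\<rparr>)"
    using alg_hom_restrict[OF ev(1), of "carrier ?E" ?H] by simp
  moreover have "fin_gen_ideal K ?E (alg_ker ?E (?F\<lparr>carrier := ?H\<rparr>) ev)"
    using N.fin_gen_ideal_ker_ev by simp
  ultimately have fp: "fin_pres_alg K (?F\<lparr>carrier := ?H\<rparr>)"
    unfolding fin_pres_alg_iff[OF \<open>nonunital_algebra K (?F\<lparr>carrier := ?H\<rparr>)\<close>]
    by (intro exI[of _ ?p] exI[of _ ev]) simp
  have "ev ` N.S \<union> ?L \<subseteq> ?H \<union> ?L" using N.S_closed by blast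
  then have "carrier ?F \<subseteq> module_gen K ?F (?H \<union> ?L)"
    using module_gen_mono N.span_evS_letters by metis
  moreover have "module_gen K ?F (?H \<union> ?L) \<subseteq> carrier ?F"
    by (rule F.module_gen_carrier) (use F.subalg_subset[OF H] Lc in blast)
  ultimately show thesis using that[OF H HL fp] by blast
qed

section \<open>Passing to subalgebras that contain an ideal of finite corank\<close>

context nonunital_algebra
begin

text \<open>
  If \<open>A\<close> is generated as an algebra by a finite set \<open>X\<close> that also spans it modulo both ideals, the
  words of length at most three in \<open>X\<close> span it modulo the product of the ideals: a word of length
  four is cut in the middle, and each half is congruent to a combination of letters modulo one of
  the ideals.
\<close>

lemma finite_corank_product:
  assumes fg: "fin_gen_alg K A" and L1: "alg_ideal K A L1" "finite_corank K A L1"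
    and L2: "alg_ideal K A L2" "finite_corank K A L2"
    and J: "submodule J K A" and prod: "\<And>x y. x \<in> L1 \<Longrightarrow> y \<in> L2 \<Longrightarrow> x \<otimes>\<^bsub>A\<^esub> y \<in> J"
    and J_right: "\<And>x a. x \<in> J \<Longrightarrow> a \<in> carrier A \<Longrightarrow> x \<otimes>\<^bsub>A\<^esub> a \<in> J"
  shows "finite_corank K A J"
proof -
  obtain S where S: "S \<subseteq> carrier A" "finite S" "subalg_gen K A S = carrier A"
    using fg unfolding fin_gen_alg_def by blast
  obtain T1 where T1: "finite T1" "T1 \<subseteq> carrier A" "module_gen K A (L1 \<union> T1) = carrier A"
    using finite_corank_span[OF L1(2)] by blast
  obtain T2 where T2: "finite T2" "T2 \<subseteq> carrier A" "module_gen K A (L2 \<union> T2) = carrier A"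
    using finite_corank_span[OF L2(2)] by blast
  define X where "X = S \<union> T1 \<union> T2"
  have X: "finite X" "X \<subseteq> carrier A" using S T1 T2 X_def by auto
  have gen: "subalg_gen K A X = carrier A"
    using subalg_gen_mono[of S X K A] S(3) subalg_subset[OF subalg_gen_subalg[OF X(2)]] X_def by blast
  have L1sm: "submodule L1 K A" and L2sm: "submodule L2 K A"
    using alg_ideal_submodule L1(1) L2(1) by auto
  have L1c: "L1 \<subseteq> carrier A" and L2c: "L2 \<subseteq> carrier A" using alg_ideal_subset L1(1) L2(1) by auto
  let ?X = "module_gen K A X"
  have Xc: "?X \<subseteq> carrier A" by (rule module_gen_carrier[OF X(2)])
  have dec1: "\<exists>l\<in>L1. \<exists>s\<in>?X. a = l \<oplus>\<^bsub>A\<^esub> s" if "a \<in> carrier A" for a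
  proof -
    have "a \<in> module_gen K A (L1 \<union> X)"
      using that T1(3) module_gen_mono[of "L1 \<union> T1" "L1 \<union> X" K A] X_def by blast
    then show ?thesis using module_gen_Un_decomp[OF L1sm X(2)] by blast
  qed
  have dec2: "\<exists>l\<in>L2. \<exists>s\<in>?X. a = l \<oplus>\<^bsub>A\<^esub> s" if "a \<in> carrier A" for a
  proof -
    have "a \<in> module_gen K A (L2 \<union> X)"
      using that T2(3) module_gen_mono[of "L2 \<union> T2" "L2 \<union> X" K A] X_def by blast
    then show ?thesis using module_gen_Un_decomp[OF L2sm X(2)] by blast
  qed
  define X2 where "X2 = (\<lambda>(x, y). x \<otimes>\<^bsub>A\<^esub> y) ` (X \<times> X)"
  define X3 where "X3 = (\<lambda>(x, y). x \<otimes>\<^bsub>A\<^esub> y) ` (X2 \<times> X)"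
  have X2: "finite X2" "X2 \<subseteq> carrier A" unfolding X2_def using X by (auto intro!: mult_closed)
  have X3: "finite X3" "X3 \<subseteq> carrier A" unfolding X3_def using X X2 by (auto intro!: mult_closed)
  have X2I: "x \<otimes>\<^bsub>A\<^esub> y \<in> X2" if "x \<in> X" "y \<in> X" for x y using that X2_def by blast
  have X3I: "x \<otimes>\<^bsub>A\<^esub> y \<in> X3" if "x \<in> X2" "y \<in> X" for x y using that X3_def by blast
  let ?G = "J \<union> (X \<union> X2 \<union> X3)" 
  let ?W = "module_gen K A ?G"
  have Gc: "?G \<subseteq> carrier A" using submoduleE(1)[OF J] X X2 X3 by blast
  have W: "submodule ?W K A" by (rule module_gen_submodule[OF Gc])
  have sup: "?G \<subseteq> ?W" by (rule module_gen_superset)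
  have four: "x \<otimes>\<^bsub>A\<^esub> y \<otimes>\<^bsub>A\<^esub> z \<otimes>\<^bsub>A\<^esub> w \<in> ?W" if m: "x \<in> X" "y \<in> X" "z \<in> X" "w \<in> X" for x y z w
  proof -
    have c: "x \<in> carrier A" "y \<in> carrier A" "z \<in> carrier A" "w \<in> carrier A" using m X by auto
    note cc = mult_closed[OF c(1,2)] mult_closed[OF c(3,4)]
    obtain l s where ls: "l \<in> L1" "s \<in> ?X" "x \<otimes>\<^bsub>A\<^esub> y = l \<oplus>\<^bsub>A\<^esub> s" using dec1[OF cc(1)] by blast
    obtain l' s' where ls': "l' \<in> L2" "s' \<in> ?X" "z \<otimes>\<^bsub>A\<^esub> w = l' \<oplus>\<^bsub>A\<^esub> s'" using dec2[OF cc(2)] by blast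
    have lc: "l \<in> carrier A" "s \<in> carrier A" "l' \<in> carrier A" "s' \<in> carrier A"
      using ls ls' L1c L2c Xc by auto
    have s_zw: "s \<otimes>\<^bsub>A\<^esub> (z \<otimes>\<^bsub>A\<^esub> w) \<in> ?W"
    proof (rule module_gen_mult_right[OF X(2) cc(2) W _ ls(2)])
      fix u assume u: "u \<in> X"
      then have "u \<otimes>\<^bsub>A\<^esub> (z \<otimes>\<^bsub>A\<^esub> w) = u \<otimes>\<^bsub>A\<^esub> z \<otimes>\<^bsub>A\<^esub> w" using c X mult_assoc by auto
      then show "u \<otimes>\<^bsub>A\<^esub> (z \<otimes>\<^bsub>A\<^esub> w) \<in> ?W" using X3I[OF X2I[OF u m(3)] m(4)] sup by auto
    qed
    have ss: "s \<otimes>\<^bsub>A\<^esub> s' \<in> ?W"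
    proof (rule module_gen_mult_right[OF X(2) lc(4) W _ ls(2)])
      fix u assume u: "u \<in> X"
      show "u \<otimes>\<^bsub>A\<^esub> s' \<in> ?W"
        by (rule module_gen_mult_left[OF X(2) _ W _ ls'(2)]) (use u X X2I sup in blast)+
    qed
    have "s \<otimes>\<^bsub>A\<^esub> l' \<oplus>\<^bsub>A\<^esub> s \<otimes>\<^bsub>A\<^esub> s' \<in> ?W"
      using s_zw ls'(3) mult_add_right[OF lc(3,4,2)] by simp
    then have sl: "s \<otimes>\<^bsub>A\<^esub> l' \<in> ?W"
      by (rule submodule_add_cancel[OF W mult_closed[OF lc(2,3)] ss])
    have ll: "l \<otimes>\<^bsub>A\<^esub> l' \<in> ?W" using prod[OF ls(1) ls'(1)] sup by blast
    have "x \<otimes>\<^bsub>A\<^esub> y \<otimes>\<^bsub>A\<^esub> l' \<in> ?W"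
      using submoduleE(5)[OF W ll sl] ls(3) mult_add_left[OF lc(1,2,3)] by simp
    moreover have "x \<otimes>\<^bsub>A\<^esub> y \<otimes>\<^bsub>A\<^esub> s' \<in> ?W"
      by (rule module_gen_mult_left[OF X(2) cc(1) W _ ls'(2)]) (use X3I[OF X2I[OF m(1,2)]] sup in blast)
    ultimately have "x \<otimes>\<^bsub>A\<^esub> y \<otimes>\<^bsub>A\<^esub> (z \<otimes>\<^bsub>A\<^esub> w) \<in> ?W"
      using submoduleE(5)[OF W] ls'(3) mult_add_right[OF lc(3,4) cc(1)] by simp
    then show ?thesis using mult_assoc[OF cc(1) c(3,4)] by simp
  qed
  have "?W = carrier A"
  proof (rule right_closed_submodule_eq_carrier[OF X(2) gen W])
    show "X \<subseteq> ?W" using sup by blast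
    fix w s assume w: "w \<in> ?W" and s: "s \<in> X"
    have sc: "s \<in> carrier A" using s X by blast
    show "w \<otimes>\<^bsub>A\<^esub> s \<in> ?W"
    proof (rule module_gen_mult_right[OF Gc sc W _ w])
      fix u assume "u \<in> ?G"
      then consider (J) "u \<in> J" | (X) "u \<in> X" | (X2) "u \<in> X2" | (X3) "u \<in> X3" by blast
      then show "u \<otimes>\<^bsub>A\<^esub> s \<in> ?W"
      proof cases
        case J
        then show ?thesis using J_right[OF _ sc] sup by blast
      next
        case X
        then show ?thesis using X2I[OF _ s] sup by blast
      next
        case X2
        then show ?thesis using X3I[OF _ s] sup by blast
      next
        case X3
        then obtain q z where q: "q \<in> X2" "z \<in> X" "u = q \<otimes>\<^bsub>A\<^esub> z"
          unfolding X3_def by auto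
        then obtain x y where "x \<in> X" "y \<in> X" "q = x \<otimes>\<^bsub>A\<^esub> y" unfolding X2_def by auto
        with q show ?thesis using four[OF _ _ _ s] by simp
      qed
    qed
  qed
  then show ?thesis
    by (intro finite_corankI[OF J, of "X \<union> X2 \<union> X3"]) (use X X2 X3 in auto)
qed

text \<open>
  Multiplying the generators of \<open>I\<close> from both sides by vectors that span \<open>A\<close> together with \<open>J\<close>
  replaces the multiplications by \<open>A\<close> by multiplications by \<open>J\<close>.
\<close>

lemma fin_gen_ideal_restrict:
  assumes J: "alg_ideal K A J" "finite_corank K A J" and I: "fin_gen_ideal K A I" "I \<subseteq> J"
  shows "fin_gen_ideal K (A\<lparr>carrier := J\<rparr>) I"
proof -
  obtain X where X: "finite X" "X \<subseteq> carrier A" "module_gen K A (J \<union> X) = carrier A"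
    using finite_corank_span[OF J(2)] by blast
  obtain R where R: "R \<subseteq> carrier A" "finite R" "ideal_gen K A R = I"
    using I(1) unfolding fin_gen_ideal_def by blast
  have Iid: "alg_ideal K A I" using ideal_gen_alg_ideal[OF R(1)] R(3) by simp
  have Jsub: "subalg K A J" by (rule alg_ideal_imp_subalg[OF J(1)])
  have Jc: "J \<subseteq> carrier A" by (rule alg_ideal_subset[OF J(1)])
  let ?AJ = "A\<lparr>carrier := J\<rparr>"
  interpret AJ: nonunital_algebra K ?AJ by (rule subalg_algebra[OF Jsub])
  define RX where "RX = R \<union> (\<lambda>(r, x). r \<otimes>\<^bsub>A\<^esub> x) ` (R \<times> X)"
  define Z where "Z = RX \<union> (\<lambda>(x, r). x \<otimes>\<^bsub>A\<^esub> r) ` (X \<times> RX)"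
  have RI: "R \<subseteq> I" using R(3) ideal_gen_superset[of R K A] by simp
  have mI: "a \<otimes>\<^bsub>A\<^esub> x \<in> I" "x \<otimes>\<^bsub>A\<^esub> a \<in> I" if "x \<in> I" "a \<in> carrier A" for a x
    using Iid that unfolding alg_ideal_def by auto
  have RXI: "RX \<subseteq> I" unfolding RX_def using RI X(2) by (auto intro!: mI(2))
  have ZI: "Z \<subseteq> I" unfolding Z_def using RXI X(2) by (auto intro!: mI(1))
  have ZJ: "Z \<subseteq> J" using ZI I(2) by blast
  let ?D = "ideal_gen K ?AJ Z"
  have D: "alg_ideal K ?AJ ?D" by (rule AJ.ideal_gen_alg_ideal) (use ZJ in simp)
  have DJ: "?D \<subseteq> J" using AJ.alg_ideal_subset[OF D] by simp
  have Dsm: "submodule ?D K A" using alg_ideal_submodule[OF D] submodule_restrict_iff[OF Jsub] by blast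
  have DD: "j \<otimes>\<^bsub>A\<^esub> x \<in> ?D" "x \<otimes>\<^bsub>A\<^esub> j \<in> ?D" if "x \<in> ?D" "j \<in> J" for j x
    using D that unfolding alg_ideal_def by auto
  have ZD: "Z \<subseteq> ?D" by (rule ideal_gen_superset)
  have Xmul: "a \<otimes>\<^bsub>A\<^esub> r \<in> ?D" if a: "a \<in> carrier A" and r: "r \<in> RX" for a r
  proof (rule module_gen_mult_right[of "J \<union> X"])
    show "J \<union> X \<subseteq> carrier A" "r \<in> carrier A" "a \<in> module_gen K A (J \<union> X)"
      using Jc X r RXI I(2) a by auto
    show "submodule ?D K A" by (rule Dsm)
    fix s assume "s \<in> J \<union> X"
    then show "s \<otimes>\<^bsub>A\<^esub> r \<in> ?D"
    proof
      assume "s \<in> J"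
      moreover have "r \<in> ?D" using r ZD Z_def by blast
      ultimately show ?thesis using DD by blast
    next
      assume "s \<in> X"
      then show ?thesis using r ZD unfolding Z_def by blast
    qed
  qed
  have Rmul: "r \<otimes>\<^bsub>A\<^esub> a \<in> ?D \<and> (\<forall>x\<in>X. x \<otimes>\<^bsub>A\<^esub> r \<otimes>\<^bsub>A\<^esub> a \<in> ?D)" if a: "a \<in> carrier A" and r: "r \<in> R" for a r
  proof -
    have c: "J \<union> X \<subseteq> carrier A" "a \<in> module_gen K A (J \<union> X)" "r \<in> carrier A"
      using Jc X a r R(1) by auto
    have rRX: "r \<in> RX" using r RX_def by blast
    have rxRX: "r \<otimes>\<^bsub>A\<^esub> y \<in> RX" if "y \<in> X" for y using r that RX_def by blast
    have 1: "r \<otimes>\<^bsub>A\<^esub> s \<in> ?D" if "s \<in> J \<union> X" for s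
      using that rRX rxRX[of s] DD(2)[of r s] ZD Z_def by blast
    have 2: "x \<otimes>\<^bsub>A\<^esub> r \<otimes>\<^bsub>A\<^esub> s \<in> ?D" if "s \<in> J \<union> X" "x \<in> X" for s x
    proof (cases "s \<in> J")
      case True
      have "x \<otimes>\<^bsub>A\<^esub> r \<in> ?D" using Xmul[OF _ rRX] that(2) X(2) by blast
      then show ?thesis using DD(2) True by blast
    next
      case False
      then have s: "s \<in> X" using that by blast
      then have "x \<otimes>\<^bsub>A\<^esub> (r \<otimes>\<^bsub>A\<^esub> s) \<in> ?D" using Xmul[OF _ rxRX] that(2) X(2) by blast
      moreover have "x \<otimes>\<^bsub>A\<^esub> r \<otimes>\<^bsub>A\<^esub> s = x \<otimes>\<^bsub>A\<^esub> (r \<otimes>\<^bsub>A\<^esub> s)"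
        by (rule mult_assoc) (use that(2) s X(2) c(3) in auto)
      ultimately show ?thesis by simp
    qed
    have "x \<otimes>\<^bsub>A\<^esub> r \<otimes>\<^bsub>A\<^esub> a \<in> ?D" if x: "x \<in> X" for x
      by (rule module_gen_mult_left[OF c(1) mult_closed[OF _ c(3)] Dsm 2[OF _ x] c(2)])
        (use x X(2) in blast)+
    moreover have "r \<otimes>\<^bsub>A\<^esub> a \<in> ?D" by (rule module_gen_mult_left[OF c(1,3) Dsm 1 c(2)])
    ultimately show ?thesis by blast
  qed
  let ?Q = "{d \<in> ?D. \<forall>a\<in>carrier A. a \<otimes>\<^bsub>A\<^esub> d \<in> ?D \<and> d \<otimes>\<^bsub>A\<^esub> a \<in> ?D}"
  have DC: "?D \<subseteq> carrier A" using DJ Jc by blast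
  have "alg_ideal K ?AJ ?Q"
    unfolding AJ.alg_ideal_iff
  proof (intro conjI ballI)
    note Dcl = Dsm[unfolded submodule_iff]
    show "?Q \<subseteq> carrier ?AJ" using DJ by auto
    show "\<zero>\<^bsub>?AJ\<^esub> \<in> ?Q" using Dcl by (simp add: mult_zero_left mult_zero_right)
    show "x \<oplus>\<^bsub>?AJ\<^esub> y \<in> ?Q" if "x \<in> ?Q" "y \<in> ?Q" for x y
    proof -
      have "x \<in> carrier A" "y \<in> carrier A" using that DC by auto
      then show ?thesis using that Dcl by (auto simp: mult_add_left mult_add_right)
    qed
    show "k \<odot>\<^bsub>?AJ\<^esub> x \<in> ?Q" if "k \<in> carrier K" "x \<in> ?Q" for k x
    proof -
      have "x \<in> carrier A" using that DC by auto
      then show ?thesis using that Dcl by (auto simp: mult_smult_left mult_smult_right)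
    qed
    show "j \<otimes>\<^bsub>?AJ\<^esub> x \<in> ?Q" "x \<otimes>\<^bsub>?AJ\<^esub> j \<in> ?Q" if m: "x \<in> ?Q" "j \<in> carrier ?AJ" for x j
    proof -
      have c: "x \<in> carrier A" "j \<in> carrier A" "j \<in> J" using m DC Jc by auto
      have j: "a \<otimes>\<^bsub>A\<^esub> j \<in> J" "j \<otimes>\<^bsub>A\<^esub> a \<in> J" if "a \<in> carrier A" for a
        using J(1) c(3) that unfolding alg_ideal_def by auto
      have "a \<otimes>\<^bsub>A\<^esub> (j \<otimes>\<^bsub>A\<^esub> x) \<in> ?D \<and> j \<otimes>\<^bsub>A\<^esub> x \<otimes>\<^bsub>A\<^esub> a \<in> ?D" if a: "a \<in> carrier A" for a
      proof -
        have "a \<otimes>\<^bsub>A\<^esub> (j \<otimes>\<^bsub>A\<^esub> x) = a \<otimes>\<^bsub>A\<^esub> j \<otimes>\<^bsub>A\<^esub> x" "j \<otimes>\<^bsub>A\<^esub> x \<otimes>\<^bsub>A\<^esub> a = j \<otimes>\<^bsub>A\<^esub> (x \<otimes>\<^bsub>A\<^esub> a)"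
          using mult_assoc[of a j x] mult_assoc[of j x a] c a by auto
        moreover have "a \<otimes>\<^bsub>A\<^esub> j \<otimes>\<^bsub>A\<^esub> x \<in> ?D" using DD(1)[OF _ j(1)[OF a]] m(1) by blast
        moreover have "j \<otimes>\<^bsub>A\<^esub> (x \<otimes>\<^bsub>A\<^esub> a) \<in> ?D" using DD(1)[OF _ c(3)] m(1) a by blast
        ultimately show ?thesis by simp
      qed
      then show "j \<otimes>\<^bsub>?AJ\<^esub> x \<in> ?Q" using DD(1)[OF _ c(3)] m(1) by auto
      have "a \<otimes>\<^bsub>A\<^esub> (x \<otimes>\<^bsub>A\<^esub> j) \<in> ?D \<and> x \<otimes>\<^bsub>A\<^esub> j \<otimes>\<^bsub>A\<^esub> a \<in> ?D" if a: "a \<in> carrier A" for a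
      proof -
        have "a \<otimes>\<^bsub>A\<^esub> (x \<otimes>\<^bsub>A\<^esub> j) = a \<otimes>\<^bsub>A\<^esub> x \<otimes>\<^bsub>A\<^esub> j" "x \<otimes>\<^bsub>A\<^esub> j \<otimes>\<^bsub>A\<^esub> a = x \<otimes>\<^bsub>A\<^esub> (j \<otimes>\<^bsub>A\<^esub> a)"
          using mult_assoc[of a x j] mult_assoc[of x j a] c a by auto
        moreover have "x \<otimes>\<^bsub>A\<^esub> (j \<otimes>\<^bsub>A\<^esub> a) \<in> ?D" using DD(2)[OF _ j(2)[OF a]] m(1) by blast
        moreover have "a \<otimes>\<^bsub>A\<^esub> x \<otimes>\<^bsub>A\<^esub> j \<in> ?D" using DD(2)[OF _ c(3)] m(1) a by blast
        ultimately show ?thesis by simp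
      qed
      then show "x \<otimes>\<^bsub>?AJ\<^esub> j \<in> ?Q" using DD(2)[OF _ c(3)] m(1) by auto
    qed
  qed
  moreover have "Z \<subseteq> ?Q"
  proof
    fix z assume z: "z \<in> Z"
    have "a \<otimes>\<^bsub>A\<^esub> z \<in> ?D \<and> z \<otimes>\<^bsub>A\<^esub> a \<in> ?D" if a: "a \<in> carrier A" for a
    proof -
      have RX2: "a \<otimes>\<^bsub>A\<^esub> r \<in> ?D \<and> r \<otimes>\<^bsub>A\<^esub> a \<in> ?D \<and> (\<forall>x\<in>X. x \<otimes>\<^bsub>A\<^esub> r \<otimes>\<^bsub>A\<^esub> a \<in> ?D)"
        if r: "r \<in> RX" and a: "a \<in> carrier A" for r a
      proof -
        consider "r \<in> R" | r' x where "r' \<in> R" "x \<in> X" "r = r' \<otimes>\<^bsub>A\<^esub> x"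
          using r unfolding RX_def by auto
        then show ?thesis
        proof cases
          case 1
          then show ?thesis using Xmul[OF a r] Rmul[OF a] by blast
        next
          case 2
          have c: "r' \<in> carrier A" "x \<in> carrier A" using 2 R(1) X(2) by auto
          have xa: "x \<otimes>\<^bsub>A\<^esub> a \<in> carrier A" using mult_closed[OF c(2) a] .
          have "y \<otimes>\<^bsub>A\<^esub> r \<otimes>\<^bsub>A\<^esub> a = y \<otimes>\<^bsub>A\<^esub> r' \<otimes>\<^bsub>A\<^esub> (x \<otimes>\<^bsub>A\<^esub> a)" if y: "y \<in> X" for y
          proof -
            have "y \<in> carrier A" using y X(2) by blast
            then show ?thesis using 2(3) c a xa by (simp add: mult_assoc mult_closed)
          qed
          moreover have "r \<otimes>\<^bsub>A\<^esub> a = r' \<otimes>\<^bsub>A\<^esub> (x \<otimes>\<^bsub>A\<^esub> a)" using 2(3) c a by (simp add: mult_assoc)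
          ultimately show ?thesis using Xmul[OF a r] Rmul[OF xa 2(1)] by simp
        qed
      qed
      consider "z \<in> RX" | x r where "x \<in> X" "r \<in> RX" "z = x \<otimes>\<^bsub>A\<^esub> r" using z unfolding Z_def by auto
      then show ?thesis
      proof cases
        case 1
        then show ?thesis using RX2[OF _ a] by blast
      next
        case 2
        have c: "x \<in> carrier A" "r \<in> carrier A" using 2 X(2) RXI I(2) Jc by auto
        have "a \<otimes>\<^bsub>A\<^esub> z = a \<otimes>\<^bsub>A\<^esub> x \<otimes>\<^bsub>A\<^esub> r" using mult_assoc[OF a c] 2(3) by simp
        then have "a \<otimes>\<^bsub>A\<^esub> z \<in> ?D" using Xmul[OF mult_closed[OF a c(1)] 2(2)] by simp
        then show ?thesis using RX2[OF 2(2) a] 2(1,3) by simp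
      qed
    qed
    then show "z \<in> ?Q" using z ZD by blast
  qed
  ultimately have "?D \<subseteq> ?Q" by (rule ideal_gen_least)
  then have "alg_ideal K A ?D" unfolding alg_ideal_def using Dsm by blast
  moreover have "R \<subseteq> ?D" using ZD unfolding Z_def RX_def by blast
  ultimately have "I \<subseteq> ?D" using ideal_gen_least R(3) by blast
  moreover have "?D \<subseteq> I"
    using ideal_gen_least[OF ideal_restrict[OF Jsub Iid], of Z] ZI I(2) by blast
  ultimately have "?D = I" by blast
  moreover have "finite Z" unfolding Z_def RX_def using R(2) X(1) by blast
  ultimately show ?thesis unfolding fin_gen_ideal_def using ZJ by (intro exI[of _ Z]) simp
qed

text \<open>Any ideal of \<open>C\<close> meets \<open>J\<close> in an ideal of \<open>J\<close>, so generators over \<open>J\<close> suffice over \<open>C\<close>.\<close>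

lemma fin_gen_ideal_extend:
  assumes C: "subalg K A C" and J: "subalg K A J" "J \<subseteq> C"
    and I: "fin_gen_ideal K (A\<lparr>carrier := J\<rparr>) I" "alg_ideal K A I"
  shows "fin_gen_ideal K (A\<lparr>carrier := C\<rparr>) I"
proof -
  interpret AC: nonunital_algebra K "A\<lparr>carrier := C\<rparr>" by (rule subalg_algebra[OF C])
  interpret AJ: nonunital_algebra K "A\<lparr>carrier := J\<rparr>" by (rule subalg_algebra[OF J(1)])
  obtain Z where Z: "Z \<subseteq> J" "finite Z" "ideal_gen K (A\<lparr>carrier := J\<rparr>) Z = I"
    using I(1) unfolding fin_gen_ideal_def by auto
  have ZC: "Z \<subseteq> carrier (A\<lparr>carrier := C\<rparr>)" using Z(1) J(2) by auto
  let ?D = "ideal_gen K (A\<lparr>carrier := C\<rparr>) Z"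
  have D: "alg_ideal K (A\<lparr>carrier := C\<rparr>) ?D" by (rule AC.ideal_gen_alg_ideal[OF ZC])
  have "subalg K (A\<lparr>carrier := C\<rparr>) J" using subalg_restrict_iff[OF C] J by blast
  from AC.ideal_restrict[OF this D] have "alg_ideal K (A\<lparr>carrier := J\<rparr>) (?D \<inter> J)" by simp
  then have "I \<subseteq> ?D \<inter> J"
    using ideal_gen_least[of K "A\<lparr>carrier := J\<rparr>" "?D \<inter> J" Z] Z(1,3) ideal_gen_superset[of Z K "A\<lparr>carrier := C\<rparr>"]
    by blast
  moreover have "?D \<subseteq> I"
    using ideal_gen_least[OF ideal_restrict[OF C I(2)], of Z] Z ideal_gen_superset[of Z K "A\<lparr>carrier := J\<rparr>"] J(2)
    by blast
  ultimately show ?thesis unfolding fin_gen_ideal_def using ZC Z(2) by blast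
qed

text \<open>
  The preimage of \<open>C\<close> in a free algebra \<open>F\<close> covering \<open>A\<close> contains a finitely presented subalgebra
  of finite corank, hence is itself finitely presented, and \<open>C\<close> is a quotient of it.
\<close>

theorem finiteness_of_subalg_over_finite_corank_ideal:
  assumes noeth: "noetherian_ring K" and J: "alg_ideal K A J" "finite_corank K A J"
    and C: "subalg K A C" "J \<subseteq> C" and fg: "fin_gen_alg K A"
  shows "fin_gen_alg K (A\<lparr>carrier := C\<rparr>)"
    and "fin_pres_alg K A \<Longrightarrow> fin_pres_alg K (A\<lparr>carrier := C\<rparr>)"
proof -
  obtain S where S: "S \<subseteq> carrier A" "finite S" "subalg_gen K A S = carrier A"
    using fg unfolding fin_gen_alg_def by blast
  obtain T where T: "finite T" "T \<subseteq> carrier A" "module_gen K A (J \<union> T) = carrier A"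
    using finite_corank_span[OF J(2)] by blast
  have ST: "finite (S \<union> T)" "S \<union> T \<subseteq> carrier A" using S T by auto
  have "subalg_gen K A (S \<union> T) = carrier A"
    using subalg_gen_mono[of S "S \<union> T" K A] S(3) subalg_subset[OF subalg_gen_subalg[OF ST(2)]] by blast
  then obtain m :: nat and h l where h: "h \<in> alg_hom K (free_alg K {..<m}) A"
    "h ` carrier (free_alg K {..<m}) = carrier A"
    and l: "l ` (S \<union> T) = (\<lambda>i. free_word K [i]) ` {..<m}" "\<And>s. s \<in> S \<union> T \<Longrightarrow> h (l s) = s"
    by (rule free_cover[OF ST]) blast
  let ?F = "free_alg K {..<m}" and ?L = "(\<lambda>i. free_word K [i]) ` {..<m}"
  interpret F: nonunital_algebra K ?F by (rule R.free_alg_algebra)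
  note alg = F.is_nonunital_algebra is_nonunital_algebra
  have Lc: "?L \<subseteq> carrier ?F" using R.free_letter_closed[of _ "{..<m}"] by auto
  have hL: "h ` ?L = S \<union> T" using l by (force simp flip: l(1) simp: image_image)
  let ?J = "{x \<in> carrier ?F. h x \<in> J}" and ?C = "{x \<in> carrier ?F. h x \<in> C}"
  have JF: "alg_ideal K ?F ?J" by (rule alg_ideal_vimage[OF alg h(1) J(1)])
  have CF: "subalg K ?F ?C" by (rule subalg_vimage[OF alg h(1) C(1)])
  have JL: "?J \<union> ?L \<subseteq> carrier ?F" using Lc by blast
  have Jc: "J \<subseteq> carrier A" by (rule alg_ideal_subset[OF J(1)])
  have "carrier ?F \<subseteq> module_gen K ?F (?J \<union> ?L)"
  proof
    fix x assume x: "x \<in> carrier ?F"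
    have "h ` ?J = J" using Jc h(2) by auto
    then have "h ` module_gen K ?F (?J \<union> ?L) = module_gen K A (J \<union> (S \<union> T))"
      using image_module_gen[OF F.is_module is_module alg_hom_lin_map[OF h(1)] JL] hL by (simp add: image_Un)
    moreover have "carrier A \<subseteq> module_gen K A (J \<union> (S \<union> T))"
      using module_gen_mono[of "J \<union> T" "J \<union> (S \<union> T)" K A] T(3) by blast
    moreover have "h x \<in> carrier A" using alg_homE(1)[OF h(1) x] .
    ultimately have "h x \<in> h ` module_gen K ?F (?J \<union> ?L)" by blast
    then obtain y where y: "h x = h y" "y \<in> module_gen K ?F (?J \<union> ?L)" by (rule imageE)
    have yc: "y \<in> carrier ?F" using y(2) F.module_gen_carrier[OF JL] by blast
    have "x \<ominus>\<^bsub>?F\<^esub> y \<in> alg_ker ?F A h" by (rule fibre_difference_in_ker[OF alg h(1) x yc]) (rule y(1))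
    then have "x \<ominus>\<^bsub>?F\<^esub> y \<in> ?J" using alg_ideal_submodule[OF J(1)] unfolding submodule_iff by auto
    then have "x \<ominus>\<^bsub>?F\<^esub> y \<in> module_gen K ?F (?J \<union> ?L)" using module_gen_superset[of "?J \<union> ?L" K ?F] by blast
    then show "x \<in> module_gen K ?F (?J \<union> ?L)"
      by (rule F.submodule_minus_cancel[OF F.module_gen_submodule[OF JL] x y(2)])
  qed
  then have JLspan: "module_gen K ?F (?J \<union> ?L) = carrier ?F" using F.module_gen_carrier[OF JL] by blast
  then obtain H where H: "subalg K ?F H" "H \<subseteq> ?J" "fin_pres_alg K (?F\<lparr>carrier := H\<rparr>)"
    "module_gen K ?F (H \<union> ?L) = carrier ?F"
    using fin_pres_subalg_of_free_alg_ideal[OF R.is_cring finite_lessThan JF] by blast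
  let ?FC = "?F\<lparr>carrier := ?C\<rparr>"
  interpret FC: nonunital_algebra K ?FC by (rule F.subalg_algebra[OF CF])
  interpret AC: nonunital_algebra K "A\<lparr>carrier := C\<rparr>" by (rule subalg_algebra[OF C(1)])
  have JC: "?J \<subseteq> ?C" using C(2) by blast
  have HC: "H \<subseteq> ?C" using H(2) JC by blast
  obtain T' where T': "finite T'" "T' \<subseteq> ?C" "?C \<subseteq> module_gen K ?F (H \<union> T')"
  proof -
    have "finite_corank K ?F H"
      by (rule F.finite_corankI[OF subalg_submodule[OF H(1)], of ?L]) (use Lc H(4) in auto)
    then obtain T' where "finite T'" "T' \<subseteq> ?C" "?C \<subseteq> module_gen K ?F ((?C \<inter> H) \<union> T')"
      using F.finite_corank_Int_subset[OF noeth _ subalg_submodule[OF CF]] by blast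
    then show thesis using that HC by (simp add: Int_absorb1)
  qed
  have HT': "H \<union> T' \<subseteq> ?C" using HC T'(2) by blast
  have "module_gen K ?FC (H \<union> T') = carrier ?FC"
    using F.module_gen_restrict[OF CF HT'] T'(3) module_gen_least[OF subalg_submodule[OF CF] HT'] by simp
  moreover have HFC: "subalg K ?FC H" using F.subalg_restrict_iff[OF CF] H(1) HC by blast
  ultimately have "finite_corank K ?FC H"
    by (intro FC.finite_corankI[OF subalg_submodule[OF HFC] T'(1)]) (use T'(2) in simp_all)
  then have fpC: "fin_pres_alg K ?FC"
    using fin_pres_alg_of_finite_corank[OF noeth FC.is_nonunital_algebra HFC] H(3) by simp
  have hC: "h \<in> alg_hom K ?FC (A\<lparr>carrier := C\<rparr>)"
    by (rule alg_hom_restrict[OF h(1)]) auto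
  have "C \<subseteq> carrier A" by (rule subalg_subset[OF C(1)])
  then have "h ` ?C = C" using h(2) by auto
  then have hCsurj: "h ` carrier ?FC = carrier (A\<lparr>carrier := C\<rparr>)" by simp
  show "fin_gen_alg K (A\<lparr>carrier := C\<rparr>)"
    by (rule fin_gen_alg_image[OF FC.is_nonunital_algebra AC.is_nonunital_algebra hC hCsurj
          FC.fin_pres_imp_fin_gen[OF fpC]])
  show "fin_pres_alg K (A\<lparr>carrier := C\<rparr>)" if fp: "fin_pres_alg K A"
  proof (rule fin_pres_quotient[OF FC.is_nonunital_algebra AC.is_nonunital_algebra fpC hC hCsurj])
    let ?I = "alg_ker ?F A h"
    have zero: "\<zero>\<^bsub>A\<^esub> \<in> J" using alg_ideal_submodule[OF J(1)] unfolding submodule_iff by blast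
    then have IJ: "?I \<subseteq> ?J" by auto
    have Fgen: "fin_gen_alg K ?F"
      unfolding fin_gen_alg_def using Lc R.free_alg_generated[of "{..<m}"] by blast
    have "fin_gen_ideal K ?F ?I"
      by (rule fin_pres_kernel_fin_gen[OF is_nonunital_algebra F.is_nonunital_algebra fp Fgen h])
    moreover have "finite_corank K ?F ?J"
      by (rule F.finite_corankI[OF alg_ideal_submodule[OF JF], of ?L]) (use Lc JLspan in auto)
    ultimately have "fin_gen_ideal K (?F\<lparr>carrier := ?J\<rparr>) ?I"
      using F.fin_gen_ideal_restrict[OF JF] IJ by blast
    then have "fin_gen_ideal K ?FC ?I"
      by (rule F.fin_gen_ideal_extend[OF CF F.alg_ideal_imp_subalg[OF JF] JC _ alg_ker_ideal[OF alg h(1)]])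
    moreover have "alg_ker ?FC (A\<lparr>carrier := C\<rparr>) h = ?I" using IJ JC by auto
    ultimately show "fin_gen_ideal K ?FC (alg_ker ?FC (A\<lparr>carrier := C\<rparr>) h)" by simp
  qed
qed

end

section \<open>Products of families\<close>

lemma prod_alg_simps:
  "carrier (prod_alg I A) = (\<Pi>\<^sub>E i\<in>I. carrier (A i))"
  "\<zero>\<^bsub>prod_alg I A\<^esub> = (\<lambda>i\<in>I. \<zero>\<^bsub>A i\<^esub>)"
  "f \<oplus>\<^bsub>prod_alg I A\<^esub> g = (\<lambda>i\<in>I. f i \<oplus>\<^bsub>A i\<^esub> g i)"
  "f \<otimes>\<^bsub>prod_alg I A\<^esub> g = (\<lambda>i\<in>I. f i \<otimes>\<^bsub>A i\<^esub> g i)"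
  "a \<odot>\<^bsub>prod_alg I A\<^esub> f = (\<lambda>i\<in>I. a \<odot>\<^bsub>A i\<^esub> f i)"
  unfolding prod_alg_def by simp_all

lemma prod_alg_algebra:
  assumes K: "cring K" and A: "\<And>i. i \<in> I \<Longrightarrow> nonunital_algebra K (A i)"
  shows "nonunital_algebra K (prod_alg I A)"
proof -
  let ?P = "prod_alg I A"
  have m: "module K (A i)" if "i \<in> I" for i using nonunital_algebra.is_module[OF A[OF that]] .
  have g: "abelian_group (A i)" if "i \<in> I" for i using module.axioms(2)[OF m[OF that]] .
  note mon = abelian_group.axioms(1)[OF g]
  have coord: "f i \<in> carrier (A i)" if "f \<in> carrier ?P" "i \<in> I" for f i
    using that unfolding prod_alg_simps by auto
  have memI: "(\<lambda>i\<in>I. f i) \<in> carrier ?P" if "\<And>i. i \<in> I \<Longrightarrow> f i \<in> carrier (A i)" for f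
    using that unfolding prod_alg_simps by auto
  have eqI: "f = g" if "f \<in> carrier ?P" "g \<in> carrier ?P" "\<And>i. i \<in> I \<Longrightarrow> f i = g i" for f g
    using that unfolding prod_alg_simps by (rule PiE_ext)
  have zero: "\<zero>\<^bsub>?P\<^esub> \<in> carrier ?P"
    unfolding prod_alg_simps(2) by (rule memI) (rule abelian_monoid.zero_closed[OF mon])
  have add: "f \<oplus>\<^bsub>?P\<^esub> h \<in> carrier ?P" if "f \<in> carrier ?P" "h \<in> carrier ?P" for f h
    unfolding prod_alg_simps(3)
    by (rule memI) (rule abelian_monoid.a_closed[OF mon coord[OF that(1)] coord[OF that(2)]])
  have mult: "f \<otimes>\<^bsub>?P\<^esub> h \<in> carrier ?P" if "f \<in> carrier ?P" "h \<in> carrier ?P" for f h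
    unfolding prod_alg_simps(4)
    by (rule memI) (rule nonunital_algebra.mult_closed[OF A coord[OF that(1)] coord[OF that(2)]])
  have smult: "a \<odot>\<^bsub>?P\<^esub> f \<in> carrier ?P" if "a \<in> carrier K" "f \<in> carrier ?P" for a f
    unfolding prod_alg_simps(5)
    by (rule memI) (rule module.smult_closed[OF m that(1) coord[OF that(2)]])
  have ab: "abelian_group ?P"
  proof (rule abelian_groupI)
    fix f assume f: "f \<in> carrier ?P"
    show "\<zero>\<^bsub>?P\<^esub> \<oplus>\<^bsub>?P\<^esub> f = f"
      by (rule eqI[OF add[OF zero f] f])
        (simp add: prod_alg_simps(2,3) abelian_monoid.l_zero[OF mon coord[OF f]])
    have neg: "(\<lambda>i\<in>I. \<ominus>\<^bsub>A i\<^esub> f i) \<in> carrier ?P"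
      by (rule memI) (rule abelian_group.a_inv_closed[OF g coord[OF f]])
    moreover have "(\<lambda>i\<in>I. \<ominus>\<^bsub>A i\<^esub> f i) \<oplus>\<^bsub>?P\<^esub> f = \<zero>\<^bsub>?P\<^esub>"
      by (rule eqI[OF add[OF neg f] zero])
        (simp add: prod_alg_simps(2,3) abelian_group.l_neg[OF g coord[OF f]])
    ultimately show "\<exists>h\<in>carrier ?P. h \<oplus>\<^bsub>?P\<^esub> f = \<zero>\<^bsub>?P\<^esub>" by blast
  next
    fix f h assume fh: "f \<in> carrier ?P" "h \<in> carrier ?P"
    show "f \<oplus>\<^bsub>?P\<^esub> h = h \<oplus>\<^bsub>?P\<^esub> f"
      by (rule eqI[OF add[OF fh] add[OF fh(2,1)]])
        (simp add: prod_alg_simps(3) abelian_monoid.a_comm[OF mon coord[OF fh(1)] coord[OF fh(2)]])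
    fix k assume k: "k \<in> carrier ?P"
    show "f \<oplus>\<^bsub>?P\<^esub> h \<oplus>\<^bsub>?P\<^esub> k = f \<oplus>\<^bsub>?P\<^esub> (h \<oplus>\<^bsub>?P\<^esub> k)"
      by (rule eqI[OF add[OF add[OF fh] k] add[OF fh(1) add[OF fh(2) k]]])
        (simp add: prod_alg_simps(3) abelian_monoid.a_assoc[OF mon coord[OF fh(1)] coord[OF fh(2)] coord[OF k]])
  qed (use zero add in auto)
  have P: "module K ?P"
  proof (intro moduleI[OF K ab])
    fix a b f h assume a: "a \<in> carrier K" and b: "b \<in> carrier K" and f: "f \<in> carrier ?P" and h: "h \<in> carrier ?P"
    have ab: "a \<oplus>\<^bsub>K\<^esub> b \<in> carrier K" "a \<otimes>\<^bsub>K\<^esub> b \<in> carrier K"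
      using a b K by (simp_all add: cring_def ring.ring_simprules)
    show "(a \<oplus>\<^bsub>K\<^esub> b) \<odot>\<^bsub>?P\<^esub> f = a \<odot>\<^bsub>?P\<^esub> f \<oplus>\<^bsub>?P\<^esub> b \<odot>\<^bsub>?P\<^esub> f"
      by (rule eqI[OF smult[OF ab(1) f] add[OF smult[OF a f] smult[OF b f]]])
        (simp add: prod_alg_simps(3,5) module.smult_l_distr[OF m a b coord[OF f]])
    show "a \<odot>\<^bsub>?P\<^esub> (f \<oplus>\<^bsub>?P\<^esub> h) = a \<odot>\<^bsub>?P\<^esub> f \<oplus>\<^bsub>?P\<^esub> a \<odot>\<^bsub>?P\<^esub> h"
      by (rule eqI[OF smult[OF a add[OF f h]] add[OF smult[OF a f] smult[OF a h]]])
        (simp add: prod_alg_simps(3,5) module.smult_r_distr[OF m a coord[OF f] coord[OF h]])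
    show "(a \<otimes>\<^bsub>K\<^esub> b) \<odot>\<^bsub>?P\<^esub> f = a \<odot>\<^bsub>?P\<^esub> (b \<odot>\<^bsub>?P\<^esub> f)"
      by (rule eqI[OF smult[OF ab(2) f] smult[OF a smult[OF b f]]])
        (simp add: prod_alg_simps(5) module.smult_assoc1[OF m a b coord[OF f]])
  next
    fix f assume f: "f \<in> carrier ?P"
    have "\<one>\<^bsub>K\<^esub> \<in> carrier K" using K by (simp add: cring_def ring.ring_simprules)
    then show "\<one>\<^bsub>K\<^esub> \<odot>\<^bsub>?P\<^esub> f = f"
      by (rule eqI[OF smult[OF _ f] f]) (simp add: prod_alg_simps(5) module.smult_one[OF m coord[OF f]])
  qed (rule smult)
  show ?thesis
  proof (intro nonunital_algebra.intro nonunital_algebra_axioms.intro P)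
    fix f h k assume f: "f \<in> carrier ?P" and h: "h \<in> carrier ?P" and k: "k \<in> carrier ?P"
    note cf = coord[OF f] and ch = coord[OF h] and ck = coord[OF k]
    show "f \<otimes>\<^bsub>?P\<^esub> h \<otimes>\<^bsub>?P\<^esub> k = f \<otimes>\<^bsub>?P\<^esub> (h \<otimes>\<^bsub>?P\<^esub> k)"
      by (rule eqI[OF mult[OF mult[OF f h] k] mult[OF f mult[OF h k]]])
        (simp add: prod_alg_simps(4) nonunital_algebra.mult_assoc[OF A cf ch ck])
    show "(f \<oplus>\<^bsub>?P\<^esub> h) \<otimes>\<^bsub>?P\<^esub> k = f \<otimes>\<^bsub>?P\<^esub> k \<oplus>\<^bsub>?P\<^esub> h \<otimes>\<^bsub>?P\<^esub> k"
      by (rule eqI[OF mult[OF add[OF f h] k] add[OF mult[OF f k] mult[OF h k]]])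
        (simp add: prod_alg_simps(3,4) nonunital_algebra.mult_add_left[OF A cf ch ck])
    show "k \<otimes>\<^bsub>?P\<^esub> (f \<oplus>\<^bsub>?P\<^esub> h) = k \<otimes>\<^bsub>?P\<^esub> f \<oplus>\<^bsub>?P\<^esub> k \<otimes>\<^bsub>?P\<^esub> h"
      by (rule eqI[OF mult[OF k add[OF f h]] add[OF mult[OF k f] mult[OF k h]]])
        (simp add: prod_alg_simps(3,4) nonunital_algebra.mult_add_right[OF A cf ch ck])
  next
    fix a f h assume a: "a \<in> carrier K" and f: "f \<in> carrier ?P" and h: "h \<in> carrier ?P"
    note cf = coord[OF f] and ch = coord[OF h]
    show "(a \<odot>\<^bsub>?P\<^esub> f) \<otimes>\<^bsub>?P\<^esub> h = a \<odot>\<^bsub>?P\<^esub> (f \<otimes>\<^bsub>?P\<^esub> h)"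
      by (rule eqI[OF mult[OF smult[OF a f] h] smult[OF a mult[OF f h]]])
        (simp add: prod_alg_simps(4,5) nonunital_algebra.mult_smult_left[OF A a cf ch])
    show "f \<otimes>\<^bsub>?P\<^esub> (a \<odot>\<^bsub>?P\<^esub> h) = a \<odot>\<^bsub>?P\<^esub> (f \<otimes>\<^bsub>?P\<^esub> h)"
      by (rule eqI[OF mult[OF f smult[OF a h]] smult[OF a mult[OF f h]]])
        (simp add: prod_alg_simps(4,5) nonunital_algebra.mult_smult_right[OF A a cf ch])
  qed (rule mult)
qed

text \<open>For \<open>S = {i}\<close> and a constant function \<open>f\<close> this is the embedding of the factor \<open>A i\<close>.\<close>

definition supported_on :: "'i set \<Rightarrow> ('i \<Rightarrow> ('k, 'a, 'n) module_scheme) \<Rightarrow> 'i set \<Rightarrow> ('i \<Rightarrow> 'a) \<Rightarrow> 'i \<Rightarrow> 'a" where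
  "supported_on I A S f = (\<lambda>j\<in>I. if j \<in> S then f j else \<zero>\<^bsub>A j\<^esub>)"

locale algebra_family = cring K
  for K :: "('k, 'm) ring_scheme" and I :: "'i set" and A :: "'i \<Rightarrow> ('k, 'a, 'n) module_scheme" +
  assumes A: "\<And>i. i \<in> I \<Longrightarrow> nonunital_algebra K (A i)"
begin

lemma prod_algebra: "S \<subseteq> I \<Longrightarrow> nonunital_algebra K (prod_alg S A)"
  by (rule prod_alg_algebra[OF is_cring]) (use A in blast)

lemma zero_mem: "i \<in> I \<Longrightarrow> \<zero>\<^bsub>A i\<^esub> \<in> carrier (A i)"
  using nonunital_algebra.is_module[OF A] by (metis abelian_group.axioms(1) abelian_monoid.zero_closed module.axioms(2))

lemma zero_add [simp]: "i \<in> I \<Longrightarrow> x \<in> carrier (A i) \<Longrightarrow> \<zero>\<^bsub>A i\<^esub> \<oplus>\<^bsub>A i\<^esub> x = x"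
  and add_zero [simp]: "i \<in> I \<Longrightarrow> x \<in> carrier (A i) \<Longrightarrow> x \<oplus>\<^bsub>A i\<^esub> \<zero>\<^bsub>A i\<^esub> = x"
proof -
  assume i: "i \<in> I" and x: "x \<in> carrier (A i)"
  interpret nonunital_algebra K "A i" by (rule A[OF i])
  show "\<zero>\<^bsub>A i\<^esub> \<oplus>\<^bsub>A i\<^esub> x = x" "x \<oplus>\<^bsub>A i\<^esub> \<zero>\<^bsub>A i\<^esub> = x" using x by simp_all
qed

lemma zero_mult [simp]: "i \<in> I \<Longrightarrow> x \<in> carrier (A i) \<Longrightarrow> \<zero>\<^bsub>A i\<^esub> \<otimes>\<^bsub>A i\<^esub> x = \<zero>\<^bsub>A i\<^esub>"
  and mult_zero [simp]: "i \<in> I \<Longrightarrow> x \<in> carrier (A i) \<Longrightarrow> x \<otimes>\<^bsub>A i\<^esub> \<zero>\<^bsub>A i\<^esub> = \<zero>\<^bsub>A i\<^esub>"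
  using nonunital_algebra.mult_zero_left[OF A] nonunital_algebra.mult_zero_right[OF A] by auto

lemma smult_zero [simp]: "i \<in> I \<Longrightarrow> a \<in> carrier K \<Longrightarrow> a \<odot>\<^bsub>A i\<^esub> \<zero>\<^bsub>A i\<^esub> = \<zero>\<^bsub>A i\<^esub>"
  using module.smult_r_null[OF nonunital_algebra.is_module[OF A]] by auto

lemma proj_hom: "i \<in> S \<Longrightarrow> (\<lambda>f. f i) \<in> alg_hom K (prod_alg S A) (A i)"
  unfolding alg_hom_def prod_alg_simps by auto

lemma embed_hom:
  assumes "S \<subseteq> I" "i \<in> S"
  shows "(\<lambda>a. supported_on S A {i} (\<lambda>_. a)) \<in> alg_hom K (A i) (prod_alg S A)"
  unfolding alg_hom_def prod_alg_simps supported_on_def using assms zero_mem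
  by (auto simp: subset_iff intro!: restrict_ext)

lemma split_last_factor:
  assumes S: "insert i S \<subseteq> I" "i \<notin> S"
  shows "direct_product K (prod_alg (insert i S) A) (A i) (prod_alg S A)
    (\<lambda>f. f i) (\<lambda>f. restrict f S)
    (\<lambda>a. supported_on (insert i S) A {i} (\<lambda>_. a)) (\<lambda>f. supported_on (insert i S) A S f)"
proof (intro direct_product.intro direct_product_axioms.intro)
  have iI: "i \<in> I" and SI: "S \<subseteq> I" using S by auto
  show "nonunital_algebra K (prod_alg (insert i S) A)" "nonunital_algebra K (A i)"
    "nonunital_algebra K (prod_alg S A)"
    using prod_algebra S A by auto
  show "(\<lambda>f. f i) \<in> alg_hom K (prod_alg (insert i S) A) (A i)" by (rule proj_hom) simp
  show "(\<lambda>f. restrict f S) \<in> alg_hom K (prod_alg (insert i S) A) (prod_alg S A)"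
    unfolding alg_hom_def prod_alg_simps by (auto intro!: restrict_ext)
  show "(\<lambda>a. supported_on (insert i S) A {i} (\<lambda>_. a)) \<in> alg_hom K (A i) (prod_alg (insert i S) A)"
    by (rule embed_hom[OF S(1)]) simp
  show "(\<lambda>f. supported_on (insert i S) A S f) \<in> alg_hom K (prod_alg S A) (prod_alg (insert i S) A)"
    unfolding alg_hom_def prod_alg_simps supported_on_def using S zero_mem
    by (auto simp: subset_iff PiE_iff intro!: restrict_ext)
  show "supported_on (insert i S) A {i} (\<lambda>_. a) i = a" for a
    by (simp add: supported_on_def)
  show "restrict (supported_on (insert i S) A S f) S = f" if "f \<in> carrier (prod_alg S A)" for f
    using that unfolding prod_alg_simps supported_on_def by (auto simp: fun_eq_iff PiE_iff extensional_def)
  show "supported_on (insert i S) A S f i = \<zero>\<^bsub>A i\<^esub>" for f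
    using S(2) by (simp add: supported_on_def)
  show "restrict (supported_on (insert i S) A {i} (\<lambda>_. a)) S = \<zero>\<^bsub>prod_alg S A\<^esub>" for a
    using S(2) unfolding prod_alg_simps supported_on_def by (auto intro!: restrict_ext)
  fix a f assume a: "a \<in> carrier (A i)" and f: "f \<in> carrier (prod_alg S A)"
  have fj: "f j \<in> carrier (A j)" if "j \<in> S" for j using f that unfolding prod_alg_simps by auto
  show "supported_on (insert i S) A {i} (\<lambda>_. a) \<otimes>\<^bsub>prod_alg (insert i S) A\<^esub> supported_on (insert i S) A S f
      = \<zero>\<^bsub>prod_alg (insert i S) A\<^esub>"
    using S a fj SI iI unfolding prod_alg_simps supported_on_def by (auto intro!: restrict_ext)
  show "supported_on (insert i S) A S f \<otimes>\<^bsub>prod_alg (insert i S) A\<^esub> supported_on (insert i S) A {i} (\<lambda>_. a)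
      = \<zero>\<^bsub>prod_alg (insert i S) A\<^esub>"
    using S a fj SI iI unfolding prod_alg_simps supported_on_def by (auto intro!: restrict_ext)
next
  fix f assume f: "f \<in> carrier (prod_alg (insert i S) A)"
  have fj: "f j \<in> carrier (A j)" if "j \<in> insert i S" for j using f that unfolding prod_alg_simps by auto
  show "f = supported_on (insert i S) A {i} (\<lambda>_. f i) \<oplus>\<^bsub>prod_alg (insert i S) A\<^esub>
      supported_on (insert i S) A S (restrict f S)"
  proof (rule PiE_ext)
    show "f \<in> (\<Pi>\<^sub>E i\<in>insert i S. carrier (A i))" using f unfolding prod_alg_simps .
    show "supported_on (insert i S) A {i} (\<lambda>_. f i) \<oplus>\<^bsub>prod_alg (insert i S) A\<^esub>
        supported_on (insert i S) A S (restrict f S) \<in> (\<Pi>\<^sub>E i\<in>insert i S. carrier (A i))"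
      using fj S zero_mem unfolding prod_alg_simps supported_on_def by (auto simp: subset_iff)
    fix j assume j: "j \<in> insert i S"
    then show "f j = (supported_on (insert i S) A {i} (\<lambda>_. f i) \<oplus>\<^bsub>prod_alg (insert i S) A\<^esub>
        supported_on (insert i S) A S (restrict f S)) j"
      using fj[OF j] S unfolding prod_alg_simps supported_on_def by (auto simp: subset_iff)
  qed
qed

lemma fin_pres_empty_product: "fin_pres_alg K (prod_alg {} A)"
proof -
  interpret P: nonunital_algebra K "prod_alg {} A" using prod_algebra by blast
  interpret F: nonunital_algebra K "free_alg K {..<0::nat}" by (rule free_alg_algebra)
  let ?h = "\<lambda>_. \<lambda>_. undefined" and ?F = "free_alg K {..<0::nat}"
  have c: "carrier (prod_alg {} A) = {\<lambda>_. undefined}" unfolding prod_alg_simps by auto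
  have Fc: "carrier ?F = {\<zero>\<^bsub>?F\<^esub>}"
  proof -
    have "f = \<zero>\<^bsub>?F\<^esub>" if "f \<in> carrier ?F" for f
      using free_alg_supp(2)[OF that] by (auto simp: free_alg_simps)
    then show ?thesis using F.M.zero_closed by blast
  qed
  have h: "?h \<in> alg_hom K ?F (prod_alg {} A)"
    unfolding alg_hom_def c by (auto simp: prod_alg_simps fun_eq_iff)
  have surj: "?h ` carrier ?F = carrier (prod_alg {} A)" unfolding c Fc by auto
  have "alg_ker ?F (prod_alg {} A) ?h = {\<zero>\<^bsub>?F\<^esub>}"
    unfolding Fc by (auto simp: prod_alg_simps fun_eq_iff)
  moreover have "ideal_gen K ?F {} = {\<zero>\<^bsub>?F\<^esub>}"
    using ideal_gen_least[OF F.alg_ideal_zero, of "{}"] F.ideal_gen_alg_ideal[of "{}"]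
    unfolding F.alg_ideal_iff by auto
  ultimately have "fin_gen_ideal K ?F (alg_ker ?F (prod_alg {} A) ?h)"
    unfolding fin_gen_ideal_def by auto
  then show ?thesis
    unfolding fin_pres_alg_iff[OF P.is_nonunital_algebra] using h surj by blast
qed

lemma fin_gen_prod:
  assumes "finite S" "S \<subseteq> I" "\<And>i. i \<in> S \<Longrightarrow> fin_gen_alg K (A i)"
  shows "fin_gen_alg K (prod_alg S A)"
  using assms
proof (induction S rule: finite_induct)
  case empty
  then show ?case
    using nonunital_algebra.fin_pres_imp_fin_gen[OF prod_algebra fin_pres_empty_product] by blast
next
  case (insert i S)
  then show ?case using direct_product.fin_gen_product[OF split_last_factor] by simp
qed

lemma fin_pres_prod:
  assumes "finite S" "S \<subseteq> I" "\<And>i. i \<in> S \<Longrightarrow> fin_pres_alg K (A i)"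
  shows "fin_pres_alg K (prod_alg S A)"
  using assms
proof (induction S rule: finite_induct)
  case empty
  then show ?case using fin_pres_empty_product by simp
next
  case (insert i S)
  then show ?case using direct_product.fin_pres_product[OF split_last_factor] by simp
qed

lemma fin_pres_coordinate:
  assumes "i \<in> I" "fin_pres_alg K (prod_alg I A)"
  shows "fin_pres_alg K (A i)"
proof -
  have "insert i (I - {i}) = I" using assms(1) by blast
  then show ?thesis
    using direct_product.fin_pres_factor[OF split_last_factor[of i "I - {i}"]] assms(2) by simp
qed

end

section \<open>Subdirect products\<close>

locale virtually_surjective_subdirect_product = algebra_family K I A
  for K :: "('k, 'm) ring_scheme" and I :: "'i set" and A :: "'i \<Rightarrow> ('k, 'a, 'n) module_scheme" +
  fixes C :: "('i \<Rightarrow> 'a) set"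
  assumes noeth: "noetherian_ring K" and finite_I: "finite I"
    and subdirect: "subdirect_product K I A C"
    and pairs: "\<And>i j. i \<in> I \<Longrightarrow> j \<in> I \<Longrightarrow> i \<noteq> j \<Longrightarrow> finite_corank K (prod_alg {i, j} A) (pair_proj i j ` C)"
begin

abbreviation "P \<equiv> prod_alg I A"

sublocale P: nonunital_algebra K P
  by (rule prod_algebra) simp

lemma C_subalg: "subalg K P C"
  using subdirect unfolding subdirect_product_def by blast

lemma C_proj: "i \<in> I \<Longrightarrow> (\<lambda>f. f i) ` C = carrier (A i)"
  using subdirect unfolding subdirect_product_def by blast

lemma C_coord: "c \<in> C \<Longrightarrow> i \<in> I \<Longrightarrow> c i \<in> carrier (A i)"
  using C_proj by blast

lemma fin_gen_coordinate:
  assumes "i \<in> I" "fin_gen_alg K (P\<lparr>carrier := C\<rparr>)"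
  shows "fin_gen_alg K (A i)"
  by (rule fin_gen_alg_image[OF P.subalg_algebra[OF C_subalg] A[OF assms(1)] _ _ assms(2)])
    (use alg_hom_restrict_dom[OF proj_hom[OF assms(1)] P.subalg_subset[OF C_subalg]] C_proj[OF assms(1)] in simp_all)

text \<open>
  For \<open>S = I - {i}\<close> this is the part of \<open>C\<close> inside the factor \<open>A i\<close>; shrinking \<open>S\<close> to the empty
  set enlarges it to all of \<open>A i\<close>.
\<close>

definition fibre_ideal :: "'i \<Rightarrow> 'i set \<Rightarrow> 'a set" where
  "fibre_ideal i S = (\<lambda>c. c i) ` {c \<in> C. \<forall>j\<in>S. c j = \<zero>\<^bsub>A j\<^esub>}"

lemma fibre_ideal_ideal:
  assumes i: "i \<in> I" and S: "S \<subseteq> I"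
  shows "alg_ideal K (A i) (fibre_ideal i S)"
proof -
  interpret Ai: nonunital_algebra K "A i" by (rule A[OF i])
  note Ccl = C_subalg[unfolded P.subalg_iff prod_alg_simps(2-5)]
  have SI: "j \<in> I" if "j \<in> S" for j using S that by blast
  have memI: "x \<in> fibre_ideal i S" if "c \<in> C" "\<forall>j\<in>S. c j = \<zero>\<^bsub>A j\<^esub>" "x = c i" for x c
    unfolding fibre_ideal_def using that by blast
  show ?thesis
    unfolding Ai.alg_ideal_iff
  proof (intro conjI ballI)
    show "fibre_ideal i S \<subseteq> carrier (A i)" unfolding fibre_ideal_def using C_coord[OF _ i] by blast
    show "\<zero>\<^bsub>A i\<^esub> \<in> fibre_ideal i S"
      by (rule memI[of "\<lambda>i\<in>I. \<zero>\<^bsub>A i\<^esub>"]) (use Ccl i SI in auto)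
  next
    fix x y assume "x \<in> fibre_ideal i S" "y \<in> fibre_ideal i S"
    then obtain c d where cd: "c \<in> C" "\<forall>j\<in>S. c j = \<zero>\<^bsub>A j\<^esub>" "x = c i" "d \<in> C" "\<forall>j\<in>S. d j = \<zero>\<^bsub>A j\<^esub>" "y = d i"
      unfolding fibre_ideal_def by blast
    show "x \<oplus>\<^bsub>A i\<^esub> y \<in> fibre_ideal i S"
    proof (rule memI)
      show "(\<lambda>i\<in>I. c i \<oplus>\<^bsub>A i\<^esub> d i) \<in> C" using Ccl cd by blast
    qed (use cd i SI zero_mem in auto)
  next
    fix a x assume a: "a \<in> carrier K" and "x \<in> fibre_ideal i S"
    then obtain c where c: "c \<in> C" "\<forall>j\<in>S. c j = \<zero>\<^bsub>A j\<^esub>" "x = c i"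
      unfolding fibre_ideal_def by blast
    show "a \<odot>\<^bsub>A i\<^esub> x \<in> fibre_ideal i S"
    proof (rule memI)
      show "(\<lambda>i\<in>I. a \<odot>\<^bsub>A i\<^esub> c i) \<in> C" using Ccl c a by blast
    qed (use c i SI a in auto)
  next
    fix x a assume "x \<in> fibre_ideal i S" and a: "a \<in> carrier (A i)"
    then obtain c where c: "c \<in> C" "\<forall>j\<in>S. c j = \<zero>\<^bsub>A j\<^esub>" "x = c i"
      unfolding fibre_ideal_def by blast
    obtain d where d: "d \<in> C" "a = d i" using a C_proj[OF i] by blast
    show "a \<otimes>\<^bsub>A i\<^esub> x \<in> fibre_ideal i S"
    proof (rule memI)
      show "(\<lambda>i\<in>I. d i \<otimes>\<^bsub>A i\<^esub> c i) \<in> C" using Ccl c d by blast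
    qed (use c d i SI C_coord[OF d(1)] in auto)
    show "x \<otimes>\<^bsub>A i\<^esub> a \<in> fibre_ideal i S"
    proof (rule memI)
      show "(\<lambda>i\<in>I. c i \<otimes>\<^bsub>A i\<^esub> d i) \<in> C" using Ccl c d by blast
    qed (use c d i SI C_coord[OF d(1)] in auto)
  qed
qed

lemma fibre_ideal_mult:
  assumes i: "i \<in> I" and S: "S \<union> T \<subseteq> I" and x: "x \<in> fibre_ideal i S" and y: "y \<in> fibre_ideal i T"
  shows "x \<otimes>\<^bsub>A i\<^esub> y \<in> fibre_ideal i (S \<union> T)"
proof -
  obtain c d where cd: "c \<in> C" "\<forall>j\<in>S. c j = \<zero>\<^bsub>A j\<^esub>" "x = c i" "d \<in> C" "\<forall>j\<in>T. d j = \<zero>\<^bsub>A j\<^esub>" "y = d i"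
    using x y unfolding fibre_ideal_def by blast
  let ?e = "\<lambda>i\<in>I. c i \<otimes>\<^bsub>A i\<^esub> d i"
  have "?e \<in> C" using C_subalg[unfolded P.subalg_iff prod_alg_simps(4)] cd by blast
  moreover have "?e j = \<zero>\<^bsub>A j\<^esub>" if "j \<in> S \<union> T" for j
    using that S cd C_coord by (auto simp: subset_iff)
  ultimately show ?thesis unfolding fibre_ideal_def using cd i
    by (intro image_eqI[of _ _ ?e]) auto
qed

text \<open>
  Modulo the fibre ideal, \<open>A i\<close> embeds into the product of \<open>A i\<close> and \<open>A j\<close> modulo the image of
  \<open>C\<close>.
\<close>

lemma finite_corank_fibre_pair:
  assumes i: "i \<in> I" and j: "j \<in> I" and ij: "i \<noteq> j"
  shows "finite_corank K (A i) (fibre_ideal i {j})"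
proof -
  let ?PP = "prod_alg {i, j} A" and ?D = "pair_proj i j ` C"
  have IJ: "{i, j} \<subseteq> I" using i j by blast
  interpret Ai: nonunital_algebra K "A i" by (rule A[OF i])
  interpret PP: nonunital_algebra K ?PP by (rule prod_algebra[OF IJ])
  define em where "em = (\<lambda>a. supported_on {i, j} A {i} (\<lambda>_. a))"
  have em: "em \<in> lin_map K (A i) ?PP"
    unfolding em_def by (rule alg_hom_lin_map[OF embed_hom[OF IJ]]) simp
  have em_i: "em a i = a" and em_j: "em a j = \<zero>\<^bsub>A j\<^esub>" for a
    using ij unfolding em_def supported_on_def by auto
  have pr: "(\<lambda>f. f i) \<in> lin_map K ?PP (A i)" by (rule alg_hom_lin_map[OF proj_hom]) simp
  let ?Q = "em ` carrier (A i)"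
  have Q: "submodule ?Q K ?PP"
    by (rule submodule_image[OF Ai.is_module PP.is_module em Ai.carrier_is_submodule])
  obtain T where T: "finite T" "T \<subseteq> ?Q" "?Q \<subseteq> module_gen K ?PP ((?Q \<inter> ?D) \<union> T)"
    using PP.finite_corank_Int_subset[OF noeth pairs[OF i j ij] Q] by blast
  have Qc: "?Q \<subseteq> carrier ?PP" using PP.submoduleE(1)[OF Q] .
  let ?T = "(\<lambda>f. f i) ` T"
  have "(\<lambda>f. f i) ` (?Q \<inter> ?D) \<subseteq> fibre_ideal i {j}"
  proof (rule image_subsetI)
    fix f assume "f \<in> ?Q \<inter> ?D"
    then obtain a c where ac: "f = em a" "c \<in> C" "f = restrict c {i, j}" unfolding pair_proj_def by blast
    then have "c j = \<zero>\<^bsub>A j\<^esub>" "f i = c i" using em_j[of a] by (metis insertCI restrict_apply')+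
    then show "f i \<in> fibre_ideal i {j}" unfolding fibre_ideal_def using ac(2) by blast
  qed
  then have sub: "(\<lambda>f. f i) ` ((?Q \<inter> ?D) \<union> T) \<subseteq> fibre_ideal i {j} \<union> ?T" by blast
  have "carrier (A i) \<subseteq> module_gen K (A i) (fibre_ideal i {j} \<union> ?T)"
  proof
    fix a assume a: "a \<in> carrier (A i)"
    have "a \<in> (\<lambda>f. f i) ` module_gen K ?PP ((?Q \<inter> ?D) \<union> T)"
      using T(3) a em_i[of a] by (intro image_eqI[of _ _ "em a"]) auto
    also have "\<dots> = module_gen K (A i) ((\<lambda>f. f i) ` ((?Q \<inter> ?D) \<union> T))"
      by (rule image_module_gen[OF PP.is_module Ai.is_module pr]) (use T(2) Qc in blast)
    also have "\<dots> \<subseteq> module_gen K (A i) (fibre_ideal i {j} \<union> ?T)" by (rule module_gen_mono[OF sub])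
    finally show "a \<in> module_gen K (A i) (fibre_ideal i {j} \<union> ?T)" .
  qed
  moreover have "?T \<subseteq> carrier (A i)" using T(2) em_i by auto
  moreover have "submodule (fibre_ideal i {j}) K (A i)"
    by (rule alg_ideal_submodule[OF fibre_ideal_ideal[OF i]]) (use j in simp)
  ultimately show ?thesis using Ai.finite_corankI[of "fibre_ideal i {j}" ?T] T(1) by blast
qed

lemma finite_corank_fibre:
  assumes i: "i \<in> I" and fg: "fin_gen_alg K (A i)" and S: "S \<subseteq> I - {i}"
  shows "finite_corank K (A i) (fibre_ideal i S)"
proof -
  have "finite S" using S finite_I finite_subset by blast
  then show ?thesis using S
  proof (induction S rule: finite_induct)
    case empty
    interpret Ai: nonunital_algebra K "A i" by (rule A[OF i])
    have "fibre_ideal i {} = carrier (A i)" unfolding fibre_ideal_def using C_proj[OF i] by simp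
    then show ?case
      using Ai.finite_corankI[OF Ai.carrier_is_submodule, of "{}"] module_gen_superset[of "carrier (A i)" K "A i"]
      by simp
  next
    case (insert j S)
    interpret Ai: nonunital_algebra K "A i" by (rule A[OF i])
    have j: "j \<in> I" "i \<noteq> j" and SI: "S \<subseteq> I" using insert.prems by auto
    have J: "alg_ideal K (A i) (fibre_ideal i (insert j S))"
      by (rule fibre_ideal_ideal[OF i]) (use j SI in blast)
    show ?case
    proof (rule Ai.finite_corank_product[OF fg])
      show "alg_ideal K (A i) (fibre_ideal i {j})" "finite_corank K (A i) (fibre_ideal i {j})"
        using fibre_ideal_ideal[OF i] finite_corank_fibre_pair[OF i] j by auto
      show "alg_ideal K (A i) (fibre_ideal i S)" "finite_corank K (A i) (fibre_ideal i S)"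
        using fibre_ideal_ideal[OF i SI] insert by auto
      show "submodule (fibre_ideal i (insert j S)) K (A i)" by (rule alg_ideal_submodule[OF J])
      show "x \<otimes>\<^bsub>A i\<^esub> y \<in> fibre_ideal i (insert j S)"
        if "x \<in> fibre_ideal i {j}" "y \<in> fibre_ideal i S" for x y
        using fibre_ideal_mult[OF i _ that] j SI by simp
      show "x \<otimes>\<^bsub>A i\<^esub> a \<in> fibre_ideal i (insert j S)"
        if "x \<in> fibre_ideal i (insert j S)" "a \<in> carrier (A i)" for x a
        using J that unfolding alg_ideal_def by blast
    qed
  qed
qed

text \<open>Of all ideals of \<open>P\<close> that are products of ideals of the factors, this is the largest one inside \<open>C\<close>.\<close>

definition conductor :: "('i \<Rightarrow> 'a) set" where
  "conductor = {f \<in> carrier P. \<forall>i\<in>I. f i \<in> fibre_ideal i (I - {i})}"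

lemma supported_on_insert:
  assumes "f \<in> carrier P" "i \<in> I" "i \<notin> S"
  shows "supported_on I A (insert i S) f = supported_on I A S f \<oplus>\<^bsub>P\<^esub> supported_on I A {i} (\<lambda>_. f i)"
proof -
  have "f j \<in> carrier (A j)" if "j \<in> I" for j using assms(1) that unfolding prod_alg_simps by auto
  then show ?thesis
    using assms(2,3) zero_mem unfolding prod_alg_simps supported_on_def by (auto intro!: restrict_ext)
qed

lemma supported_on_all: "f \<in> carrier P \<Longrightarrow> supported_on I A I f = f"
  unfolding prod_alg_simps supported_on_def by (auto simp: fun_eq_iff PiE_iff extensional_def)

lemma mem_if_components_mem:
  assumes H: "submodule H K P" and f: "f \<in> carrier P"
    and comp: "\<And>i. i \<in> I \<Longrightarrow> supported_on I A {i} (\<lambda>_. f i) \<in> H"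
  shows "f \<in> H"
proof -
  have "supported_on I A S f \<in> H" if "S \<subseteq> I" for S
  proof -
    have "finite S" using that finite_I finite_subset by blast
    then show ?thesis using that
    proof (induction S rule: finite_induct)
      case empty
      have "supported_on I A {} f = \<zero>\<^bsub>P\<^esub>" unfolding supported_on_def prod_alg_simps by simp
      then show ?case using H unfolding P.submodule_iff by simp
    next
      case (insert i S)
      then show ?case
        using supported_on_insert[OF f, of i S] P.submoduleE(5)[OF H _ comp[of i]] by simp
    qed
  qed
  then show ?thesis using supported_on_all[OF f] by fastforce
qed

lemma conductor_ideal: "alg_ideal K P conductor"
proof -
  have id: "alg_ideal K P {f \<in> carrier P. f i \<in> fibre_ideal i (I - {i})}" if "i \<in> I" for i
    by (rule alg_ideal_vimage[OF P.is_nonunital_algebra A[OF that] proj_hom[OF that]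
          fibre_ideal_ideal[OF that]]) blast
  show ?thesis
    unfolding P.alg_ideal_iff conductor_def using id[unfolded P.alg_ideal_iff]
    by (auto simp: P.mult_closed)
qed

lemma conductor_subset: "conductor \<subseteq> C"
proof
  fix f assume f: "f \<in> conductor"
  then have fP: "f \<in> carrier P" unfolding conductor_def by blast
  show "f \<in> C"
  proof (rule mem_if_components_mem[OF subalg_submodule[OF C_subalg] fP])
    fix i assume i: "i \<in> I"
    then obtain c where c: "c \<in> C" "\<forall>j\<in>I - {i}. c j = \<zero>\<^bsub>A j\<^esub>" "f i = c i"
      using f unfolding conductor_def fibre_ideal_def by blast
    have "c \<in> extensional I"
      using c(1) P.subalg_subset[OF C_subalg] unfolding prod_alg_simps PiE_def by blast
    then have "supported_on I A {i} (\<lambda>_. f i) = c"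
      using c(2,3) unfolding supported_on_def by (auto simp: fun_eq_iff extensional_def)
    then show "supported_on I A {i} (\<lambda>_. f i) \<in> C" using c(1) by simp
  qed
qed

lemma finite_corank_conductor:
  assumes fg: "\<And>i. i \<in> I \<Longrightarrow> fin_gen_alg K (A i)"
  shows "finite_corank K P conductor"
proof -
  have "\<exists>T. finite T \<and> T \<subseteq> carrier (A i) \<and> module_gen K (A i) (fibre_ideal i (I - {i}) \<union> T) = carrier (A i)"
    if i: "i \<in> I" for i
    by (rule module.finite_corank_span[OF nonunital_algebra.is_module[OF A[OF i]]
          finite_corank_fibre[OF i fg[OF i] subset_refl]]) blast
  then obtain T where T: "\<And>i. i \<in> I \<Longrightarrow> finite (T i) \<and> T i \<subseteq> carrier (A i) \<and>
      module_gen K (A i) (fibre_ideal i (I - {i}) \<union> T i) = carrier (A i)"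
    by metis
  let ?em = "\<lambda>i a. supported_on I A {i} (\<lambda>_. a)"
  define U where "U = (\<Union>i\<in>I. ?em i ` T i)"
  have em: "?em i \<in> lin_map K (A i) P" if "i \<in> I" for i
    by (rule alg_hom_lin_map[OF embed_hom[OF subset_refl that]])
  have U: "finite U" "U \<subseteq> carrier P"
    unfolding U_def using finite_I T lin_mapE(1)[OF em] by (blast, fast)
  have cU: "conductor \<union> U \<subseteq> carrier P" using P.alg_ideal_subset[OF conductor_ideal] U(2) by blast
  let ?W = "module_gen K P (conductor \<union> U)"
  have W: "submodule ?W K P" by (rule P.module_gen_submodule[OF cU])
  have sup: "conductor \<union> U \<subseteq> ?W" by (rule module_gen_superset)
  have comp: "?em i a \<in> ?W" if i: "i \<in> I" and a: "a \<in> carrier (A i)" for i a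
  proof (rule lin_map_module_gen[OF nonunital_algebra.is_module[OF A[OF i]] P.is_module em[OF i] _ W])
    show "a \<in> module_gen K (A i) (fibre_ideal i (I - {i}) \<union> T i)" using T[OF i] a by blast
    have fc: "fibre_ideal i (I - {i}) \<subseteq> carrier (A i)"
      using nonunital_algebra.alg_ideal_subset[OF A[OF i] fibre_ideal_ideal[OF i]] by blast
    then show "fibre_ideal i (I - {i}) \<union> T i \<subseteq> carrier (A i)" using T[OF i] by blast
    fix s assume "s \<in> fibre_ideal i (I - {i}) \<union> T i"
    then show "?em i s \<in> ?W"
    proof
      assume s: "s \<in> fibre_ideal i (I - {i})"
      have "\<zero>\<^bsub>A j\<^esub> \<in> fibre_ideal j (I - {j})" if "j \<in> I" for j
        using fibre_ideal_ideal[OF that, of "I - {j}"] nonunital_algebra.alg_ideal_iff[OF A[OF that]] by blast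
      moreover have "?em i s \<in> carrier P" using lin_mapE(1)[OF em[OF i]] s fc by blast
      ultimately have "?em i s \<in> conductor" using s unfolding conductor_def supported_on_def by simp
      then show ?thesis using sup by blast
    next
      assume "s \<in> T i"
      then show ?thesis using sup i unfolding U_def by blast
    qed
  qed
  have "carrier P \<subseteq> ?W"
  proof
    fix f assume f: "f \<in> carrier P"
    show "f \<in> ?W"
      by (rule mem_if_components_mem[OF W f]) (rule comp, use f in \<open>auto simp: prod_alg_simps\<close>)
  qed
  then show ?thesis
    by (intro P.finite_corankI[OF alg_ideal_submodule[OF conductor_ideal] U])
qed

lemma finite_corank_C:
  assumes fg: "\<And>i. i \<in> I \<Longrightarrow> fin_gen_alg K (A i)"
  shows "finite_corank K P C"
proof -
  obtain T where T: "finite T" "T \<subseteq> carrier P" "module_gen K P (conductor \<union> T) = carrier P"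
    using P.finite_corank_span[OF finite_corank_conductor[OF fg]] by blast
  have "conductor \<union> T \<subseteq> C \<union> T" using conductor_subset by blast
  then have "carrier P \<subseteq> module_gen K P (C \<union> T)"
    unfolding T(3)[symmetric] by (rule module_gen_mono)
  then show ?thesis by (rule P.finite_corankI[OF subalg_submodule[OF C_subalg] T(1,2)])
qed

theorem fin_gen_iff:
  "fin_gen_alg K (P\<lparr>carrier := C\<rparr>) \<longleftrightarrow> (\<forall>i\<in>I. fin_gen_alg K (A i))"
proof
  assume "fin_gen_alg K (P\<lparr>carrier := C\<rparr>)"
  then show "\<forall>i\<in>I. fin_gen_alg K (A i)" using fin_gen_coordinate by blast
next
  assume fg: "\<forall>i\<in>I. fin_gen_alg K (A i)"
  then have "fin_gen_alg K P" using fin_gen_prod[OF finite_I subset_refl] by blast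
  then show "fin_gen_alg K (P\<lparr>carrier := C\<rparr>)"
    using P.finiteness_of_subalg_over_finite_corank_ideal(1)[OF noeth conductor_ideal
        finite_corank_conductor C_subalg conductor_subset] fg by blast
qed

theorem fin_pres_iff:
  "fin_pres_alg K (P\<lparr>carrier := C\<rparr>) \<longleftrightarrow> (\<forall>i\<in>I. fin_pres_alg K (A i))"
proof
  assume fp: "fin_pres_alg K (P\<lparr>carrier := C\<rparr>)"
  have "fin_gen_alg K (P\<lparr>carrier := C\<rparr>)"
    by (rule nonunital_algebra.fin_pres_imp_fin_gen[OF P.subalg_algebra[OF C_subalg] fp])
  then have fg: "fin_gen_alg K (A i)" if "i \<in> I" for i using fin_gen_coordinate that by blast
  have "fin_pres_alg K P"
    by (rule fin_pres_alg_of_finite_corank[OF noeth P.is_nonunital_algebra C_subalg finite_corank_C[OF fg] fp])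
  then show "\<forall>i\<in>I. fin_pres_alg K (A i)" using fin_pres_coordinate by blast
next
  assume fp: "\<forall>i\<in>I. fin_pres_alg K (A i)"
  have fg: "fin_gen_alg K (A i)" if "i \<in> I" for i
    using nonunital_algebra.fin_pres_imp_fin_gen[OF A[OF that]] fp that by blast
  have fpP: "fin_pres_alg K P" using fin_pres_prod[OF finite_I subset_refl] fp by blast
  show "fin_pres_alg K (P\<lparr>carrier := C\<rparr>)"
    by (rule P.finiteness_of_subalg_over_finite_corank_ideal(2)[OF noeth conductor_ideal
        finite_corank_conductor[OF fg] C_subalg conductor_subset fin_gen_prod[OF finite_I subset_refl fg] fpP])
qed

end

theorem theorem6p8:
  fixes K :: "('k, 'm) ring_scheme"
    and A :: "nat \<Rightarrow> ('k, 'a, 'n) module_scheme"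
    and C :: "(nat \<Rightarrow> 'a) set"
    and n :: nat
  assumes "cring K" and "noetherian_ring K"
    and "n \<ge> 2"
    and "\<And>i. i \<in> {1..n} \<Longrightarrow> nonunital_algebra K (A i)"
    and "subdirect_product K {1..n} A C"
    and "\<And>i j. \<lbrakk>1 \<le> i; i < j; j \<le> n\<rbrakk> \<Longrightarrow>
           finite_corank K (prod_alg {i, j} A) (pair_proj i j ` C)"
  shows "(fin_gen_alg K ((prod_alg {1..n} A)\<lparr>carrier := C\<rparr>) \<longleftrightarrow>
            (\<forall>i\<in>{1..n}. fin_gen_alg K (A i))) \<and>
         (fin_pres_alg K ((prod_alg {1..n} A)\<lparr>carrier := C\<rparr>) \<longleftrightarrow>
            (\<forall>i\<in>{1..n}. fin_pres_alg K (A i)))"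
proof -
  \<comment> \<open>both the product and the projection depend only on the set of the two indices\<close>
  have pairs: "finite_corank K (prod_alg {i, j} A) (pair_proj i j ` C)"
    if "i \<in> {1..n}" "j \<in> {1..n}" "i \<noteq> j" for i j
  proof (cases "i < j")
    case True
    then show ?thesis using assms(6) that by simp
  next
    case False
    then have "finite_corank K (prod_alg {j, i} A) (pair_proj j i ` C)" using assms(6) that by simp
    moreover have "{j, i} = {i, j}" by blast
    moreover have "pair_proj j i = (pair_proj i j :: (nat \<Rightarrow> 'a) \<Rightarrow> _)"
      unfolding pair_proj_def by (simp add: insert_commute)
    ultimately show ?thesis by simp
  qed
  interpret virtually_surjective_subdirect_product K "{1..n}" A C
    by (intro virtually_surjective_subdirect_product.intro algebra_family.intro assms(1)
        algebra_family_axioms.intro virtually_surjective_subdirect_product_axioms.intro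
        assms(2,4,5) pairs finite_atLeastAtMost)
  show ?thesis using fin_gen_iff fin_pres_iff by blast
qed

end
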